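(* Let $n\ge1$ and $\beta>0$. Suppose the twice differentiable function $v:\mathbb{R}^n\to(0,\infty)$ satisfies $\int_{\mathbb{R}^n}v\,dx=1$ and $\int_{\mathbb{R}^n}|x|^2v\,dx<\infty$. Suppose that either (1) $\beta>1$ and $0\ge\nabla^2\log v\ge-\frac1\beta\,\mathrm{id}$ on $\mathbb{R}^n$, or (2) $0<\beta<1$ and $v$ is $\beta$-semi-log-concave, i.e. $\nabla^2\log v\le-\frac1\beta\,\mathrm{id}$ on $\mathbb{R}^n$. Then $$\frac12W_2(\gamma,v)^2-\mathrm{Ent}_\gamma\Big(\frac v\gamma\Big)\le\frac12W_2(\gamma,\gamma_\beta)^2-\mathrm{Ent}_\gamma\Big(\frac{\gamma_\beta}\gamma\Big).$$
   Context: For $\beta>0$, $\gamma_\beta(x)=(2\pi\beta)^{-n/2}e^{-|x|^2/(2\beta)}$ on $\mathbb{R}^n$, $\gamma=\gamma_1$, $d\gamma=\gamma(x)\,dx$. $\mathrm{Ent}_\gamma(f)=\int f\log f\,d\gamma-(\int f\,d\gamma)\log(\int f\,d\gamma)$. Probability densities are identified with the probability measures they define, and $W_2$ is the quadratic Wasserstein distance $W_2(\mu,\nu)^2=\inf_{\pi}\int|x-y|^2\,d\pi(x,y)$, the infimum being over all couplings $\pi$ of $\mu$ and $\nu$ on $\mathbb{R}^n\times\mathbb{R}^n$. Matrix inequalities are in the sense of symmetric matrices. *)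

theory Defs
  imports "HOL-Analysis.Analysis"
begin

definition gauss_density :: "real \<Rightarrow> real^'n \<Rightarrow> real" where
  "gauss_density \<beta> x =
     (2 * pi * \<beta>) powr (- real CARD('n) / 2) * exp (- (norm x)\<^sup>2 / (2 * \<beta>))"

definition density_measure :: "(real^'n \<Rightarrow> real) \<Rightarrow> (real^'n) measure" where
  "density_measure f = density lborel (\<lambda>x. ennreal (f x))"

text \<open>
  The integrals are Bochner integrals, which are 0 for non-integrable functions; the value is the
  usual entropy whenever \<open>f\<close> and \<open>f log f\<close> are integrable, as they are for \<open>f = v / \<gamma>\<close> with respect
  to the standard Gaussian, if \<open>v\<close> is a log-concave probability density. The convention \<open>ln 0 = 0\<close>
  gives \<open>0 log 0 = 0\<close>.
\<close>
definition Ent :: "'a measure \<Rightarrow> ('a \<Rightarrow> real) \<Rightarrow> real" where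
  "Ent M f = (\<integral>x. f x * ln (f x) \<partial>M) - (\<integral>x. f x \<partial>M) * ln (\<integral>x. f x \<partial>M)"

definition couplings :: "'a measure \<Rightarrow> 'b measure \<Rightarrow> ('a \<times> 'b) measure set" where
  "couplings \<mu> \<nu> =
     {\<pi>. sets \<pi> = sets (\<mu> \<Otimes>\<^sub>M \<nu>) \<and> distr \<pi> \<mu> fst = \<mu> \<and> distr \<pi> \<nu> snd = \<nu>}"

text \<open>
  The infimum is taken in the extended nonnegative reals. It is finite for probability measures with
  finite second moments (consider the product coupling), so that \<open>enn2real\<close> loses nothing there.
\<close>
definition W2 :: "(real^'n) measure \<Rightarrow> (real^'n) measure \<Rightarrow> real" where
  "W2 \<mu> \<nu> =
     sqrt (enn2real (INF \<pi>\<in>couplings \<mu> \<nu>. \<integral>\<^sup>+ p. ennreal ((norm (fst p - snd p))\<^sup>2) \<partial>\<pi>))"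

definition gradient :: "(real^'n \<Rightarrow> real) \<Rightarrow> real^'n \<Rightarrow> real^'n" where
  "gradient f x = (\<chi> i. frechet_derivative f (at x) (axis i 1))"

definition twice_differentiable :: "(real^'n \<Rightarrow> real) \<Rightarrow> bool" where
  "twice_differentiable f \<longleftrightarrow>
     (\<forall>x. f differentiable (at x)) \<and> (\<forall>x. gradient f differentiable (at x))"

definition hessian :: "(real^'n \<Rightarrow> real) \<Rightarrow> real^'n \<Rightarrow> real^'n^'n" where
  "hessian f x = jacobian (gradient f) (at x)"

text \<open>
  The order of symmetric matrices. Symmetry is not part of the relation: it is applied only to
  multiples of the identity and to Hessians of twice (Frechet) differentiable functions, which are
  symmetric.
\<close>
definition loewner_le :: "real^'n^'n \<Rightarrow> real^'n^'n \<Rightarrow> bool" where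
  "loewner_le A B \<longleftrightarrow> (\<forall>w. w \<bullet> (A *v w) \<le> w \<bullet> (B *v w))"

definition semi_log_concave :: "real \<Rightarrow> (real^'n \<Rightarrow> real) \<Rightarrow> bool" where
  "semi_log_concave \<beta> v \<longleftrightarrow>
     (\<forall>x. loewner_le (hessian (\<lambda>y. ln (v y)) x) ((- (1 / \<beta>)) *\<^sub>R mat 1))"

end

theory Submission
  imports Defs "HOL-Probability.Probability"
begin

text \<open>
  Since \<open>W\<^sub>2\<close> is an infimum over couplings, any map \<open>T\<close> pushing \<open>\<gamma>\<close> to \<open>v\<close> bounds the left-hand side, and the
  triangular Knothe map can replace the Brenier map: with diagonal derivatives \<open>s\<^sub>i\<close> of \<open>T\<close> the left-hand side is at
  most \<open>\<integral> (\<Sum>i. 1 - s\<^sub>i + ln s\<^sub>i) d\<gamma>\<close>. Each \<open>s\<^sub>i\<close> is the derivative of a one-dimensional monotone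
  rearrangement of \<open>\<gamma>\<close> onto a conditional density of \<open>v\<close>. Marginals, hence conditional densities, inherit the
  semi-log-concavity (Prekopa) or semi-log-convexity (Hoelder), and in dimension one this forces \<open>s\<^sub>i \<le> \<sigma> < 1\<close>
  or \<open>s\<^sub>i \<ge> \<sigma> > 1\<close> with \<open>\<sigma> = sqrt \<beta>\<close>. As \<open>1 - s + ln s\<close> increases on \<open>(0, 1]\<close> and decreases afterwards, the
  left-hand side is at most \<open>n (1 - \<sigma> + ln \<sigma>)\<close>, the value at \<open>\<gamma>\<^sub>\<beta>\<close>.
\<close>

section \<open>Monotone rearrangement on the line\<close>

text \<open>Integrability shapes the proof: \<open>Ent\<close> and \<open>W2\<close> are
  real-valued, while the conditional densities met in the induction come with no entropy bound.
  Relative entropy is therefore carried as the integral of the nonnegative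
  \<open>a * ln (a / b) - a + b\<close>, whose last two terms cancel for probability densities. The
  chain rule and the transport inequality then hold in \<open>[0, \<infinity>]\<close>, with
  deficits added on the left instead of subtracted, and finiteness is proved once, for
  \<open>v\<close> itself, from a pointwise upper bound. The inequality tensorizes because the
  squared distance splits over the coordinates and the entropy obeys the chain rule. In dimension
  one its source is \<open>f (R t) * R' t = \<gamma> t\<close> together with the Gaussian
  integration by parts of R' into t R, which also makes the second moment of R cancel between cost
  and entropy. The constant \<sigma> is the slope of the linear map that carries \<gamma> to
  \<gamma>_\<beta>. For \<gamma>_\<beta> the entropy is explicit, and of \<open>W2\<close> only a
  lower bound is required, which every coupling satisfies by an elementary quadratic inequality. The
  two cases run through a single induction with a sign \<epsilon>.\<close>

definition pos_density :: "(real \<Rightarrow> real) \<Rightarrow> bool" where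
  "pos_density f \<longleftrightarrow> (\<forall>t. 0 < f t) \<and> continuous_on UNIV f \<and> integrable lborel f \<and> integral\<^sup>L lborel f = 1"

abbreviation law :: "(real \<Rightarrow> real) \<Rightarrow> real measure" where
  "law f \<equiv> density lborel (\<lambda>t. ennreal (f t))"

lemma pos_densityD:
  assumes "pos_density f"
  shows "0 < f t" "0 \<le> f t" "isCont f t" "f \<in> borel_measurable borel" "integrable lborel f"
    "integral\<^sup>L lborel f = 1" "(\<integral>\<^sup>+t. ennreal (f t) \<partial>lborel) = 1"
proof -
  show *: "0 < f t" for t using assms by (auto simp: pos_density_def)
  then show "0 \<le> f t" for t using less_imp_le by blast
  show "isCont f t" using assms by (auto simp: pos_density_def continuous_on_eq_continuous_at)
  show "f \<in> borel_measurable borel"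
    using assms by (auto simp: pos_density_def intro: borel_measurable_continuous_onI)
  show i: "integrable lborel f" "integral\<^sup>L lborel f = 1" using assms by (auto simp: pos_density_def)
  show "(\<integral>\<^sup>+t. ennreal (f t) \<partial>lborel) = 1"
    using i * by (subst nn_integral_eq_integral) (auto simp: less_imp_le)
qed

lemma real_distribution_law: "pos_density f \<Longrightarrow> real_distribution (law f)"
  unfolding real_distribution_def real_distribution_axioms_def
  by (auto intro!: prob_spaceI simp: emeasure_density pos_densityD)

lemma measure_law:
  assumes f: "pos_density f" and A: "A \<in> sets borel"
  shows "measure (law f) A = (\<integral>t. indicator A t * f t \<partial>lborel)"
proof -
  note [measurable] = pos_densityD(4)[OF f] A
  have i: "integrable lborel (\<lambda>t. indicator A t * f t)"
    using integrable_mult_indicator[OF _ pos_densityD(5)[OF f], of A] A by simp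
  have "emeasure (law f) A = (\<integral>\<^sup>+t. ennreal (indicator A t * f t) \<partial>lborel)"
    by (subst emeasure_density) (auto intro!: nn_integral_cong split: split_indicator)
  also have "\<dots> = ennreal (\<integral>t. indicator A t * f t \<partial>lborel)"
    using i by (rule nn_integral_eq_integral) (auto simp: pos_densityD[OF f])
  finally show ?thesis
    by (simp add: measure_def Bochner_Integration.integral_nonneg pos_densityD[OF f])
qed

lemma cdf_law_diff:
  assumes f: "pos_density f" and "a \<le> b"
  shows "cdf (law f) b - cdf (law f) a = integral {a..b} f"
proof -
  interpret real_distribution "law f" using f by (rule real_distribution_law)
  note [measurable] = pos_densityD(4)[OF f]
  have c: "continuous_on {a..b} f"
    using f by (auto simp: pos_density_def intro: continuous_on_subset)
  have "cdf (law f) b - cdf (law f) a = measure (law f) {a<..b}" if "a < b"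
    using cdf_diff_eq[OF that] .
  also have "measure (law f) {a<..b} = (\<integral>t. indicator {a<..b} t * f t \<partial>lborel)"
    by (rule measure_law[OF f]) auto
  also have "\<dots> = (\<integral>t. indicator {a..b} t *\<^sub>R f t \<partial>lborel)"
  proof (rule integral_cong_AE)
    show "AE t in lborel. indicator {a<..b} t * f t = indicator {a..b} t *\<^sub>R f t"
      using AE_lborel_singleton[of a] by eventually_elim (auto split: split_indicator)
  qed measurable
  also have "\<dots> = integral {a..b} f"
    using set_borel_integral_eq_integral(2)[OF borel_integrable_atLeastAtMost', OF c]
    by (simp add: set_lebesgue_integral_def)
  finally show ?thesis using assms(2) by (cases "a = b") auto
qed

lemma DERIV_cdf_law:
  assumes f: "pos_density f"
  shows "(cdf (law f) has_real_derivative f x) (at x)"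
proof -
  \<comment> \<open>Starting the primitive at x - 1 keeps x in the interior, so the derivative
    within the interval is a two-sided one.\<close>
  have c: "continuous_on {x-1..x+1} f"
    using f by (auto simp: pos_density_def intro: continuous_on_subset)
  have "((\<lambda>u. integral {x-1..u} f) has_real_derivative f x) (at x within {x-1..x+1})"
    by (rule integral_has_real_derivative[OF c]) auto
  then have "((\<lambda>u. integral {x-1..u} f) has_real_derivative f x) (at x)"
    by (subst (asm) at_within_interior) (auto simp: interior_atLeastAtMost_real)
  then have "((\<lambda>u. cdf (law f) (x-1) + integral {x-1..u} f) has_real_derivative f x) (at x)"
    by (auto intro!: derivative_eq_intros)
  then show ?thesis
  proof (rule has_field_derivative_transform_within[where d=1])
    fix u assume "dist u x < 1"
    then show "cdf (law f) (x-1) + integral {x-1..u} f = cdf (law f) u"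
      using cdf_law_diff[OF f, of "x-1" u] by (simp add: dist_real_def abs_less_iff algebra_simps)
  qed auto
qed

lemma cdf_law_less:
  assumes f: "pos_density f" and "a < b"
  shows "cdf (law f) a < cdf (law f) b"
  by (rule DERIV_pos_imp_increasing[OF assms(2)]) (blast intro: DERIV_cdf_law[OF f] pos_densityD(1)[OF f])

lemma cdf_law_mono: "pos_density f \<Longrightarrow> cdf (law f) a \<le> cdf (law f) b \<longleftrightarrow> a \<le> b"
  using cdf_law_less[of f a b] cdf_law_less[of f b a] by (cases a b rule: linorder_cases) auto

lemma cdf_law_bounds:
  assumes f: "pos_density f" shows "0 < cdf (law f) a" "cdf (law f) a < 1"
proof -
  interpret real_distribution "law f" using f by (rule real_distribution_law)
  show "0 < cdf (law f) a"
    using cdf_law_less[OF f, of "a-1" a] cdf_nonneg[of "a-1"] by auto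
  show "cdf (law f) a < 1"
    using cdf_law_less[OF f, of a "a+1"] cdf_bounded_prob[of "a+1"] by auto
qed

lemma cdf_law_surj:
  assumes f: "pos_density f" and p: "0 < p" "p < 1"
  shows "\<exists>!s. cdf (law f) s = p"
proof -
  interpret real_distribution "law f" using f by (rule real_distribution_law)
  have "eventually (\<lambda>s. cdf (law f) s < p) at_bot"
    using cdf_lim_at_bot p by (auto simp: order_tendsto_iff)
  then obtain a where a: "cdf (law f) a < p" by (auto simp: eventually_at_bot_linorder)
  have "eventually (\<lambda>s. cdf (law f) s > p) at_top"
    using cdf_lim_at_top_prob p by (auto simp: order_tendsto_iff)
  then obtain b where b: "p < cdf (law f) b" by (auto simp: eventually_at_top_linorder)
  have "a \<le> b" using a b cdf_law_mono[OF f, of a b] by linarith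
  have "\<exists>s\<ge>a. s \<le> b \<and> cdf (law f) s = p"
    by (rule IVT) (use a b \<open>a \<le> b\<close> DERIV_isCont[OF DERIV_cdf_law[OF f]] in auto)
  moreover have "s = s'" if "cdf (law f) s = cdf (law f) s'" for s s'
    using that cdf_law_mono[OF f, of s s'] cdf_law_mono[OF f, of s' s] by auto
  ultimately show ?thesis by metis
qed

text \<open>Meaningful only for p strictly between 0 and 1; the cdf of a \<open>pos_density\<close>
  takes no other values.\<close>

definition quantile :: "(real \<Rightarrow> real) \<Rightarrow> real \<Rightarrow> real" where
  "quantile b p = (THE s. cdf (law b) s = p)"

definition rearr :: "(real \<Rightarrow> real) \<Rightarrow> (real \<Rightarrow> real) \<Rightarrow> real \<Rightarrow> real" where
  "rearr a b t = quantile b (cdf (law a) t)"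

lemma cdf_quantile: "pos_density b \<Longrightarrow> 0 < p \<Longrightarrow> p < 1 \<Longrightarrow> cdf (law b) (quantile b p) = p"
  unfolding quantile_def by (rule theI'[OF cdf_law_surj])

lemma cdf_rearr:
  assumes "pos_density a" "pos_density b"
  shows "cdf (law b) (rearr a b t) = cdf (law a) t"
  unfolding rearr_def by (rule cdf_quantile) (use assms cdf_law_bounds in auto)

text \<open>This Galois connection turns sublevel sets of the rearrangement into inequalities
  between cdfs. The image law and, later, the joint measurability of the Knothe map both follow from
  it.\<close>

lemma rearr_le_iff:
  assumes "pos_density a" "pos_density b"
  shows "rearr a b t \<le> s \<longleftrightarrow> cdf (law a) t \<le> cdf (law b) s"
  using cdf_law_mono[OF assms(2), of "rearr a b t" s] cdf_rearr[OF assms] by simp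

lemma rearr_strict_mono:
  assumes "pos_density a" "pos_density b" "t < t'"
  shows "rearr a b t < rearr a b t'"
  using cdf_law_mono[OF assms(2), of "rearr a b t'" "rearr a b t"] cdf_rearr[OF assms(1,2)] cdf_law_less[OF assms(1,3)]
  by (auto simp: not_le[symmetric])

lemma quantile_cdf: "pos_density b \<Longrightarrow> quantile b (cdf (law b) z) = z"
  unfolding quantile_def by (rule the1_equality[OF cdf_law_surj]) (use cdf_law_bounds in auto)

lemma isCont_quantile:
  assumes b: "pos_density b"
  shows "isCont (quantile b) (cdf (law b) x)"
proof (rule isCont_inverse_function2[of "x-1" x "x+1" "quantile b" "cdf (law b)"])
  fix z show "quantile b (cdf (law b) z) = z" by (rule quantile_cdf[OF b])
  show "isCont (cdf (law b)) z" by (rule DERIV_isCont[OF DERIV_cdf_law[OF b]])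
qed auto

text \<open>Differentiating \<open>cdf (law b) (R t) = cdf (law a) t\<close> gives the
  one-dimensional Monge-Ampere equation \<open>b (R t) * R' t = a t\<close>.\<close>

lemma DERIV_rearr:
  assumes a: "pos_density a" and b: "pos_density b"
  shows "(rearr a b has_real_derivative a t / b (rearr a b t)) (at t)"
proof -
  have "DERIV (quantile b) (cdf (law b) x) :> inverse (b x)" for x
  proof (rule DERIV_inverse_function)
    show "(cdf (law b) has_real_derivative b x) (at (quantile b (cdf (law b) x)))"
      by (simp add: quantile_cdf[OF b] DERIV_cdf_law[OF b])
    show "b x \<noteq> 0" using pos_densityD(1)[OF b, of x] by simp
    show "0 < cdf (law b) x" "cdf (law b) x < 1" using cdf_law_bounds[OF b] .
    show "cdf (law b) (quantile b y) = y" if "0 < y" "y < 1" for y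
      by (rule cdf_quantile[OF b that])
    show "isCont (quantile b) (cdf (law b) x)" by (rule isCont_quantile[OF b])
  qed
  then have "DERIV (quantile b) (cdf (law a) t) :> inverse (b (rearr a b t))"
    by (metis cdf_rearr[OF a b])
  from DERIV_chain[OF this DERIV_cdf_law[OF a]] show ?thesis
    by (simp add: rearr_def[abs_def] comp_def divide_inverse mult.commute)
qed

lemma isCont_rearr:
  assumes "pos_density a" "pos_density b" shows "isCont (rearr a b) t"
  by (rule DERIV_isCont[OF DERIV_rearr[OF assms]])

lemma rearr_measurable [measurable]:
  assumes "pos_density a" "pos_density b" shows "rearr a b \<in> borel_measurable borel"
  using isCont_rearr[OF assms]
  by (intro borel_measurable_continuous_onI) (simp add: continuous_on_eq_continuous_at)

lemma distr_rearr:
  assumes a: "pos_density a" and b: "pos_density b"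
  shows "distr (law a) borel (rearr a b) = law b"
proof -
  interpret A: real_distribution "law a" using a by (rule real_distribution_law)
  interpret B: real_distribution "law b" using b by (rule real_distribution_law)
  have m: "rearr a b \<in> measurable (law a) borel" using rearr_measurable[OF a b] by simp
  show ?thesis
  proof (rule cdf_unique)
    show "real_distribution (distr (law a) borel (rearr a b))"
      using m by (rule A.real_distribution_distr)
    show "real_distribution (law b)" by (rule B.real_distribution_axioms)
    show "cdf (distr (law a) borel (rearr a b)) = cdf (law b)"
    proof
      fix s
      have "cdf (distr (law a) borel (rearr a b)) s = measure (law a) {t. rearr a b t \<le> s}"
        unfolding cdf_def2 using m by (subst measure_distr) (auto simp: vimage_def)
      \<comment> \<open>The sublevel set is a half-line, and its endpoint is the inverse
        rearrangement \<open>rearr b a\<close> at s.\<close>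
      also have "{t. rearr a b t \<le> s} = {.. rearr b a s}"
        by (auto simp: rearr_le_iff[OF a b] cdf_law_mono[OF a] simp flip: cdf_rearr[OF b a, of s])
      also have "measure (law a) \<dots> = cdf (law b) s"
        using cdf_rearr[OF b a] by (simp add: cdf_def2)
      finally show "cdf (distr (law a) borel (rearr a b)) s = cdf (law b) s" .
    qed
  qed
qed

lemma nn_integral_rearr:
  assumes a: "pos_density a" and b: "pos_density b" and [measurable]: "\<phi> \<in> borel_measurable borel"
  shows "(\<integral>\<^sup>+t. ennreal (a t) * \<phi> (rearr a b t) \<partial>lborel) = (\<integral>\<^sup>+s. ennreal (b s) * \<phi> s \<partial>lborel)"
proof -
  note [measurable] = rearr_measurable[OF a b] pos_densityD(4)[OF a] pos_densityD(4)[OF b]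
  have "(\<integral>\<^sup>+s. ennreal (b s) * \<phi> s \<partial>lborel) = integral\<^sup>N (law b) \<phi>"
    by (subst nn_integral_density) auto
  also have "\<dots> = integral\<^sup>N (law a) (\<lambda>t. \<phi> (rearr a b t))"
    by (subst distr_rearr[OF a b, symmetric], subst nn_integral_distr) auto
  also have "\<dots> = (\<integral>\<^sup>+t. ennreal (a t) * \<phi> (rearr a b t) \<partial>lborel)"
    by (subst nn_integral_density) auto
  finally show ?thesis ..
qed

section \<open>Comparison with Gaussians and the one-dimensional deficit\<close>

lemma pos_density_normal:
  assumes "0 < \<sigma>" shows "pos_density (normal_density 0 \<sigma>)"
  unfolding pos_density_def
proof (intro conjI allI)
  show "continuous_on UNIV (normal_density 0 \<sigma>)"
    unfolding normal_density_def by (intro continuous_intros) (use assms in auto)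
qed (use assms in \<open>auto simp: normal_density_pos\<close>)

text \<open>The rearrangement of \<gamma> onto the centred normal law of deviation \<sigma> is
  multiplication by \<sigma>, so the points to be matched with t in the comparison below are
  multiples of t.\<close>

lemma cdf_law_scale_normal:
  assumes s: "0 < \<sigma>"
  shows "cdf (law (normal_density 0 \<sigma>)) (\<sigma> * t) = cdf (law std_normal_density) t"
proof -
  have *: "\<sigma> * normal_density 0 \<sigma> (\<sigma> * x) = std_normal_density x" for x
    using s by (simp add: normal_density_def real_sqrt_mult power_mult_distrib)
  have "emeasure (law (normal_density 0 \<sigma>)) {..\<sigma> * t}
      = (\<integral>\<^sup>+x. ennreal (normal_density 0 \<sigma> x) * indicator {..\<sigma> * t} x \<partial>lborel)"
    by (subst emeasure_density) auto
  also have "\<dots> = ennreal \<sigma> * (\<integral>\<^sup>+x. ennreal (normal_density 0 \<sigma> (\<sigma> * x)) * indicator {..\<sigma> * t} (\<sigma> * x) \<partial>lborel)"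
    using s by (subst nn_integral_real_affine[where c=\<sigma> and t=0]) auto
  also have "\<dots> = (\<integral>\<^sup>+x. ennreal (std_normal_density x) * indicator {..t} x \<partial>lborel)"
    using s by (subst nn_integral_cmult[symmetric])
      (auto intro!: nn_integral_cong split: split_indicator simp: ennreal_mult[symmetric] *)
  also have "\<dots> = emeasure (law std_normal_density) {..t}"
    by (subst emeasure_density) auto
  finally show ?thesis by (simp add: cdf_def2 measure_def)
qed

text \<open>If \<open>a\<close> were smaller than \<open>b\<close> on a whole half-line ending at the matched points, the mass of that
  half-line could not agree.\<close>
lemma not_less_on_half_line:
  assumes a: "pos_density a" and b: "pos_density b" and eq: "cdf (law a) s = cdf (law b) r"
  shows "\<exists>h\<le>0. b (r + h) \<le> a (s + h)" "\<exists>h\<ge>0. b (r + h) \<le> a (s + h)"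
proof -
  interpret A: real_distribution "law a" using a by (rule real_distribution_law)
  interpret B: real_distribution "law b" using b by (rule real_distribution_law)
  define D where "D h = cdf (law b) (r + h) - cdf (law a) (s + h)" for h
  have DD: "(D has_real_derivative b (r + h) - a (s + h)) (at h)" for h
    unfolding D_def
    using DERIV_cdf_law[OF a, of "s + h"] DERIV_cdf_law[OF b, of "r + h"]
    by (intro DERIV_diff) (simp_all add: DERIV_at_within_shift add.commute[of s] add.commute[of r] DERIV_shift)
  have D0: "D 0 = 0" using eq by (simp add: D_def)
  have inc: "D x < D y" if "x < y" "\<And>h. x \<le> h \<Longrightarrow> h \<le> y \<Longrightarrow> a (s + h) < b (r + h)" for x y
    by (rule DERIV_pos_imp_increasing[OF that(1)]) (use DD that(2) in \<open>metis diff_gt_0_iff_gt\<close>)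
  show "\<exists>h\<le>0. b (r + h) \<le> a (s + h)"
  proof (rule ccontr)
    assume nt: "\<not> ?thesis"
    then have *: "a (s + h) < b (r + h)" if "h \<le> 0" for h using that nt by (meson not_le)
    have "filterlim (\<lambda>h. x + h) at_bot at_bot" for x :: real by real_asymp
    then have "((\<lambda>h. cdf (law b) (r + h) - cdf (law a) (s + h)) \<longlongrightarrow> 0 - 0) at_bot"
      by (intro tendsto_diff filterlim_compose[OF B.cdf_lim_at_bot] filterlim_compose[OF A.cdf_lim_at_bot])
    then have "(D \<longlongrightarrow> 0) at_bot" unfolding D_def[abs_def] by simp
    \<comment> \<open>A strictly increasing \<open>D\<close> stays below the negative number
      \<open>D (-1)\<close> further to the left, which contradicts its limit 0.\<close>
    moreover have "D (-1) < 0" using inc[of "-1" 0] * D0 by auto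
    ultimately have "eventually (\<lambda>h. D (-1) < D h) at_bot" by (auto simp: order_tendsto_iff)
    then obtain h where "h < -1" "D (-1) < D h"
      unfolding eventually_at_bot_linorder by (metis less_eq_real_def linorder_le_less_linear lt_ex order_less_trans)
    then show False using inc[of h "-1"] * by force
  qed
  show "\<exists>h\<ge>0. b (r + h) \<le> a (s + h)"
  proof (rule ccontr)
    assume nt: "\<not> ?thesis"
    then have *: "a (s + h) < b (r + h)" if "h \<ge> 0" for h using that nt by (meson not_le)
    have "filterlim (\<lambda>h. x + h) at_top at_top" for x :: real by real_asymp
    then have "((\<lambda>h. cdf (law b) (r + h) - cdf (law a) (s + h)) \<longlongrightarrow> 1 - 1) at_top"
      by (intro tendsto_diff filterlim_compose[OF B.cdf_lim_at_top_prob] filterlim_compose[OF A.cdf_lim_at_top_prob])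
    then have "(D \<longlongrightarrow> 0) at_top" unfolding D_def[abs_def] by simp
    moreover have "0 < D 1" using inc[of 0 1] * D0 by auto
    ultimately have "eventually (\<lambda>h. D h < D 1) at_top" by (auto simp: order_tendsto_iff)
    then obtain h where "h > 1" "D h < D 1"
      unfolding eventually_at_top_linorder by (metis gt_ex less_eq_real_def linorder_le_less_linear order_less_trans)
    then show False using inc[of 1 h] * by force
  qed
qed

text \<open>The logarithm of the shifted ratio a / b is concave and, the masses of both half-lines
  being matched, nonnegative somewhere on each side of 0. Concavity makes it nonnegative at 0. This
  replaces the maximum principle for the derivative of the transport map.\<close>

lemma density_le_of_log_concave_ratio:
  assumes a: "pos_density a" and b: "pos_density b" and eq: "cdf (law a) s = cdf (law b) r"
    and conc: "\<And>x y l. 0 \<le> l \<Longrightarrow> l \<le> 1 \<Longrightarrow>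
      (1 - l) * (ln (a (s + x)) - ln (b (r + x))) + l * (ln (a (s + y)) - ln (b (r + y)))
        \<le> ln (a (s + ((1 - l) * x + l * y))) - ln (b (r + ((1 - l) * x + l * y)))"
  shows "b r \<le> a s"
proof (rule ccontr)
  assume less: "\<not> b r \<le> a s"
  define q where "q h = ln (a (s + h)) - ln (b (r + h))" for h
  have q: "0 \<le> q h \<longleftrightarrow> b (r + h) \<le> a (s + h)" for h
    using pos_densityD(1)[OF a, of "s+h"] pos_densityD(1)[OF b, of "r+h"] by (simp add: q_def)
  obtain x y where xy: "x \<le> 0" "0 \<le> y" "0 \<le> q x" "0 \<le> q y"
    using not_less_on_half_line[OF a b eq] q by blast
  have q0: "q 0 < 0" using less q[of 0] by auto
  then have "x \<noteq> 0" "y \<noteq> 0" using xy by auto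
  then have xy': "x < 0" "0 < y" using xy by auto
  \<comment> \<open>The weight that writes 0 as a convex combination of x and y.\<close>
  define l where "l = - x / (y - x)"
  have l: "0 \<le> l" "l \<le> 1" "(1 - l) * x + l * y = 0"
    using xy' by (auto simp: l_def field_simps)
  have "(1 - l) * q x + l * q y \<le> q ((1 - l) * x + l * y)"
    using conc[of l x y] l(1,2) unfolding q_def .
  moreover have "0 \<le> (1 - l) * q x" "0 \<le> l * q y" using l xy by simp_all
  ultimately show False using l(3) q0 by simp
qed

lemma ln_normal_density:
  "0 < \<sigma> \<Longrightarrow> ln (normal_density 0 \<sigma> x) = - ln (sqrt (2 * pi * \<sigma>\<^sup>2)) - x\<^sup>2 / (2 * \<sigma>\<^sup>2)"
  by (simp add: normal_density_def ln_mult ln_div)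

text \<open>Since the rearrangement R has derivative \<gamma>(t) / f(R t), this says that R' is at
  most \<sigma>: the one-dimensional Caffarelli contraction, obtained by comparing f with the normal
  density of deviation \<sigma> at the matched points R t and \<sigma> t.\<close>

lemma rearr_normal_density_le:
  assumes f: "pos_density f" and s: "0 < \<sigma>"
    and conc: "concave_on UNIV (\<lambda>t. ln (f t) + t\<^sup>2 / (2 * \<sigma>\<^sup>2))"
  shows "std_normal_density t / \<sigma> \<le> f (rearr std_normal_density f t)"
proof -
  let ?g = "normal_density 0 \<sigma>" and ?s = "rearr std_normal_density f t" and ?r = "\<sigma> * t"
  define \<psi> where "\<psi> = (\<lambda>t. ln (f t) + t\<^sup>2 / (2 * \<sigma>\<^sup>2))"
  note N = pos_density_normal[of 1, simplified]
  have eq: "cdf (law f) ?s = cdf (law ?g) ?r"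
    using cdf_rearr[OF N f] cdf_law_scale_normal[OF s] by simp
  have "?g ?r \<le> f ?s"
  proof (rule density_le_of_log_concave_ratio[OF f pos_density_normal[OF s] eq])
    \<comment> \<open>Although the two densities are shifted by different points, the squares of h
      cancel and the difference from \<psi> is affine in h, which does not affect concavity.\<close>
    obtain c d where *: "ln (f (?s + h)) - ln (?g (?r + h)) = \<psi> (?s + h) + c + d * h" for h
    proof
      show "ln (f (?s + h)) - ln (?g (?r + h)) = \<psi> (?s + h) + (ln (sqrt (2 * pi * \<sigma>\<^sup>2)) + (?r\<^sup>2 - ?s\<^sup>2) / (2*\<sigma>\<^sup>2)) + (?r - ?s) / \<sigma>\<^sup>2 * h" for h
        unfolding ln_normal_density[OF s] \<psi>_def using s by (simp add: field_simps power2_eq_square)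
    qed
    fix x y l :: real assume l: "0 \<le> l" "l \<le> 1"
      have "(1 - l) * \<psi> (?s + x) + l * \<psi> (?s + y) \<le> \<psi> ((1 - l) * (?s + x) + l * (?s + y))"
        using concave_onD[OF conc, of l "?s+x" "?s+y"] l unfolding \<psi>_def by simp
      also have "(1 - l) * (?s + x) + l * (?s + y) = ?s + ((1-l) * x + l * y)" by algebra
      finally show "(1 - l) * (ln (f (?s + x)) - ln (?g (?r + x))) + l * (ln (f (?s + y)) - ln (?g (?r + y)))
        \<le> ln (f (?s + ((1 - l) * x + l * y))) - ln (?g (?r + ((1 - l) * x + l * y)))"
      unfolding * by (simp add: algebra_simps)
  qed
  moreover have "?g ?r = std_normal_density t / \<sigma>"
    using s by (simp add: normal_density_def real_sqrt_mult power_mult_distrib)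
  ultimately show ?thesis by simp
qed

text \<open>The same comparison with the roles of f and the Gaussian exchanged: now the ratio of the
  Gaussian to f is log-concave, and R' is at least \<sigma>.\<close>

lemma rearr_normal_density_ge:
  assumes f: "pos_density f" and s: "0 < \<sigma>"
    and conv: "convex_on UNIV (\<lambda>t. ln (f t) + t\<^sup>2 / (2 * \<sigma>\<^sup>2))"
  shows "f (rearr std_normal_density f t) \<le> std_normal_density t / \<sigma>"
proof -
  let ?g = "normal_density 0 \<sigma>" and ?s = "rearr std_normal_density f t" and ?r = "\<sigma> * t"
  define \<psi> where "\<psi> = (\<lambda>t. ln (f t) + t\<^sup>2 / (2 * \<sigma>\<^sup>2))"
  note N = pos_density_normal[of 1, simplified]
  have eq: "cdf (law ?g) ?r = cdf (law f) ?s"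
    using cdf_rearr[OF N f] cdf_law_scale_normal[OF s] by simp
  have "f ?s \<le> ?g ?r"
  proof (rule density_le_of_log_concave_ratio[OF pos_density_normal[OF s] f eq])
    obtain c d where *: "ln (?g (?r + h)) - ln (f (?s + h)) = - \<psi> (?s + h) - c - d * h" for h
    proof
      show "ln (?g (?r + h)) - ln (f (?s + h)) = - \<psi> (?s + h) - (ln (sqrt (2 * pi * \<sigma>\<^sup>2)) + (?r\<^sup>2 - ?s\<^sup>2) / (2*\<sigma>\<^sup>2)) - (?r - ?s) / \<sigma>\<^sup>2 * h" for h
        unfolding ln_normal_density[OF s] \<psi>_def using s by (simp add: field_simps power2_eq_square)
    qed
    fix x y l :: real assume l: "0 \<le> l" "l \<le> 1"
      have "(1 - l) * \<psi> (?s + x) + l * \<psi> (?s + y) \<ge> \<psi> ((1 - l) * (?s + x) + l * (?s + y))"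
        using convex_onD[OF conv, of l "?s+x" "?s+y"] l unfolding \<psi>_def by simp
      also have "(1 - l) * (?s + x) + l * (?s + y) = ?s + ((1-l) * x + l * y)" by algebra
      finally show "(1 - l) * (ln (?g (?r + x)) - ln (f (?s + x))) + l * (ln (?g (?r + y)) - ln (f (?s + y)))
        \<le> ln (?g (?r + ((1 - l) * x + l * y))) - ln (f (?s + ((1 - l) * x + l * y)))"
      unfolding * by (simp add: algebra_simps)
  qed
  moreover have "?g ?r = std_normal_density t / \<sigma>"
    using s by (simp add: normal_density_def real_sqrt_mult power_mult_distrib)
  ultimately show ?thesis by simp
qed

section \<open>Gaussian integration by parts and the one-dimensional transport inequality\<close>

lemma DERIV_std_normal_density:
  "(std_normal_density has_real_derivative - t * std_normal_density t) (at t)"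
  unfolding std_normal_density_def[abs_def] 
  by (rule derivative_eq_intros refl | simp)+

lemma std_normal_density_tail:
  assumes "0 \<le> s"
  shows "(\<integral>\<^sup>+t. ennreal (t * std_normal_density t) * indicator {s..} t \<partial>lborel) = ennreal (std_normal_density s)"
proof -
  have "(\<integral>\<^sup>+t. ennreal (t * std_normal_density t) * indicator {s..} t \<partial>lborel)
      = ennreal (0 - (- std_normal_density s))"
  proof (rule nn_integral_FTC_atLeast)
    show "((\<lambda>t. - std_normal_density t) has_real_derivative t * std_normal_density t) (at t)" for t
      using DERIV_std_normal_density[of t] by (auto intro!: derivative_eq_intros)
    have "((\<lambda>x::real. - ((1 / sqrt (2 * pi)) * exp (- x\<^sup>2 / 2))) \<longlongrightarrow> 0) at_top"
      by real_asymp
    then show "((\<lambda>t. - std_normal_density t) \<longlongrightarrow> 0) at_top"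
      unfolding std_normal_density_def .
  qed (use assms in auto)
  then show ?thesis by simp
qed


text \<open>Fubini after inserting \<open>\<gamma>(s) = \<integral>\<^sub>s\<^sup>\<infinity> t \<gamma>(t) dt\<close>: no boundary terms arise, so that no growth condition on \<open>R\<close>
  is needed.\<close>
lemma nn_integral_deriv_std_normal_half:
  assumes R: "\<And>t. (R has_real_derivative R' t) (at t)" and nn: "\<And>t. 0 \<le> R' t"
    and [measurable]: "R' \<in> borel_measurable borel"
  shows "(\<integral>\<^sup>+t. ennreal (R' t * std_normal_density t) * indicator {0..} t \<partial>lborel)
    = (\<integral>\<^sup>+t. ennreal (t * (R t - R 0) * std_normal_density t) * indicator {0..} t \<partial>lborel)"
proof -
  let ?g = std_normal_density
  have "(\<integral>\<^sup>+s. ennreal (R' s * ?g s) * indicator {0..} s \<partial>lborel)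
     = (\<integral>\<^sup>+s. \<integral>\<^sup>+t. ennreal (R' s) * indicator {0..} s * (ennreal (t * ?g t) * indicator {s..} t) \<partial>lborel \<partial>lborel)"
    by (intro nn_integral_cong, subst nn_integral_cmult)
       (auto simp: std_normal_density_tail ennreal_mult nn split: split_indicator)
  also have "\<dots> = (\<integral>\<^sup>+t. \<integral>\<^sup>+s. ennreal (R' s) * indicator {0..} s * (ennreal (t * ?g t) * indicator {s..} t) \<partial>lborel \<partial>lborel)"
  proof (rule lborel_pair.Fubini'[symmetric])
    have "(\<lambda>p. ennreal (R' (fst p)) * indicator {0..} (fst p) *
        (ennreal (snd p * ?g (snd p)) * (if fst p \<le> snd p then 1 else 0)))
      \<in> borel_measurable (lborel \<Otimes>\<^sub>M lborel)"
      by measurable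
    moreover have "indicator {s..} t = (if s \<le> t then 1 else 0 :: ennreal)" for s t :: real
      by (auto split: split_indicator)
    ultimately show "(\<lambda>(s, t). ennreal (R' s) * indicator {0..} s * (ennreal (t * ?g t) * indicator {s..} t))
      \<in> borel_measurable (lborel \<Otimes>\<^sub>M lborel)" by (simp add: case_prod_beta)
  qed
  also have "\<dots> = (\<integral>\<^sup>+t. ennreal (t * (R t - R 0) * ?g t) * indicator {0..} t \<partial>lborel)"
  proof (intro nn_integral_cong)
    fix t
    have "(\<integral>\<^sup>+s. ennreal (R' s) * indicator {0..} s * (ennreal (t * ?g t) * indicator {s..} t) \<partial>lborel)
       = (\<integral>\<^sup>+s. ennreal (t * ?g t) * (ennreal (R' s) * indicator {0..t} s) \<partial>lborel)"
      by (intro nn_integral_cong) (auto split: split_indicator simp: mult_ac)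
    also have "\<dots> = ennreal (t * ?g t) * (\<integral>\<^sup>+s. ennreal (R' s) * indicator {0..t} s \<partial>lborel)"
      by (rule nn_integral_cmult) auto
    also have "\<dots> = ennreal (t * (R t - R 0) * ?g t) * indicator {0..} t"
    proof (cases "0 \<le> t")
      case True
      have "(\<integral>\<^sup>+s. ennreal (R' s) * indicator {0..t} s \<partial>lborel) = ennreal (R t - R 0)"
        by (rule nn_integral_FTC_Icc) (use R nn True in auto)
      moreover have "R 0 \<le> R t"
        by (rule DERIV_nonneg_imp_nondecreasing[OF True]) (use R nn in blast)
      ultimately show ?thesis using True by (simp add: ennreal_mult[symmetric] mult_ac)
    qed auto
    finally show "(\<integral>\<^sup>+s. ennreal (R' s) * indicator {0..} s * (ennreal (t * ?g t) * indicator {s..} t) \<partial>lborel)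
       = ennreal (t * (R t - R 0) * ?g t) * indicator {0..} t" .
  qed
  finally show ?thesis .
qed

lemma nn_integral_split_at_0:
  assumes [measurable]: "(f :: real \<Rightarrow> ennreal) \<in> borel_measurable borel"
  shows "integral\<^sup>N lborel f = (\<integral>\<^sup>+t. f t * indicator {0..} t \<partial>lborel) + (\<integral>\<^sup>+t. f (- t) * indicator {0..} t \<partial>lborel)"
proof -
  have "integral\<^sup>N lborel f = (\<integral>\<^sup>+t. f t * indicator {0..} t + f t * indicator {..0} t \<partial>lborel)"
  proof (rule nn_integral_cong_AE)
    show "AE t in lborel. f t = f t * indicator {0..} t + f t * indicator {..0} t"
      using AE_lborel_singleton[of 0] by eventually_elim (auto split: split_indicator)
  qed
  also have "\<dots> = (\<integral>\<^sup>+t. f t * indicator {0..} t \<partial>lborel) + (\<integral>\<^sup>+t. f t * indicator {..0} t \<partial>lborel)"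
    by (rule nn_integral_add) auto
  also have "(\<integral>\<^sup>+t. f t * indicator {..0} t \<partial>lborel) = (\<integral>\<^sup>+t. f (- t) * indicator {0..} t \<partial>lborel)"
    by (subst nn_integral_real_affine[where c="-1" and t=0])
       (auto intro!: nn_integral_cong split: split_indicator)
  finally show ?thesis .
qed

text \<open>Stein's identity for nondecreasing R. Subtracting \<open>R 0\<close> makes the
  right-hand integrand nonnegative, so both sides make sense in \<open>[0, \<infinity>]\<close>
  without integrability.\<close>

lemma nn_integral_deriv_std_normal:
  assumes R: "\<And>t. (R has_real_derivative R' t) (at t)" and nn: "\<And>t. 0 \<le> R' t"
    and [measurable]: "R' \<in> borel_measurable borel"
  shows "(\<integral>\<^sup>+t. ennreal (R' t * std_normal_density t) \<partial>lborel)
    = (\<integral>\<^sup>+t. ennreal (t * (R t - R 0) * std_normal_density t) \<partial>lborel)"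
proof -
  have [measurable]: "R \<in> borel_measurable borel"
    using DERIV_isCont[OF R] by (intro borel_measurable_continuous_onI) (simp add: continuous_on_eq_continuous_at)
  have ev: "std_normal_density (- t) = std_normal_density t" for t
    by (simp add: std_normal_density_def)
  \<comment> \<open>The negative half-line reduces to the positive one through the reflected
    function, which is again nondecreasing.\<close>
  have "((\<lambda>t. - R (- t)) has_real_derivative R' (- t)) (at t)" for t
    using DERIV_minus[OF R[of "- t", unfolded DERIV_mirror]] by simp
  from nn_integral_deriv_std_normal_half[OF this] nn
  have *: "(\<integral>\<^sup>+t. ennreal (R' (- t) * std_normal_density t) * indicator {0..} t \<partial>lborel)
    = (\<integral>\<^sup>+t. ennreal (t * (- R (- t) - - R (- 0)) * std_normal_density t) * indicator {0..} t \<partial>lborel)"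
    by auto
  have eq: "t * (- R (- t) - - R (- 0)) = - t * (R (- t) - R 0)" for t
    by (simp add: algebra_simps)
  show ?thesis
    using *[unfolded eq] nn_integral_deriv_std_normal_half[OF R nn]
    by (subst (1 2) nn_integral_split_at_0) (auto simp: ev)
qed

text \<open>The tangent of the logarithm at \<sigma> gives ln(s / \<sigma>) \<le> (s - \<sigma>) /
  \<sigma>. As s - \<sigma> and \<sigma> - 1 never have opposite signs, the right-hand side is at
  most s - \<sigma>.\<close>

lemma sub_ln_le:
  fixes s \<sigma> :: real
  assumes "0 < s" "0 < \<sigma>" "(\<sigma> < 1 \<and> s \<le> \<sigma>) \<or> (1 < \<sigma> \<and> \<sigma> \<le> s)"
  shows "\<sigma> - ln \<sigma> \<le> s - ln s"
proof -
  have "ln (s / \<sigma>) \<le> s / \<sigma> - 1" using assms by (intro ln_le_minus_one) auto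
  also have "s / \<sigma> - 1 = (s - \<sigma>) / \<sigma>" using assms by (simp add: field_simps)
  also have "\<dots> \<le> s - \<sigma>"
  proof -
    have "0 \<le> (s - \<sigma>) * (\<sigma> - 1)" using assms(3) by (auto simp: zero_le_mult_iff)
    then show ?thesis using assms by (subst pos_divide_le_eq) (auto simp: algebra_simps)
  qed
  finally show ?thesis using assms by (simp add: ln_div)
qed

text \<open>The pointwise form of Gibbs' inequality. For two probability densities the terms - a + b
  integrate to zero, so this integrand represents relative entropy with a value in
  \<open>[0, \<infinity>]\<close> in every case.\<close>

lemma gibbs_nonneg:
  fixes a b :: real assumes "0 < a" "0 < b"
  shows "0 \<le> a * ln (a / b) - a + b"
proof -
  have "ln (b / a) \<le> b / a - 1" using assms by (intro ln_le_minus_one) auto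
  then have "a * ln (b / a) \<le> a * (b / a - 1)" using assms by (intro mult_left_mono) auto
  then show ?thesis using assms by (simp add: ln_div algebra_simps)
qed


text \<open>With S = R', twice the entropy minus the cost equals twice the \<gamma>-integral of S -
  1 - ln S: expand the square, insert the logarithm of the Monge-Ampere equation into the entropy,
  and turn the cross term into the integral of S by Stein's identity. The bound on S then makes the
  integrand at least \<sigma> - 1 - ln \<sigma>. An infinite entropy makes the claim trivial; a
  finite one makes all integrals split.\<close>

lemma talagrand_deficit_1d:
  assumes f: "pos_density f" and s: "0 < \<sigma>"
    and c: "(\<sigma> < 1 \<and> concave_on UNIV (\<lambda>t. ln (f t) + t\<^sup>2 / (2 * \<sigma>\<^sup>2))) \<or>
            (1 < \<sigma> \<and> convex_on UNIV (\<lambda>t. ln (f t) + t\<^sup>2 / (2 * \<sigma>\<^sup>2)))"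
    and m2: "integrable lborel (\<lambda>t. f t * t\<^sup>2)"
  defines "R \<equiv> rearr std_normal_density f"
  shows "(\<integral>\<^sup>+t. ennreal (std_normal_density t) * ennreal ((t - R t)\<^sup>2) \<partial>lborel) + ennreal (2 * (\<sigma> - 1 - ln \<sigma>))
    \<le> 2 * (\<integral>\<^sup>+t. ennreal (f t * ln (f t / std_normal_density t) - f t + std_normal_density t) \<partial>lborel)"
proof (cases "(\<integral>\<^sup>+t. ennreal (f t * ln (f t / std_normal_density t) - f t + std_normal_density t) \<partial>lborel) = \<infinity>")
  case True then show ?thesis by (simp add: ennreal_mult_top)
next
  case False
  let ?g = std_normal_density
  note g = pos_density_normal[of 1, simplified]
  note fD = pos_densityD[OF f] note gD = pos_densityD[OF g]
  note [measurable] = fD(4) gD(4)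
  have [measurable]: "R \<in> borel_measurable borel" unfolding R_def by (rule rearr_measurable[OF g f])
  define L where "L = (\<lambda>t. ln (f t / ?g t))"
  have [measurable]: "L \<in> borel_measurable borel" unfolding L_def by measurable
  have nn: "0 \<le> f t * L t - f t + ?g t" for t unfolding L_def by (rule gibbs_nonneg) (use fD gD in auto)
  have i1: "integrable lborel (\<lambda>t. f t * L t - f t + ?g t)"
    by (rule integrableI_nonneg) (use False nn in \<open>auto simp: L_def less_top\<close>)
  have "integrable lborel (\<lambda>t. (f t * L t - f t + ?g t) + f t - ?g t)"
    by (intro Bochner_Integration.integrable_add Bochner_Integration.integrable_diff i1 fD gD)
  then have i2: "integrable lborel (\<lambda>t. f t * L t)" by simp
  have E: "(\<integral>\<^sup>+t. ennreal (f t * L t - f t + ?g t) \<partial>lborel) = ennreal (\<integral>t. f t * L t \<partial>lborel)"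
    by (subst nn_integral_eq_integral[OF i1])
       (use nn i2 fD(5,6) gD(5,6) in \<open>simp_all add: Bochner_Integration.integral_add Bochner_Integration.integral_diff\<close>)
  have push: "integrable lborel (\<lambda>t. ?g t * \<phi> (R t)) \<and> (\<integral>t. ?g t * \<phi> (R t) \<partial>lborel) = (\<integral>t. f t * \<phi> t \<partial>lborel)"
    if [measurable]: "\<phi> \<in> borel_measurable borel" and "integrable lborel (\<lambda>t. f t * \<phi> t)" for \<phi> :: "real \<Rightarrow> real"
  proof -
    have "integrable (law f) \<phi>"
      using that by (subst integrable_density) (auto simp: fD)
    then have "integrable (law ?g) (\<lambda>t. \<phi> (R t))"
      unfolding R_def using rearr_measurable[OF g f]
      by (subst (asm) distr_rearr[OF g f, symmetric], subst (asm) integrable_distr_eq) auto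
    moreover have "(\<integral>t. \<phi> (R t) \<partial>law ?g) = (\<integral>t. \<phi> t \<partial>law f)"
      unfolding R_def using rearr_measurable[OF g f]
      by (subst distr_rearr[OF g f, symmetric], subst integral_distr) auto
    ultimately show ?thesis
      by (auto simp: integrable_density integral_density fD gD)
  qed
  define S where "S t = ?g t / f (R t)" for t
  have S0: "0 < S t" for t using fD(1) gD(1) by (simp add: S_def)
  have [measurable]: "S \<in> borel_measurable borel" unfolding S_def[abs_def] by measurable
  \<comment> \<open>The logarithm of \<open>f (R t) * S t = \<gamma> t\<close>; the normalizing
    constants of the two Gaussian factors cancel.\<close>
  have LR: "L (R t) = (R t)\<^sup>2 / 2 - t\<^sup>2 / 2 - ln (S t)" for t
    using fD(1)[of "R t"] gD(1)[of "R t"] gD(1)[of t]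
    by (simp add: L_def S_def ln_div ln_normal_density)
  have iL: "integrable lborel (\<lambda>t. ?g t * L (R t))" "(\<integral>t. ?g t * L (R t) \<partial>lborel) = (\<integral>t. f t * L t \<partial>lborel)"
    using push[of L] i2 by auto
  have iR: "integrable lborel (\<lambda>t. ?g t * (R t)\<^sup>2)" using push[of "\<lambda>t. t\<^sup>2"] m2 by auto
  have it: "integrable lborel (\<lambda>t. ?g t * t\<^sup>2)" "(\<integral>t. ?g t * t\<^sup>2 \<partial>lborel) = 1" "integrable lborel (\<lambda>t. ?g t * t)"
    using integrable_std_normal_moment[of 2] integral_std_normal_moment_even[of 1] integrable_std_normal_moment[of 1]
    by simp_all
  have itR: "integrable lborel (\<lambda>t. ?g t * (t * R t))"
  proof (rule Bochner_Integration.integrable_bound[OF Bochner_Integration.integrable_add[OF iR it(1)]])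
    have "\<bar>t * R t\<bar> \<le> (R t)\<^sup>2 + t\<^sup>2" for t
    proof -
      have "0 \<le> (\<bar>t\<bar> - \<bar>R t\<bar>)\<^sup>2" by simp
      then have "2 * (\<bar>t\<bar> * \<bar>R t\<bar>) \<le> t\<^sup>2 + (R t)\<^sup>2" by (simp add: power2_diff)
      moreover have "0 \<le> t\<^sup>2 + (R t)\<^sup>2" by simp
      ultimately show ?thesis unfolding abs_mult by linarith
    qed
    then have "?g t * \<bar>t * R t\<bar> \<le> ?g t * ((R t)\<^sup>2 + t\<^sup>2)" for t by (intro mult_left_mono) auto
    then show "AE t in lborel. norm (?g t * (t * R t)) \<le> norm (?g t * (R t)\<^sup>2 + ?g t * t\<^sup>2)"
      by (intro AE_I2) (simp add: abs_mult algebra_simps)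
  qed measurable
  have ilS: "integrable lborel (\<lambda>t. ?g t * ln (S t))"
  proof -
    \<comment> \<open>The logarithm of S inherits integrability from the three other terms of
      \<open>LR\<close>.\<close>
    have "integrable lborel (\<lambda>t. (?g t * (R t)\<^sup>2) / 2 - (?g t * t\<^sup>2) / 2 - ?g t * L (R t))"
      by (intro Bochner_Integration.integrable_diff integrable_divide iR it iL)
    then show ?thesis by (simp add: LR algebra_simps)
  qed
  have i0: "integrable lborel (\<lambda>t. ?g t * (t * R t) - R 0 * (?g t * t))"
    by (intro Bochner_Integration.integrable_diff integrable_mult_right itR it)
  have Rm: "0 \<le> t * (R t - R 0)" for t
    using rearr_strict_mono[OF g f, of 0 t] rearr_strict_mono[OF g f, of t 0] 
    by (cases t "0::real" rule: linorder_cases) (auto simp: R_def zero_le_mult_iff)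
  have "(\<integral>\<^sup>+t. ennreal (S t * ?g t) \<partial>lborel) = (\<integral>\<^sup>+t. ennreal (t * (R t - R 0) * ?g t) \<partial>lborel)"
  proof (rule nn_integral_deriv_std_normal)
    show "(R has_real_derivative S t) (at t)" for t unfolding R_def S_def by (rule DERIV_rearr[OF g f])
  qed (use S0 in \<open>auto simp: less_imp_le\<close>)
  also have "\<dots> = (\<integral>\<^sup>+t. ennreal (?g t * (t * R t) - R 0 * (?g t * t)) \<partial>lborel)"
    by (simp add: algebra_simps)
  also have "\<dots> = ennreal (\<integral>t. ?g t * (t * R t) - R 0 * (?g t * t) \<partial>lborel)"
  proof (rule nn_integral_eq_integral[OF i0], rule AE_I2)
    show "0 \<le> ?g t * (t * R t) - R 0 * (?g t * t)" for t
      using mult_nonneg_nonneg[OF Rm[of t] gD(2)[of t]] by (simp add: algebra_simps)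
  qed
  \<comment> \<open>\<gamma> has mean zero, so the constant \<open>R 0\<close> drops out.\<close>
  also have "(\<integral>t. ?g t * (t * R t) - R 0 * (?g t * t) \<partial>lborel) = (\<integral>t. ?g t * (t * R t) \<partial>lborel)"
    using itR it integral_std_normal_moment_odd[of 0] by simp
  finally have S1: "(\<integral>\<^sup>+t. ennreal (S t * ?g t) \<partial>lborel) = ennreal (\<integral>t. ?g t * (t * R t) \<partial>lborel)" .
  have iS: "integrable lborel (\<lambda>t. S t * ?g t)"
    by (rule integrableI_nonneg) (use S1 S0 in \<open>auto simp: less_imp_le\<close>)
  have "0 \<le> (\<integral>t. ?g t * (t * R t) \<partial>lborel)"
  proof -
    have "0 \<le> (\<integral>t. ?g t * (t * R t) - R 0 * (?g t * t) \<partial>lborel)"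
    proof (rule Bochner_Integration.integral_nonneg)
      show "0 \<le> ?g t * (t * R t) - R 0 * (?g t * t)" for t
        using mult_nonneg_nonneg[OF Rm[of t] gD(2)[of t]] by (simp add: algebra_simps)
    qed
    then show ?thesis using itR it integral_std_normal_moment_odd[of 0] by simp
  qed
  then have S2: "(\<integral>t. S t * ?g t \<partial>lborel) = (\<integral>t. ?g t * (t * R t) \<partial>lborel)"
    using S1 S0 gD(2) by (intro integral_eq_nn_integral[THEN trans]) (auto simp: less_imp_le)
  have pt: "\<sigma> - ln \<sigma> \<le> S t - ln (S t)" for t
  proof (rule sub_ln_le[OF S0 s])
    have *: "S t \<le> \<sigma> \<longleftrightarrow> ?g t / \<sigma> \<le> f (R t)" "\<sigma> \<le> S t \<longleftrightarrow> f (R t) \<le> ?g t / \<sigma>"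
      using s fD(1)[of "R t"] by (auto simp: S_def field_simps)
    show "\<sigma> < 1 \<and> S t \<le> \<sigma> \<or> 1 < \<sigma> \<and> \<sigma> \<le> S t"
      unfolding * R_def using c rearr_normal_density_le[OF f s, of t] rearr_normal_density_ge[OF f s, of t] by blast
  qed
  have "(\<integral>t. (\<sigma> - ln \<sigma>) * ?g t \<partial>lborel) \<le> (\<integral>t. S t * ?g t - ?g t * ln (S t) \<partial>lborel)"
  proof (rule integral_mono)
    show "(\<sigma> - ln \<sigma>) * ?g t \<le> S t * ?g t - ?g t * ln (S t)" for t
      using mult_right_mono[OF pt[of t] gD(2)[of t]] by (simp add: algebra_simps)
  qed (use iS ilS gD(5) in auto)
  then have key: "\<sigma> - ln \<sigma> \<le> (\<integral>t. ?g t * (t * R t) \<partial>lborel) - (\<integral>t. ?g t * ln (S t) \<partial>lborel)"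
    using iS ilS gD(6) S2 by simp
  have "(\<integral>t. ?g t * L (R t) \<partial>lborel) = (\<integral>t. (?g t * (R t)\<^sup>2) / 2 - (?g t * t\<^sup>2) / 2 - ?g t * ln (S t) \<partial>lborel)"
    by (simp add: LR algebra_simps)
  also have "\<dots> = (\<integral>t. ?g t * (R t)\<^sup>2 \<partial>lborel) / 2 - 1 / 2 - (\<integral>t. ?g t * ln (S t) \<partial>lborel)"
    using iR it ilS by simp
  finally have e1: "(\<integral>t. f t * L t \<partial>lborel) = \<dots>" using iL by simp
  have "(\<lambda>t. ?g t * (t - R t)\<^sup>2) = (\<lambda>t. ?g t * t\<^sup>2 + ?g t * (R t)\<^sup>2 - 2 * (?g t * (t * R t)))"
    by (auto simp: power2_eq_square algebra_simps)
  then have ic: "integrable lborel (\<lambda>t. ?g t * (t - R t)\<^sup>2)"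
    and e2: "(\<integral>t. ?g t * (t - R t)\<^sup>2 \<partial>lborel) = 1 + (\<integral>t. ?g t * (R t)\<^sup>2 \<partial>lborel) - 2 * (\<integral>t. ?g t * (t * R t) \<partial>lborel)"
    using it iR itR by simp_all
  have "(\<integral>\<^sup>+t. ennreal (?g t) * ennreal ((t - R t)\<^sup>2) \<partial>lborel) = ennreal (\<integral>t. ?g t * (t - R t)\<^sup>2 \<partial>lborel)"
    by (subst nn_integral_eq_integral[OF ic, symmetric]) (auto simp: ennreal_mult gD)
  moreover have "0 \<le> \<sigma> - 1 - ln \<sigma>" using ln_le_minus_one[OF s] by simp
  moreover have "0 \<le> (\<integral>t. ?g t * (t - R t)\<^sup>2 \<partial>lborel)" by (rule Bochner_Integration.integral_nonneg) simp
  moreover have "(\<integral>t. ?g t * (t - R t)\<^sup>2 \<partial>lborel) + 2 * (\<sigma> - 1 - ln \<sigma>) \<le> 2 * (\<integral>t. f t * L t \<partial>lborel)"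
    using key e1 e2 by simp
  ultimately show ?thesis
    unfolding E[unfolded L_def] 
    by (simp add: ennreal_plus[symmetric] ennreal_mult'[symmetric] ennreal_numeral[symmetric] L_def ennreal_leI
             del: ennreal_plus ennreal_numeral)
qed

section \<open>Marginals of one variable\<close>

lemma pos_density_normalize:
  assumes "\<And>t. 0 < a t" "continuous_on UNIV a" "integrable lborel a"
  shows "0 < integral\<^sup>L lborel a" "pos_density (\<lambda>t. a t / integral\<^sup>L lborel a)"
proof -
  have "integral\<^sup>L lborel a \<noteq> 0"
  proof
    assume "integral\<^sup>L lborel a = 0"
    then have "AE t in lborel. a t = 0"
      using integral_nonneg_eq_0_iff_AE[OF assms(3)] assms(1) by (simp add: less_imp_le)
    then have "AE t in (lborel :: real measure). False"
      by eventually_elim (metis assms(1) less_irrefl)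
    then have "ae_filter (lborel :: real measure) = bot" by (simp add: trivial_limit_def)
    then show False by (simp add: ae_filter_eq_bot_iff)
  qed
  then show p: "0 < integral\<^sup>L lborel a"
    using Bochner_Integration.integral_nonneg[of lborel a] assms(1) by (simp add: less_imp_le order_less_le)
  show "pos_density (\<lambda>t. a t / integral\<^sup>L lborel a)"
    unfolding pos_density_def using assms p by (auto intro!: continuous_intros)
qed

text \<open>Only an inequality, because z may miss part of the line. The substitution is made on
  [-n, n], and n tends to infinity by monotone convergence.\<close>

lemma nn_integral_compose_mono_le:
  fixes z :: "real \<Rightarrow> real" and c :: "real \<Rightarrow> real"
  assumes z: "\<And>t. (z has_real_derivative z' t) (at t)" and z': "continuous_on UNIV z'" "\<And>t. 0 \<le> z' t"
    and [measurable]: "c \<in> borel_measurable borel" and c: "\<And>t. 0 \<le> c t"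
  shows "(\<integral>\<^sup>+t. ennreal (c (z t) * z' t) \<partial>lborel) \<le> (\<integral>\<^sup>+t. ennreal (c t) \<partial>lborel)"
proof -
  have [measurable]: "z \<in> borel_measurable borel" "z' \<in> borel_measurable borel"
    using DERIV_isCont[OF z] z'(1)
    by (auto intro!: borel_measurable_continuous_onI simp: continuous_on_eq_continuous_at)
  let ?F = "\<lambda>n t. ennreal (c (z t) * z' t) * indicator {- real n..real n} t"
  have sup: "(SUP n. ?F n t) = ennreal (c (z t) * z' t)" for t
  proof (rule antisym)
    obtain n :: nat where "\<bar>t\<bar> \<le> real n" using real_arch_simple by blast
    then have "?F n t = ennreal (c (z t) * z' t)" by (auto split: split_indicator)
    moreover have "?F n t \<le> (SUP n. ?F n t)" by (rule SUP_upper) simp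
    ultimately show "ennreal (c (z t) * z' t) \<le> (SUP n. ?F n t)" by (simp only:)
  qed (auto intro!: SUP_least split: split_indicator)
  have "(\<integral>\<^sup>+t. ennreal (c (z t) * z' t) \<partial>lborel) = (\<integral>\<^sup>+t. (SUP n. ?F n t) \<partial>lborel)"
    by (simp only: sup)
  also have "\<dots> = (SUP n. integral\<^sup>N lborel (?F n))"
    by (rule nn_integral_monotone_convergence_SUP)
       (auto simp: incseq_def le_fun_def split: split_indicator)
  also have "\<dots> \<le> (\<integral>\<^sup>+t. ennreal (c t) \<partial>lborel)"
  proof (rule SUP_least)
    fix n :: nat
    have "(\<integral>\<^sup>+t. ennreal (c t * indicator {z (- real n)..z (real n)} t) \<partial>lborel)
      = (\<integral>\<^sup>+t. ennreal (c (z t) * z' t * indicator {- real n..real n} t) \<partial>lborel)"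
    proof (rule nn_integral_substitution)
      show "set_borel_measurable borel {z (- real n)..z (real n)} c"
        unfolding set_borel_measurable_def by measurable
    qed (use z z' in \<open>auto intro: continuous_on_subset\<close>)
    also have "\<dots> = integral\<^sup>N lborel (?F n)"
      by (intro nn_integral_cong) (auto split: split_indicator)
    finally have "integral\<^sup>N lborel (?F n) = (\<integral>\<^sup>+t. ennreal (c t * indicator {z (- real n)..z (real n)} t) \<partial>lborel)" ..
    also have "\<dots> \<le> (\<integral>\<^sup>+t. ennreal (c t) \<partial>lborel)"
      by (intro nn_integral_mono) (auto split: split_indicator simp: c)
    finally show "integral\<^sup>N lborel (?F n) \<le> (\<integral>\<^sup>+t. ennreal (c t) \<partial>lborel)" .
  qed
  finally show ?thesis .
qed

text \<open>McCann's transport proof: let R rearrange a / A onto b / B and integrate c along z(t) =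
  (1 - l) t + l R(t), whose derivative dominates R' to the power l by the arithmetic-geometric mean
  inequality. The constant K makes room for the quadratic terms of the remaining
  coordinates.\<close>

lemma prekopa_leindler_1d:
  fixes a b c :: "real \<Rightarrow> real"
  assumes a: "\<And>t. 0 < a t" "continuous_on UNIV a" "integrable lborel a"
    and b: "\<And>t. 0 < b t" "continuous_on UNIV b" "integrable lborel b"
    and c: "\<And>t. 0 < c t" "integrable lborel c"
    and l: "0 \<le> l" "l \<le> 1"
    and le: "\<And>x y. (1 - l) * ln (a x) + l * ln (b y) \<le> ln (c ((1 - l) * x + l * y)) + K"
  shows "(1 - l) * ln (integral\<^sup>L lborel a) + l * ln (integral\<^sup>L lborel b) \<le> ln (integral\<^sup>L lborel c) + K"
proof -
  define A where "A = integral\<^sup>L lborel a"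
  define B where "B = integral\<^sup>L lborel b"
  let ?a = "\<lambda>t. a t / A" and ?b = "\<lambda>t. b t / B"
  note pa = pos_density_normalize[OF a, folded A_def] note pb = pos_density_normalize[OF b, folded B_def]
  note [measurable] = borel_measurable_integrable[OF c(2), simplified]
  define R where "R = rearr ?a ?b"
  define R' where "R' t = ?a t / ?b (R t)" for t
  have R: "(R has_real_derivative R' t) (at t)" for t
    unfolding R_def R'_def by (rule DERIV_rearr[OF pa(2) pb(2)])
  have R0: "0 < R' t" for t using a(1)[of t] b(1)[of "R t"] pa(1) pb(1) by (simp add: R'_def)
  have cR: "continuous_on UNIV R" using DERIV_isCont[OF R] by (simp add: continuous_on_eq_continuous_at)
  have cR': "continuous_on UNIV R'"
    unfolding R'_def[abs_def] using pa(1) pb(1) b(1)[THEN less_imp_neq]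
    by (intro continuous_intros continuous_on_compose2[OF b(2) cR] a(2)) (auto simp: less_imp_neq[symmetric])
  define z where "z t = (1 - l) * t + l * R t" for t
  have pt: "exp (l * ln (B / A)) * a t \<le> exp K * (c (z t) * ((1 - l) + l * R' t))" for t
  proof -
    \<comment> \<open>Monge-Ampere for the normalized densities; the ratio B / A of the masses is
      what finally produces the two integrals.\<close>
    have "ln (b (R t)) = ln (a t) + ln (B / A) - ln (R' t)"
      using a(1)[of t] b(1)[of "R t"] pa(1) pb(1) by (simp add: R'_def ln_div ln_mult)
    then have "l * ln (b (R t)) = l * ln (a t) + l * ln (B / A) - l * ln (R' t)"
      by (simp only: distrib_left right_diff_distrib)
    then have "l * ln (B / A) + ln (a t) - l * ln (R' t) \<le> ln (c (z t)) + K"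
      using le[of t "R t"] by (simp add: z_def algebra_simps)
    then have "l * ln (B / A) + ln (a t) \<le> K + ln (c (z t)) + l * ln (R' t)" by simp
    then have "exp (l * ln (B / A) + ln (a t)) \<le> exp (K + ln (c (z t)) + l * ln (R' t))" by simp
    then have "exp (l * ln (B / A)) * a t \<le> exp K * c (z t) * exp (l * ln (R' t))"
      using a(1) c(1) by (simp add: exp_add)
    \<comment> \<open>Weighted arithmetic-geometric mean of 1 and \<open>R' t\<close>; the
      right-hand side is the derivative of z.\<close>
    also have "exp (l * ln (R' t)) \<le> (1 - l) + l * R' t"
      using Youngs_inequality_0[of "1-l" l 1 "R' t"] l R0[of t] by (simp add: powr_def)
    then have "exp K * c (z t) * exp (l * ln (R' t)) \<le> exp K * c (z t) * ((1 - l) + l * R' t)"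
      using c(1)[of "z t"] by (intro mult_left_mono) auto
    finally show ?thesis by simp
  qed
  have "ennreal (exp (l * ln (B / A)) * A) = (\<integral>\<^sup>+t. ennreal (exp (l * ln (B / A)) * a t) \<partial>lborel)"
    using a by (subst nn_integral_eq_integral) (auto simp: A_def less_imp_le)
  also have "\<dots> \<le> (\<integral>\<^sup>+t. ennreal (exp K) * ennreal (c (z t) * ((1 - l) + l * R' t)) \<partial>lborel)"
    using pt by (intro nn_integral_mono) (simp add: ennreal_mult'[symmetric] ennreal_leI)
  also have "\<dots> = ennreal (exp K) * (\<integral>\<^sup>+t. ennreal (c (z t) * ((1 - l) + l * R' t)) \<partial>lborel)"
  proof (rule nn_integral_cmult)
    have [measurable]: "R \<in> borel_measurable borel" "R' \<in> borel_measurable borel"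
      using cR cR' by (auto intro: borel_measurable_continuous_onI)
    show "(\<lambda>t. ennreal (c (z t) * ((1 - l) + l * R' t))) \<in> borel_measurable lborel"
      unfolding z_def by measurable
  qed
  also have "\<dots> \<le> ennreal (exp K) * (\<integral>\<^sup>+t. ennreal (c t) \<partial>lborel)"
  proof (intro mult_left_mono nn_integral_compose_mono_le)
    show "(z has_real_derivative (1 - l) + l * R' t) (at t)" for t
      unfolding z_def using R[of t] by (auto intro!: derivative_eq_intros)
    show "continuous_on UNIV (\<lambda>t. (1 - l) + l * R' t)" by (intro continuous_intros cR')
  qed (use l R0 c in \<open>auto simp: less_imp_le\<close>)
  also have "\<dots> = ennreal (exp K * integral\<^sup>L lborel c)"
    using c by (subst nn_integral_eq_integral) (auto simp: less_imp_le ennreal_mult')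
  finally have "exp (l * ln (B / A)) * A \<le> exp K * integral\<^sup>L lborel c"
    using Bochner_Integration.integral_nonneg[of lborel c] c(1)
    by (subst (asm) ennreal_le_iff) (auto simp: less_imp_le)
  moreover have "0 < exp (l * ln (B / A)) * A" using pa(1) by simp
  ultimately have "ln (exp (l * ln (B / A)) * A) \<le> ln (exp K * integral\<^sup>L lborel c)"
    by (subst ln_le_cancel_iff) auto
  moreover have "0 < integral\<^sup>L lborel c"
    using \<open>0 < exp (l * ln (B / A)) * A\<close> \<open>exp (l * ln (B / A)) * A \<le> exp K * integral\<^sup>L lborel c\<close>
    by (smt (verit) exp_gt_zero zero_less_mult_iff)
  ultimately show ?thesis using pa(1) pb(1)
    by (simp add: ln_mult ln_div A_def[symmetric] B_def[symmetric] algebra_simps)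
qed

text \<open>Hoelder's inequality in logarithmic form. Young's inequality is applied pointwise to a /
  A and b / B, so that the convex combination integrates to 1 and only the factor
  \<open>exp k\<close> remains.\<close>

lemma holder_log_convex:
  fixes a b c :: "'a \<Rightarrow> real"
  assumes a: "\<And>t. 0 < a t" "integrable M a" "0 < integral\<^sup>L M a"
    and b: "\<And>t. 0 < b t" "integrable M b" "0 < integral\<^sup>L M b"
    and c: "\<And>t. 0 < c t" "integrable M c" "0 < integral\<^sup>L M c"
    and l: "0 \<le> l" "l \<le> 1"
    and le: "\<And>t. ln (c t) \<le> (1 - l) * ln (a t) + l * ln (b t) + K"
  shows "ln (integral\<^sup>L M c) \<le> (1 - l) * ln (integral\<^sup>L M a) + l * ln (integral\<^sup>L M b) + K"
proof -
  define A where "A = integral\<^sup>L M a"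
  define B where "B = integral\<^sup>L M b"
  define k where "k = (1 - l) * ln A + l * ln B + K"
  have AB: "0 < A" "0 < B" using a b by (auto simp: A_def B_def)
  have pt: "c t \<le> exp k * ((1 - l) * (a t / A) + l * (b t / B))" for t
  proof -
    have "c t \<le> exp ((1 - l) * ln (a t) + l * ln (b t) + K)"
      using le[of t] c(1)[of t] by (metis exp_le_cancel_iff exp_ln)
    also have "\<dots> = exp k * (exp ((1 - l) * ln (a t / A)) * exp (l * ln (b t / B)))"
      using a(1)[of t] b(1)[of t] AB unfolding k_def exp_add[symmetric] by (simp add: ln_div algebra_simps)
    also have "\<dots> \<le> exp k * ((1 - l) * (a t / A) + l * (b t / B))"
      using Youngs_inequality_0[of "1-l" l "a t / A" "b t / B"] l a(1)[of t] b(1)[of t] AB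
      by (intro mult_left_mono) (auto simp: powr_def)
    finally show ?thesis .
  qed
  have "integral\<^sup>L M c \<le> (\<integral>t. exp k * ((1 - l) * (a t / A) + l * (b t / B)) \<partial>M)"
    by (rule integral_mono) (use a b c pt in auto)
  also have "\<dots> = exp k" using a b AB by (simp add: A_def[symmetric] B_def[symmetric])
  finally show ?thesis using c(3) unfolding k_def A_def B_def
    by (metis ln_exp ln_mono)
qed

text \<open>A concave function is continuous and lies below a tangent line, so f lies below a
  multiple of a shifted Gaussian. Convexity has no such consequence, hence integrability of slices
  requires a separate argument in that case.\<close>

lemma gauss_concave_1d:
  assumes f: "\<And>t. 0 < f t" and s: "0 < \<sigma>"
    and c: "concave_on UNIV (\<lambda>t. ln (f t) + t\<^sup>2 / (2 * \<sigma>\<^sup>2))"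
  shows "continuous_on UNIV f" "integrable lborel f"
proof -
  define \<psi> where "\<psi> t = ln (f t) + t\<^sup>2 / (2 * \<sigma>\<^sup>2)" for t
  have cv: "convex_on UNIV (\<lambda>t. - \<psi> t)" using c by (simp add: concave_on_def \<psi>_def)
  have "continuous_on UNIV (\<lambda>t. - (- \<psi> t))"
    by (intro continuous_on_minus convex_on_continuous[OF open_UNIV cv])
  then have "continuous_on UNIV \<psi>" by simp
  then have "continuous_on UNIV (\<lambda>t. exp (\<psi> t - t\<^sup>2 / (2 * \<sigma>\<^sup>2)))"
    using s by (intro continuous_intros) auto
  moreover have f_eq: "f t = exp (\<psi> t - t\<^sup>2 / (2 * \<sigma>\<^sup>2))" for t using f by (simp add: \<psi>_def)
  ultimately show cf: "continuous_on UNIV f" by simp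
  \<comment> \<open>A supporting line at 0; its slope is, up to sign, the infimum of the right
    difference quotients of - \<psi>.\<close>
  obtain q where q: "\<psi> t \<le> \<psi> 0 + q * t" for t
  proof -
    define q' where "q' = Inf ((\<lambda>t. (- \<psi> 0 - - \<psi> t) / (0 - t)) ` ({0<..} \<inter> UNIV))"
    have "- \<psi> 0 + q' * (t - 0) \<le> - \<psi> t" for t
      using convex_le_Inf_differential[OF cv, of 0 t] by (simp add: q'_def)
    then show ?thesis using that[of "- q'"] by (metis diff_0_right minus_add_distrib minus_le_iff minus_minus mult_minus_left)
  qed
  \<comment> \<open>From completing the square: the linear term q t moves the centre of the Gaussian
    to q times the variance.\<close>
  define C where "C = exp (\<psi> 0 + q\<^sup>2 * \<sigma>\<^sup>2 / 2) * sqrt (2 * pi * \<sigma>\<^sup>2)"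
  have "f t \<le> C * normal_density (q * \<sigma>\<^sup>2) \<sigma> t" for t
  proof -
    have "f t \<le> exp (\<psi> 0 + q * t - t\<^sup>2 / (2 * \<sigma>\<^sup>2))" unfolding f_eq using q[of t] by simp
    also have "\<psi> 0 + q * t - t\<^sup>2 / (2 * \<sigma>\<^sup>2) = (\<psi> 0 + q\<^sup>2 * \<sigma>\<^sup>2 / 2) + (- (t - q * \<sigma>\<^sup>2)\<^sup>2 / (2 * \<sigma>\<^sup>2))"
      using s by (simp add: field_simps power2_eq_square)
    also have "exp \<dots> = C * normal_density (q * \<sigma>\<^sup>2) \<sigma> t"
      using s unfolding exp_add[of "\<psi> 0 + q\<^sup>2 * \<sigma>\<^sup>2 / 2"] by (simp add: C_def normal_density_def)
    finally show ?thesis .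
  qed
  moreover have "integrable lborel (\<lambda>t. C * normal_density (q * \<sigma>\<^sup>2) \<sigma> t)" using s by simp
  ultimately show "integrable lborel f"
    using f borel_measurable_continuous_onI[OF cf]
    by (intro Bochner_Integration.integrable_bound[of lborel "\<lambda>t. C * normal_density (q * \<sigma>\<^sup>2) \<sigma> t" f])
       (auto intro!: AE_I2 simp: less_imp_le intro: order_trans[OF _ abs_ge_self])
qed

lemma gauss_convex_1d_continuous:
  assumes f: "\<And>t. 0 < f t" and s: "0 < \<sigma>"
    and c: "convex_on UNIV (\<lambda>t. ln (f t) + t\<^sup>2 / (2 * \<sigma>\<^sup>2))"
  shows "continuous_on UNIV f"
proof -
  have "continuous_on UNIV (\<lambda>t. exp (ln (f t) + t\<^sup>2 / (2 * \<sigma>\<^sup>2) - t\<^sup>2 / (2 * \<sigma>\<^sup>2)))"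
    using s by (intro continuous_intros convex_on_continuous[OF open_UNIV c]) auto
  then show ?thesis using f by simp
qed

section \<open>Semi-log-concave and semi-log-convex densities on finite products\<close>

abbreviation PL :: "'i set \<Rightarrow> ('i \<Rightarrow> real) measure" where
  "PL I \<equiv> PiM I (\<lambda>_. lborel)"

interpretation PL: product_sigma_finite "\<lambda>_::'i. lborel :: real measure" ..

definition sumsq :: "'i set \<Rightarrow> ('i \<Rightarrow> real) \<Rightarrow> real" where
  "sumsq I x = (\<Sum>i\<in>I. (x i)\<^sup>2)"

definition comb :: "real \<Rightarrow> ('i \<Rightarrow> real) \<Rightarrow> ('i \<Rightarrow> real) \<Rightarrow> 'i \<Rightarrow> real" where
  "comb l x y = (\<lambda>i. (1 - l) * x i + l * y i)"

lemma space_PL: "space (PL I) = extensional I"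
  by (auto simp: space_PiM PiE_def)

text \<open>Off I both points have the same value u = \<open>undefined\<close>, and (1 - l) u + l u
  = u.\<close>

lemma comb_extensional: "x \<in> extensional I \<Longrightarrow> y \<in> extensional I \<Longrightarrow> comb l x y \<in> extensional I"
  by (auto simp: extensional_def comb_def algebra_simps)

lemma upd_extensional: "y \<in> extensional I \<Longrightarrow> y(j := t) \<in> extensional (insert j I)"
  by (auto simp: extensional_def)

lemma comb_upd: "comb l (x(j := s)) (y(j := t)) = (comb l x y)(j := (1 - l) * s + l * t)"
  by (auto simp: comb_def)

lemma sumsq_upd: "finite I \<Longrightarrow> j \<notin> I \<Longrightarrow> sumsq (insert j I) (y(j := t)) = sumsq I y + t\<^sup>2"
  by (auto simp: sumsq_def intro!: sum.cong)

lemma sumsq_nonneg: "0 \<le> sumsq I x" by (simp add: sumsq_def sum_nonneg)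

lemma sumsq_measurable [measurable]: "sumsq I \<in> borel_measurable (PL I)"
  unfolding sumsq_def by measurable

text \<open>Fubini for null sets: almost every slice of a null set containing the exceptional points
  is null.\<close>

lemma AE_PL_insert:
  assumes I: "finite I" "j \<notin> I" and P: "AE x in PL (insert j I). P x"
  shows "AE t in lborel. AE y in PL I. P (y(j := t))"
proof -
  obtain N where N: "{x \<in> space (PL (insert j I)). \<not> P x} \<subseteq> N" "emeasure (PL (insert j I)) N = 0"
    and [measurable]: "N \<in> sets (PL (insert j I))"
    using P by (rule AE_E)
  interpret I: finite_product_sigma_finite "\<lambda>_. lborel :: real measure" I by standard (rule I)
  have [measurable]: "(\<lambda>(t, y). y(j := t)) \<in> measurable (lborel \<Otimes>\<^sub>M PL I) (PL (insert j I))"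
    using measurable_compose[OF measurable_pair_swap' measurable_add_dim[of j I "\<lambda>_. lborel"]]
    by (simp add: case_prod_beta')
  have "0 = (\<integral>\<^sup>+x. indicator N x \<partial>PL (insert j I))" using N by simp
  also have "\<dots> = (\<integral>\<^sup>+t. \<integral>\<^sup>+y. indicator N (y(j := t)) \<partial>PL I \<partial>lborel)"
    using I by (subst PL.product_nn_integral_insert_rev) auto
  finally have "AE t in lborel. (\<integral>\<^sup>+y. indicator N (y(j := t)) \<partial>PL I) = 0"
    by (subst (asm) eq_commute, subst (asm) nn_integral_0_iff_AE) auto
  then show ?thesis
  proof (eventually_elim)
    case (elim t)
    then have "AE y in PL I. indicator N (y(j := t)) = (0 :: ennreal)"
      by (subst (asm) nn_integral_0_iff_AE) auto
    then show ?case
      using AE_space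
      by eventually_elim (use N(1) upd_extensional[of _ I j t] in \<open>auto simp: space_PL split: split_indicator_asm\<close>)
  qed
qed

text \<open>A convex set of full measure is the whole space, by induction on the coordinates: almost
  every hyperplane x_j = t lies entirely in C, and any point is a convex combination of points on
  two such hyperplanes, one on each side. It upgrades the almost-everywhere finiteness that Fubini
  gives to finiteness at every point.\<close>

lemma AE_imp_all_of_convex:
  fixes C :: "('i \<Rightarrow> real) set"
  assumes "finite I" "\<And>x y l. x \<in> C \<Longrightarrow> y \<in> C \<Longrightarrow> 0 \<le> l \<Longrightarrow> l \<le> 1 \<Longrightarrow> comb l x y \<in> C"
    "AE x in PL I. x \<in> C" "x \<in> extensional I"
  shows "x \<in> C"
  using assms
proof (induction I arbitrary: C x rule: finite_induct)
  case empty
  have "{\<lambda>k. undefined} \<subseteq> C"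
    using empty.prems(2) by (subst (asm) PiM_empty) (auto simp: AE_count_space)
  then show ?case using empty(3) by (auto simp: extensional_def fun_eq_iff)
next
  case (insert j I)
  define T where "T = {t. \<forall>y\<in>extensional I. y(j := t) \<in> C}"
  have "AE t in lborel. t \<in> T"
    using AE_PL_insert[OF insert(1,2,5)]
  proof eventually_elim
    case (elim t)
    show ?case unfolding T_def
    proof (intro CollectI ballI)
      fix y :: "'i \<Rightarrow> real" assume y: "y \<in> extensional I"
      have "y \<in> {y. y(j := t) \<in> C}"
      proof (rule insert.IH)
        fix x y :: "'i \<Rightarrow> real" and l :: real assume "x \<in> {y. y(j := t) \<in> C}" "y \<in> {y. y(j := t) \<in> C}" "0 \<le> l" "l \<le> 1"
        then have "comb l (x(j := t)) (y(j := t)) \<in> C" using insert.prems(1) by auto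
        then show "comb l x y \<in> {y. y(j := t) \<in> C}" by (simp add: comb_upd algebra_simps)
      next
        show "AE y in PL I. y \<in> {y. y(j := t) \<in> C}" using elim by (simp only: mem_Collect_eq)
      qed (rule y)
      then show "y(j := t) \<in> C" by simp
    qed
  qed
  \<comment> \<open>A set of full measure meets every open interval.\<close>
  then have ex: "\<exists>t\<in>T. a < t \<and> t < b" if "a < b" for a b
  proof (rule contrapos_pp)
    assume *: "\<not> (\<exists>t\<in>T. a < t \<and> t < b)"
    show "\<not> (AE t in lborel. t \<in> T)"
    proof
      assume "AE t in lborel. t \<in> T"
      then have "AE t in lborel. t \<notin> {a<..<b}" by eventually_elim (use * in auto)
      then have "emeasure lborel {a<..<b} = 0" by (subst (asm) AE_iff_measurable[of "{a<..<b}"]) auto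
      then show False using that by simp
    qed
  qed
  obtain t1 where t1: "t1 \<in> T" "t1 < x j" using ex[of "x j - 1" "x j"] by auto
  obtain t2 where t2: "t2 \<in> T" "x j < t2" using ex[of "x j" "x j + 1"] by auto
  \<comment> \<open>Resetting coordinate j produces a point of the smaller product, to which
    membership in \<open>T\<close> applies.\<close>
  define y where "y = x(j := undefined)"
  have y: "y \<in> extensional I" using insert.prems(3) by (auto simp: y_def extensional_def)
  define l where "l = (x j - t1) / (t2 - t1)"
  have "l * (t2 - t1) = x j - t1" using t1 t2 by (simp add: l_def)
  then have l: "(1 - l) * t1 + l * t2 = x j" "0 \<le> l" "l \<le> 1"
    by (simp add: algebra_simps) (use t1 t2 in \<open>auto simp: l_def\<close>)
  have "y(j := t1) \<in> C" "y(j := t2) \<in> C" using t1(1) t2(1) y unfolding T_def by blast+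
  then have "comb l (y(j := t1)) (y(j := t2)) \<in> C"
    using l(2,3) by (rule insert.prems(1))
  moreover have "comb l (y(j := t1)) (y(j := t2)) = x"
    unfolding comb_upd l(1) by (auto simp: comb_def y_def fun_eq_iff algebra_simps)
  ultimately show ?case by simp
qed

text \<open>\<open>\<epsilon> = 1\<close> is semi-log-convexity and \<open>\<epsilon> = - 1\<close> is semi-log-concavity, with \<open>\<beta> = \<sigma>\<^sup>2\<close>. Points are functions
  that are \<open>undefined\<close> outside \<open>I\<close>, a condition that is preserved by convex combinations.\<close>
definition semi_log_cvx :: "real \<Rightarrow> real \<Rightarrow> 'i set \<Rightarrow> (('i \<Rightarrow> real) \<Rightarrow> real) \<Rightarrow> bool" where
  "semi_log_cvx \<epsilon> \<sigma> I v \<longleftrightarrow> (\<forall>x\<in>extensional I. \<forall>y\<in>extensional I. \<forall>l. 0 \<le> l \<longrightarrow> l \<le> 1 \<longrightarrow>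
     \<epsilon> * (ln (v (comb l x y)) + sumsq I (comb l x y) / (2 * \<sigma>\<^sup>2))
       \<le> (1 - l) * (\<epsilon> * (ln (v x) + sumsq I x / (2 * \<sigma>\<^sup>2))) + l * (\<epsilon> * (ln (v y) + sumsq I y / (2 * \<sigma>\<^sup>2))))"

text \<open>The second moment is carried through the induction so that the squares in the
  one-dimensional transport cost can be expanded.\<close>

definition semi_log_density :: "real \<Rightarrow> real \<Rightarrow> 'i set \<Rightarrow> (('i \<Rightarrow> real) \<Rightarrow> real) \<Rightarrow> bool" where
  "semi_log_density \<epsilon> \<sigma> I v \<longleftrightarrow> v \<in> borel_measurable (PL I) \<and> (\<forall>x\<in>extensional I. 0 < v x) \<and>
     (\<integral>\<^sup>+x. ennreal (v x) \<partial>PL I) = 1 \<and> (\<integral>\<^sup>+x. ennreal (v x * sumsq I x) \<partial>PL I) < \<infinity> \<and> semi_log_cvx \<epsilon> \<sigma> I v"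

definition marginal :: "'i \<Rightarrow> (('i \<Rightarrow> real) \<Rightarrow> real) \<Rightarrow> ('i \<Rightarrow> real) \<Rightarrow> real" where
  "marginal j v y = (\<integral>t. v (y(j := t)) \<partial>lborel)"

section \<open>Slices, marginals and conditional densities\<close>

context
  fixes \<epsilon> \<sigma> :: real and I :: "'i set" and j :: 'i and v :: "('i \<Rightarrow> real) \<Rightarrow> real"
  assumes I: "finite I" "j \<notin> I" and s: "0 < \<sigma>" and eps: "\<epsilon> = 1 \<or> \<epsilon> = - 1"
    and v: "semi_log_density \<epsilon> \<sigma> (insert j I) v"
begin

lemma slice_pos: "y \<in> extensional I \<Longrightarrow> 0 < v (y(j := t))"
  using v upd_extensional[of y I j t] by (auto simp: semi_log_density_def)

lemma semi_log_density_measurable [measurable]: "v \<in> borel_measurable (PL (insert j I))"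
  using v by (auto simp: semi_log_density_def)

lemma slice_pair_measurable [measurable]: "(\<lambda>(y, t). v (y(j := t))) \<in> borel_measurable (PL I \<Otimes>\<^sub>M lborel)"
  using measurable_compose[OF measurable_add_dim[of j I "\<lambda>_. lborel"] semi_log_density_measurable]
  by (simp add: case_prod_beta')

lemma slice_cvx:
  assumes x: "x \<in> extensional I" and y: "y \<in> extensional I" and l: "0 \<le> l" "l \<le> 1"
  shows "\<epsilon> * (ln (v ((comb l x y)(j := (1 - l) * s + l * t))) + (sumsq I (comb l x y) + ((1 - l) * s + l * t)\<^sup>2) / (2 * \<sigma>\<^sup>2))
    \<le> (1 - l) * (\<epsilon> * (ln (v (x(j := s))) + (sumsq I x + s\<^sup>2) / (2 * \<sigma>\<^sup>2)))
      + l * (\<epsilon> * (ln (v (y(j := t))) + (sumsq I y + t\<^sup>2) / (2 * \<sigma>\<^sup>2)))"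
proof -
  have "semi_log_cvx \<epsilon> \<sigma> (insert j I) v" using v by (simp add: semi_log_density_def)
  from this[unfolded semi_log_cvx_def, rule_format, OF upd_extensional[OF x, of j s] upd_extensional[OF y, of j t] l]
  show ?thesis by (simp add: comb_upd sumsq_upd I)
qed

lemma comb_self: "comb l y y = y" by (auto simp: comb_def algebra_simps)

lemma slice_convex:
  assumes "\<epsilon> = 1" and y: "y \<in> extensional I"
  shows "convex_on UNIV (\<lambda>t. ln (v (y(j := t))) + t\<^sup>2 / (2 * \<sigma>\<^sup>2))"
proof (rule convex_onI)
  fix l s t :: real assume "0 < l" "l < 1"
  then show "ln (v (y(j := (1 - l) *\<^sub>R s + l *\<^sub>R t))) + ((1 - l) *\<^sub>R s + l *\<^sub>R t)\<^sup>2 / (2 * \<sigma>\<^sup>2)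
      \<le> (1 - l) * (ln (v (y(j := s))) + s\<^sup>2 / (2 * \<sigma>\<^sup>2)) + l * (ln (v (y(j := t))) + t\<^sup>2 / (2 * \<sigma>\<^sup>2))"
    using slice_cvx[OF y y, of l s t] assms(1) by (simp add: comb_self add_divide_distrib diff_divide_distrib algebra_simps)
qed auto

lemma slice_concave:
  assumes "\<epsilon> = - 1" and y: "y \<in> extensional I"
  shows "concave_on UNIV (\<lambda>t. ln (v (y(j := t))) + t\<^sup>2 / (2 * \<sigma>\<^sup>2))"
  unfolding concave_on_def
proof (rule convex_onI)
  fix l s t :: real assume "0 < l" "l < 1"
  then show "- (ln (v (y(j := (1 - l) *\<^sub>R s + l *\<^sub>R t))) + ((1 - l) *\<^sub>R s + l *\<^sub>R t)\<^sup>2 / (2 * \<sigma>\<^sup>2))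
      \<le> (1 - l) * - (ln (v (y(j := s))) + s\<^sup>2 / (2 * \<sigma>\<^sup>2)) + l * - (ln (v (y(j := t))) + t\<^sup>2 / (2 * \<sigma>\<^sup>2))"
    using slice_cvx[OF y y, of l s t] assms(1) by (simp add: comb_self add_divide_distrib diff_divide_distrib algebra_simps)
qed auto

lemma slice_continuous:
  assumes y: "y \<in> extensional I" shows "continuous_on UNIV (\<lambda>t. v (y(j := t)))"
  using eps gauss_concave_1d(1)[OF slice_pos[OF y] s slice_concave[OF _ y]]
    gauss_convex_1d_continuous[OF slice_pos[OF y] s slice_convex[OF _ y]] by blast

lemma slice_measurable: "y \<in> extensional I \<Longrightarrow> (\<lambda>t. v (y(j := t))) \<in> borel_measurable borel"
  by (intro borel_measurable_continuous_onI slice_continuous)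

lemma nn_integral_slices:
  assumes [measurable]: "\<phi> \<in> borel_measurable (PL (insert j I))"
  shows "(\<integral>\<^sup>+x. \<phi> x \<partial>PL (insert j I)) = (\<integral>\<^sup>+y. \<integral>\<^sup>+t. \<phi> (y(j := t)) \<partial>lborel \<partial>PL I)"
  using I by (subst PL.product_nn_integral_insert) auto

text \<open>Fubini gives finiteness for almost every y only, whereas the marginal is used at every
  point. The set of good y is convex, since Young's inequality bounds a slice at a convex
  combination by the slices at its endpoints, so it is everything.\<close>

lemma slice_integrable_convex:
  assumes e: "\<epsilon> = 1" and y: "y \<in> extensional I"
  shows "(\<integral>\<^sup>+t. ennreal (v (y(j := t))) \<partial>lborel) < \<infinity>"
proof -
  define C where "C = {y \<in> extensional I. (\<integral>\<^sup>+t. ennreal (v (y(j := t))) \<partial>lborel) < \<infinity>}"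
  have "y \<in> C"
  proof (rule AE_imp_all_of_convex[OF I(1) _ _ y])
    have "(\<integral>\<^sup>+y. \<integral>\<^sup>+t. ennreal (v (y(j := t))) \<partial>lborel \<partial>PL I) = 1"
      using v by (subst nn_integral_slices[symmetric]) (auto simp: semi_log_density_def)
    then have "AE y in PL I. (\<integral>\<^sup>+t. ennreal (v (y(j := t))) \<partial>lborel) \<noteq> \<infinity>"
      by (intro nn_integral_PInf_AE) (auto simp: less_top[symmetric])
    then show "AE y in PL I. y \<in> C"
      using AE_space by eventually_elim (auto simp: C_def space_PL less_top)
  next
    fix x y :: "'i \<Rightarrow> real" and l :: real assume x: "x \<in> C" and y: "y \<in> C" and l: "0 \<le> l" "l \<le> 1"
    let ?z = "comb l x y"
    have xy: "x \<in> extensional I" "y \<in> extensional I" using x y by (auto simp: C_def)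
    \<comment> \<open>The contribution of the squares of the coordinates in I. The squares of
      coordinate j cancel, because the same t is used at x, y and their combination.\<close>
    define K where "K = ((1 - l) * sumsq I x + l * sumsq I y - sumsq I ?z) / (2 * \<sigma>\<^sup>2)"
    have "v (?z(j := t)) \<le> exp K * ((1 - l) * v (x(j := t)) + l * v (y(j := t)))" for t
    proof -
      have p: "0 < v (x(j := t))" "0 < v (y(j := t))" "0 < v (?z(j := t))"
        using slice_pos xy comb_extensional[OF xy] by auto
      have "ln (v (?z(j := t))) \<le> (1 - l) * ln (v (x(j := t))) + l * ln (v (y(j := t))) + K"
        using slice_cvx[OF xy l, of t t] e by (simp add: K_def add_divide_distrib diff_divide_distrib algebra_simps)
      then have "v (?z(j := t)) \<le> exp ((1 - l) * ln (v (x(j := t))) + l * ln (v (y(j := t))) + K)"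
        using p(3) by (metis exp_le_cancel_iff exp_ln)
      also have "\<dots> = exp K * (v (x(j := t)) powr (1 - l) * v (y(j := t)) powr l)"
        using p by (simp add: powr_def exp_add)
      also have "\<dots> \<le> exp K * ((1 - l) * v (x(j := t)) + l * v (y(j := t)))"
        using Youngs_inequality_0[of "1 - l" l] p l by (intro mult_left_mono) auto
      finally show ?thesis .
    qed
    then have "(\<integral>\<^sup>+t. ennreal (v (?z(j := t))) \<partial>lborel)
      \<le> (\<integral>\<^sup>+t. ennreal (exp K * (1 - l)) * ennreal (v (x(j := t))) + ennreal (exp K * l) * ennreal (v (y(j := t))) \<partial>lborel)"
      using l slice_pos[OF xy(1)] slice_pos[OF xy(2)]
      by (intro nn_integral_mono)
         (simp add: ennreal_mult'[symmetric] ennreal_plus[symmetric] less_imp_le algebra_simps ennreal_leI del: ennreal_plus)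
    also have "\<dots> = ennreal (exp K * (1 - l)) * (\<integral>\<^sup>+t. ennreal (v (x(j := t))) \<partial>lborel)
        + ennreal (exp K * l) * (\<integral>\<^sup>+t. ennreal (v (y(j := t))) \<partial>lborel)"
      using slice_measurable[OF xy(1)] slice_measurable[OF xy(2)]
      by (subst nn_integral_add) (auto simp: nn_integral_cmult)
    also have "\<dots> < \<infinity>" using x y by (auto simp: C_def ennreal_mult_less_top)
    finally show "?z \<in> C" using comb_extensional[OF xy] by (simp add: C_def)
  qed
  then show ?thesis by (simp add: C_def)
qed

lemma slice_integrable:
  assumes y: "y \<in> extensional I" shows "integrable lborel (\<lambda>t. v (y(j := t)))"
proof (cases "\<epsilon> = 1")
  case True
  show ?thesis
    by (rule integrableI_nonneg)
       (use slice_integrable_convex[OF True y] slice_measurable[OF y] slice_pos[OF y] in \<open>auto simp: less_imp_le\<close>)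
next
  case False
  then show ?thesis using eps gauss_concave_1d(2)[OF slice_pos[OF y] s slice_concave[OF _ y]] by blast
qed

lemma marginal_pos: "y \<in> extensional I \<Longrightarrow> 0 < marginal j v y"
  unfolding marginal_def
  by (rule pos_density_normalize(1)[OF slice_pos slice_continuous slice_integrable])

lemma conditional_pos_density:
  "y \<in> extensional I \<Longrightarrow> pos_density (\<lambda>t. v (y(j := t)) / marginal j v y)"
  unfolding marginal_def
  by (rule pos_density_normalize(2)[OF slice_pos slice_continuous slice_integrable])

lemma nn_integral_slice:
  assumes y: "y \<in> extensional I"
  shows "(\<integral>\<^sup>+t. ennreal (v (y(j := t))) \<partial>lborel) = ennreal (marginal j v y)"
  unfolding marginal_def
  by (rule nn_integral_eq_integral[OF slice_integrable[OF y]]) (use slice_pos[OF y] in \<open>auto simp: less_imp_le\<close>)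

lemma marginal_measurable [measurable]: "marginal j v \<in> borel_measurable (PL I)"
  unfolding marginal_def[abs_def] by measurable

text \<open>The semi-convex case compares slices at equal t and integrates by Hoelder's inequality.
  The semi-concave case compares slices at different s and t and uses Prekopa-Leindler.\<close>

lemma marginal_semi_log_cvx: "semi_log_cvx \<epsilon> \<sigma> I (marginal j v)"
  unfolding semi_log_cvx_def
proof (intro ballI allI impI)
  fix x y :: "'i \<Rightarrow> real" and l :: real assume xy: "x \<in> extensional I" "y \<in> extensional I" and l: "0 \<le> l" "l \<le> 1"
  let ?z = "comb l x y"
  note z = comb_extensional[OF xy, of l]
  define K where "K = (sumsq I ?z - (1 - l) * sumsq I x - l * sumsq I y) / (2 * \<sigma>\<^sup>2)"
  show "\<epsilon> * (ln (marginal j v ?z) + sumsq I ?z / (2 * \<sigma>\<^sup>2))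
       \<le> (1 - l) * (\<epsilon> * (ln (marginal j v x) + sumsq I x / (2 * \<sigma>\<^sup>2))) + l * (\<epsilon> * (ln (marginal j v y) + sumsq I y / (2 * \<sigma>\<^sup>2)))"
  proof (cases "\<epsilon> = 1")
    case True
    have "ln (marginal j v ?z) \<le> (1 - l) * ln (marginal j v x) + l * ln (marginal j v y) + - K"
      unfolding marginal_def
    proof (rule holder_log_convex)
      show "ln (v (?z(j := t))) \<le> (1 - l) * ln (v (x(j := t))) + l * ln (v (y(j := t))) + - K" for t
        using slice_cvx[OF xy l, of t t] True by (simp add: K_def add_divide_distrib diff_divide_distrib algebra_simps)
    qed (use l xy z slice_pos slice_integrable marginal_pos[unfolded marginal_def] in auto)
    then show ?thesis using True by (simp add: K_def add_divide_distrib diff_divide_distrib algebra_simps)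
  next
    case False
    then have e: "\<epsilon> = - 1" using eps by simp
    have "(1 - l) * ln (marginal j v x) + l * ln (marginal j v y) \<le> ln (marginal j v ?z) + K"
      unfolding marginal_def
    proof (rule prekopa_leindler_1d)
      fix s t :: real
      let ?u = "(1 - l) * s + l * t"
      \<comment> \<open>By convexity of the square, the terms of coordinate j have the favourable
        sign and can be discarded, which leaves the constant K.\<close>
      have "?u\<^sup>2 \<le> (1 - l) * s\<^sup>2 + l * t\<^sup>2"
      proof -
        have "(1 - l) * s\<^sup>2 + l * t\<^sup>2 - ?u\<^sup>2 = l * (1 - l) * (s - t)\<^sup>2"
          by (simp add: power2_eq_square algebra_simps)
        moreover have "0 \<le> l * (1 - l) * (s - t)\<^sup>2" using l by simp
        ultimately show ?thesis by linarith
      qed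
      then have "?u\<^sup>2 / (2 * \<sigma>\<^sup>2) \<le> ((1 - l) * s\<^sup>2 + l * t\<^sup>2) / (2 * \<sigma>\<^sup>2)"
        by (intro divide_right_mono) auto
      then show "(1 - l) * ln (v (x(j := s))) + l * ln (v (y(j := t))) \<le> ln (v (?z(j := ?u))) + K"
        using slice_cvx[OF xy l, of s t] e by (simp add: K_def add_divide_distrib diff_divide_distrib algebra_simps)
    qed (use l xy z slice_pos slice_integrable slice_continuous in auto)
    then show ?thesis using e by (simp add: K_def add_divide_distrib diff_divide_distrib algebra_simps)
  qed
qed

lemma marginal_semi_log_density: "semi_log_density \<epsilon> \<sigma> I (marginal j v)"
  unfolding semi_log_density_def
proof (intro conjI ballI marginal_semi_log_cvx marginal_measurable marginal_pos)
  have "(\<integral>\<^sup>+y. ennreal (marginal j v y) \<partial>PL I) = (\<integral>\<^sup>+y. \<integral>\<^sup>+t. ennreal (v (y(j := t))) \<partial>lborel \<partial>PL I)"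
    by (intro nn_integral_cong) (auto simp: nn_integral_slice space_PL)
  also have "\<dots> = 1"
    using v by (subst nn_integral_slices[symmetric]) (auto simp: semi_log_density_def)
  finally show "(\<integral>\<^sup>+y. ennreal (marginal j v y) \<partial>PL I) = 1" .
  have "(\<integral>\<^sup>+y. ennreal (marginal j v y * sumsq I y) \<partial>PL I)
     = (\<integral>\<^sup>+y. \<integral>\<^sup>+t. ennreal (v (y(j := t))) * ennreal (sumsq I y) \<partial>lborel \<partial>PL I)"
    by (intro nn_integral_cong, subst nn_integral_multc)
       (auto simp: nn_integral_slice space_PL ennreal_mult'' sumsq_nonneg slice_measurable)
  also have "\<dots> \<le> (\<integral>\<^sup>+y. \<integral>\<^sup>+t. ennreal (v (y(j := t)) * sumsq (insert j I) (y(j := t))) \<partial>lborel \<partial>PL I)"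
    using slice_pos by (intro nn_integral_mono)
      (auto simp: space_PL sumsq_upd I ennreal_mult'[symmetric] ennreal_mult''[symmetric] sumsq_nonneg less_imp_le intro!: ennreal_leI mult_left_mono)
  also have "\<dots> = (\<integral>\<^sup>+x. ennreal (v x * sumsq (insert j I) x) \<partial>PL (insert j I))"
    by (subst nn_integral_slices[symmetric]) auto
  also have "\<dots> < \<infinity>" using v by (simp add: semi_log_density_def)
  finally show "(\<integral>\<^sup>+y. ennreal (marginal j v y * sumsq I y) \<partial>PL I) < \<infinity>" .
qed

end

declare semi_log_density_measurable [measurable del] slice_pair_measurable [measurable del] marginal_measurable [measurable del]

section \<open>The Knothe map\<close>

text \<open>The integrated form of: relative entropy of a joint law is that of the marginal plus the
  conditional one. Here p and g are the values of the two marginals at a fixed point, and the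
  identity holds even where the conditional entropy is infinite.\<close>

lemma entropy_chain_rule:
  assumes f: "pos_density f" and pg: "0 < p" "0 < g"
  shows "(\<integral>\<^sup>+t. ennreal (p * f t * ln (p * f t / (g * std_normal_density t)) - p * f t + g * std_normal_density t) \<partial>lborel)
    = ennreal p * (\<integral>\<^sup>+t. ennreal (f t * ln (f t / std_normal_density t) - f t + std_normal_density t) \<partial>lborel)
      + ennreal (p * ln (p / g) - p + g)"
proof -
  let ?\<gamma> = std_normal_density
  note \<gamma> = pos_density_normal[of 1, simplified]
  note fD = pos_densityD[OF f] note \<gamma>D = pos_densityD[OF \<gamma>]
  note [measurable] = fD(4)
  define k where "k = p * ln (p / g)"
  let ?H = "\<lambda>t. p * f t * ln (p * f t / (g * ?\<gamma> t)) - p * f t + g * ?\<gamma> t"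
  let ?h = "\<lambda>t. f t * ln (f t / ?\<gamma> t) - f t + ?\<gamma> t"
  \<comment> \<open>The number k can have either sign. Its negative part is moved to the other side,
    so that every integrand stays nonnegative; the finite summand km + p is cancelled at the
    end.\<close>
  define kp km where "kp = max k 0" "km = max (- k) 0"
  have k: "kp - km = k" "0 \<le> kp" "0 \<le> km" by (auto simp: kp_km_def)
  have hn: "0 \<le> ?h t" for t by (rule gibbs_nonneg) (use fD \<gamma>D in auto)
  have Hn: "0 \<le> ?H t" for t by (rule gibbs_nonneg) (use fD \<gamma>D pg in auto)
  have eq: "?H t + (p * ?\<gamma> t + km * f t) = p * ?h t + (kp * f t + g * ?\<gamma> t)" for t
  proof -
    have "ln (p * f t / (g * ?\<gamma> t)) = ln (p / g) + ln (f t / ?\<gamma> t)"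
      using pg fD(1)[of t] \<gamma>D(1)[of t] by (simp add: ln_mult ln_div)
    then have "?H t = k * f t + p * (f t * ln (f t / ?\<gamma> t)) - p * f t + g * ?\<gamma> t"
      by (simp add: k_def algebra_simps)
    then show ?thesis unfolding k(1)[symmetric] by (simp add: algebra_simps)
  qed
  have i: "(\<integral>\<^sup>+t. ennreal (a * f t + b * ?\<gamma> t) \<partial>lborel) = ennreal (a + b)" if "0 \<le> a" "0 \<le> b" for a b
  proof -
    have "(\<integral>\<^sup>+t. ennreal (a * f t + b * ?\<gamma> t) \<partial>lborel)
        = (\<integral>\<^sup>+t. ennreal a * ennreal (f t) + ennreal b * ennreal (?\<gamma> t) \<partial>lborel)"
      using that fD(2) by (intro nn_integral_cong) (simp add: ennreal_mult ennreal_plus)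
    also have "\<dots> = ennreal a + ennreal b"
      by (subst nn_integral_add) (auto simp: nn_integral_cmult fD(7) \<gamma>D(7))
    finally show ?thesis using that by (simp add: ennreal_plus)
  qed
  have "(\<integral>\<^sup>+t. ennreal (?H t) \<partial>lborel) + ennreal (km + p)
      = (\<integral>\<^sup>+t. ennreal (?H t) + ennreal (km * f t + p * ?\<gamma> t) \<partial>lborel)"
    using k pg by (subst nn_integral_add) (auto simp: i)
  also have "\<dots> = (\<integral>\<^sup>+t. ennreal p * ennreal (?h t) + ennreal (kp * f t + g * ?\<gamma> t) \<partial>lborel)"
  proof (rule nn_integral_cong)
    fix t
    have "ennreal (?H t) + ennreal (km * f t + p * ?\<gamma> t) = ennreal (?H t + (km * f t + p * ?\<gamma> t))"
      using Hn k pg fD(2) by (intro ennreal_plus[symmetric]) auto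
    also have "?H t + (km * f t + p * ?\<gamma> t) = p * ?h t + (kp * f t + g * ?\<gamma> t)" using eq[of t] by simp
    also have "ennreal \<dots> = ennreal (p * ?h t) + ennreal (kp * f t + g * ?\<gamma> t)"
      using hn k pg fD(2) by (intro ennreal_plus) auto
    also have "ennreal (p * ?h t) = ennreal p * ennreal (?h t)"
      using pg hn by (intro ennreal_mult) auto
    finally show "ennreal (?H t) + ennreal (km * f t + p * ?\<gamma> t) = ennreal p * ennreal (?h t) + ennreal (kp * f t + g * ?\<gamma> t)" .
  qed
  also have "\<dots> = ennreal p * (\<integral>\<^sup>+t. ennreal (?h t) \<partial>lborel) + ennreal (kp + g)"
    using k pg by (subst nn_integral_add) (auto simp: i nn_integral_cmult)
  also have "kp + g = (k - p + g) + (km + p)" using k by simp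
  also have "ennreal \<dots> = ennreal (k - p + g) + ennreal (km + p)"
    using gibbs_nonneg[OF pg] k pg by (intro ennreal_plus) (auto simp: k_def)
  finally have "ennreal (km + p) + (\<integral>\<^sup>+t. ennreal (?H t) \<partial>lborel)
     = ennreal (km + p) + (ennreal p * (\<integral>\<^sup>+t. ennreal (?h t) \<partial>lborel) + ennreal (k - p + g))"
    by (simp add: ac_simps)
  then show ?thesis by (subst (asm) ennreal_add_left_cancel) (simp add: k_def)
qed

definition gaussI :: "'i set \<Rightarrow> ('i \<Rightarrow> real) \<Rightarrow> real" where
  "gaussI I x = (\<Prod>i\<in>I. std_normal_density (x i))"

lemma gaussI_pos: "0 < gaussI I x"
  unfolding gaussI_def by (intro prod_pos) (simp add: normal_density_pos)

lemma gaussI_measurable [measurable]: "gaussI I \<in> borel_measurable (PL I)"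
  unfolding gaussI_def[abs_def]
  by measurable

lemma gaussI_upd: "finite I \<Longrightarrow> j \<notin> I \<Longrightarrow> gaussI (insert j I) (y(j := t)) = gaussI I y * std_normal_density t"
proof -
  assume I: "finite I" "j \<notin> I"
  have "(\<Prod>i\<in>I. std_normal_density ((y(j := t)) i)) = (\<Prod>i\<in>I. std_normal_density (y i))"
    by (rule prod.cong) (use I in auto)
  then show ?thesis using I by (simp add: gaussI_def del: fun_upd_apply) simp
qed

definition sqdist :: "'i set \<Rightarrow> ('i \<Rightarrow> real) \<Rightarrow> ('i \<Rightarrow> real) \<Rightarrow> real" where
  "sqdist I x y = (\<Sum>i\<in>I. (x i - y i)\<^sup>2)"

lemma sqdist_nonneg: "0 \<le> sqdist I x y" by (simp add: sqdist_def sum_nonneg)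

lemma sqdist_upd: "finite I \<Longrightarrow> j \<notin> I \<Longrightarrow> sqdist (insert j I) (x(j := s)) (y(j := t)) = sqdist I x y + (s - t)\<^sup>2"
  by (auto simp: sqdist_def intro!: sum.cong)

lemma sqdist_measurable [measurable (raw)]:
  "f \<in> measurable M (PL I) \<Longrightarrow> g \<in> measurable M (PL I) \<Longrightarrow> (\<lambda>x. sqdist I (f x) (g x)) \<in> borel_measurable M"
proof -
  assume fg: "f \<in> measurable M (PL I)" "g \<in> measurable M (PL I)"
  have "(\<lambda>x. f x i) \<in> borel_measurable M" "(\<lambda>x. g x i) \<in> borel_measurable M" if "i \<in> I" for i
    using measurable_compose[OF fg(1) measurable_component_singleton[OF that]]
      measurable_compose[OF fg(2) measurable_component_singleton[OF that]] by simp_all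
  then show ?thesis unfolding sqdist_def
    by (intro borel_measurable_sum borel_measurable_power borel_measurable_diff)
qed

text \<open>Here y is a point on the target side: the map rearranges \<gamma> onto the conditional
  density of coordinate j under v, given that the others equal y.\<close>

definition knothe :: "'i \<Rightarrow> (('i \<Rightarrow> real) \<Rightarrow> real) \<Rightarrow> ('i \<Rightarrow> real) \<Rightarrow> real \<Rightarrow> real" where
  "knothe j v y = rearr std_normal_density (\<lambda>t. v (y(j := t)) / marginal j v y)"

text \<open>Joint measurability is seen on sublevel sets, where the rearrangement disappears: what
  remains is an inequality between the normal cdf and the conditional cdf at a, and the latter is a
  parametric integral, measurable in y.\<close>

lemma knothe_measurable:
  assumes I: "finite I" "j \<notin> I" and s: "0 < \<sigma>" and eps: "\<epsilon> = 1 \<or> \<epsilon> = - 1"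
    and v: "semi_log_density \<epsilon> \<sigma> (insert j I) v"
  shows "(\<lambda>w. knothe j v (fst w) (snd w)) \<in> borel_measurable (PL I \<Otimes>\<^sub>M lborel)"
proof (rule borel_measurable_iff_le[THEN iffD2], rule allI)
  fix a
  note \<gamma> = pos_density_normal[of 1, simplified]
  note ctx = I s eps v
  note [measurable] = marginal_measurable[OF ctx] slice_pair_measurable[OF ctx]
  define F where "F y = (\<integral>\<tau>. indicator {..a} \<tau> * (v (y(j := \<tau>)) / marginal j v y) \<partial>lborel)" for y
  have [measurable]: "F \<in> borel_measurable (PL I)" unfolding F_def[abs_def] by measurable
  have [measurable]: "cdf (law std_normal_density) \<in> borel_measurable borel"
    using DERIV_isCont[OF DERIV_cdf_law[OF \<gamma>]]
    by (intro borel_measurable_continuous_onI) (simp add: continuous_on_eq_continuous_at)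
  have F: "cdf (law (\<lambda>t. v (y(j := t)) / marginal j v y)) a = F y" if "y \<in> extensional I" for y
    unfolding cdf_def2 F_def by (rule measure_law[OF conditional_pos_density[OF ctx that]]) auto
  have "{w \<in> space (PL I \<Otimes>\<^sub>M lborel). knothe j v (fst w) (snd w) \<le> a}
    = {w \<in> space (PL I \<Otimes>\<^sub>M lborel). cdf (law std_normal_density) (snd w) \<le> F (fst w)}"
    by (auto simp: space_pair_measure space_PL knothe_def rearr_le_iff[OF \<gamma> conditional_pos_density[OF ctx]] F)
  also have "\<dots> \<in> sets (PL I \<Otimes>\<^sub>M lborel)" by measurable
  finally show "{w \<in> space (PL I \<Otimes>\<^sub>M lborel). knothe j v (fst w) (snd w) \<le> a} \<in> sets (PL I \<Otimes>\<^sub>M lborel)" .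
qed

text \<open>Induction on the coordinates: a map for the marginal on I is extended by the Knothe map
  in coordinate j. Cost and entropy both split into the part on I and a one-dimensional part
  averaged over the marginal, and the one-dimensional inequality compares the latter two. The
  push-forward is stated through integrals, which is the form in which the induction hypothesis is
  applied to costs.\<close>

lemma transport_exists:
  assumes I: "finite I" and s: "0 < \<sigma>" and es: "(\<epsilon> = 1 \<and> 1 < \<sigma>) \<or> (\<epsilon> = - 1 \<and> \<sigma> < 1)"
    and v: "semi_log_density \<epsilon> \<sigma> I v"
  shows "\<exists>T\<in>measurable (PL I) (PL I).
    (\<forall>\<phi>\<in>borel_measurable (PL I). (\<integral>\<^sup>+x. ennreal (v x) * \<phi> x \<partial>PL I) = (\<integral>\<^sup>+x. ennreal (gaussI I x) * \<phi> (T x) \<partial>PL I)) \<and>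
    (\<integral>\<^sup>+x. ennreal (gaussI I x) * ennreal (sqdist I x (T x)) \<partial>PL I) + ennreal (2 * real (card I) * (\<sigma> - 1 - ln \<sigma>))
      \<le> 2 * (\<integral>\<^sup>+x. ennreal (v x * ln (v x / gaussI I x) - v x + gaussI I x) \<partial>PL I)"
  using I v
proof (induction I arbitrary: v rule: finite_induct)
  case empty
  \<comment> \<open>The empty product is a one-point space with unit mass, so v equals 1 there and
    all integrals are trivial.\<close>
  have sp: "space (PL ({} :: 'a set)) = {\<lambda>k. undefined}" by (simp add: PiM_empty)
  have "ennreal (v (\<lambda>k. undefined)) = 1"
    using empty by (auto simp: semi_log_density_def PiM_empty nn_integral_count_space_finite)
  then have "v (\<lambda>k. undefined) = 1" by (simp add: ennreal_eq_1)
  then have "v x = 1" if "x \<in> space (PL {})" for x using that unfolding sp by simp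
  then show ?case
    by (intro bexI[of _ "\<lambda>x. x"]) (auto simp: gaussI_def sqdist_def intro!: nn_integral_cong)
next
  case (insert j I)
  let ?\<gamma> = std_normal_density
  note \<gamma> = pos_density_normal[of 1, simplified]
  have eps: "\<epsilon> = 1 \<or> \<epsilon> = - 1" using es by auto
  note ctx = insert.hyps s eps insert.prems
  define p where "p = marginal j v"
  define S where "S = knothe j v"
  define f where "f y t = v (y(j := t)) / p y" for y t
  have f: "pos_density (f y)" if "y \<in> extensional I" for y
    unfolding f_def[abs_def] p_def by (rule conditional_pos_density[OF ctx that])
  have p0: "0 < p y" if "y \<in> extensional I" for y using marginal_pos[OF ctx that] by (simp add: p_def)
  have vf: "v (y(j := t)) = p y * f y t" if "y \<in> extensional I" for y t
    using p0[OF that] by (simp add: f_def)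
  have Sy: "S y = rearr ?\<gamma> (f y)" for y unfolding S_def knothe_def f_def[abs_def] p_def ..
  have [measurable]: "(\<lambda>w. S (fst w) (snd w)) \<in> borel_measurable (PL I \<Otimes>\<^sub>M lborel)"
    unfolding S_def by (rule knothe_measurable[OF ctx])
  note [measurable] = marginal_measurable[OF ctx, folded p_def] slice_pair_measurable[OF ctx] semi_log_density_measurable[OF ctx]
  have [measurable]: "(\<lambda>w. f (fst w) (snd w)) \<in> borel_measurable (PL I \<Otimes>\<^sub>M lborel)"
    unfolding f_def by measurable
  from insert.IH[OF marginal_semi_log_density[OF ctx]]
  obtain T where [measurable]: "T \<in> measurable (PL I) (PL I)"
    and push: "\<And>\<phi>. \<phi> \<in> borel_measurable (PL I) \<Longrightarrow>
      (\<integral>\<^sup>+x. ennreal (p x) * \<phi> x \<partial>PL I) = (\<integral>\<^sup>+x. ennreal (gaussI I x) * \<phi> (T x) \<partial>PL I)"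
    and cost: "(\<integral>\<^sup>+x. ennreal (gaussI I x) * ennreal (sqdist I x (T x)) \<partial>PL I) + ennreal (2 * real (card I) * (\<sigma> - 1 - ln \<sigma>))
      \<le> 2 * (\<integral>\<^sup>+x. ennreal (p x * ln (p x / gaussI I x) - p x + gaussI I x) \<partial>PL I)"
    unfolding p_def by blast
  have Text: "T x \<in> extensional I" if "x \<in> extensional I" for x
    using measurable_space[OF \<open>T \<in> measurable (PL I) (PL I)\<close>, of x] that by (simp add: space_PL)
  \<comment> \<open>The last coordinate is rearranged at the image \<open>T x\<close>, not at x,
    because the conditional densities belong to the target law.\<close>
  define T' where "T' x = (T (restrict x I))(j := S (T (restrict x I)) (x j))" for x
  have T'_upd: "T' (x(j := t)) = (T x)(j := S (T x) t)" if "x \<in> extensional I" for x t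
  proof -
    have "restrict (x(j := t)) I = x" using that insert.hyps(2) by (auto simp: extensional_def restrict_def)
    then show ?thesis by (simp add: T'_def)
  qed
  have [measurable]: "T' \<in> measurable (PL (insert j I)) (PL (insert j I))"
  proof -
    have 1: "(\<lambda>x. T (restrict x I)) \<in> measurable (PL (insert j I)) (PL I)"
      using measurable_restrict_subset[of I "insert j I" "\<lambda>_. lborel"]
      by (intro measurable_compose[OF _ \<open>T \<in> measurable (PL I) (PL I)\<close>]) auto
    have 2: "(\<lambda>x. x j) \<in> measurable (PL (insert j I)) lborel"
      by (rule measurable_component_singleton) simp
    have "(\<lambda>x. S (fst (T (restrict x I), x j)) (snd (T (restrict x I), x j))) \<in> borel_measurable (PL (insert j I))"
      by (rule measurable_compose[OF measurable_Pair[OF 1 2]]) measurable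
    then have 3: "(\<lambda>x. S (T (restrict x I)) (x j)) \<in> measurable (PL (insert j I)) lborel" by simp
    show ?thesis unfolding T'_def[abs_def] by (rule measurable_fun_upd[OF _ 1 3]) auto
  qed
  have push': "(\<integral>\<^sup>+x. ennreal (v x) * \<phi> x \<partial>PL (insert j I)) = (\<integral>\<^sup>+x. ennreal (gaussI (insert j I) x) * \<phi> (T' x) \<partial>PL (insert j I))"
    if [measurable]: "\<phi> \<in> borel_measurable (PL (insert j I))" for \<phi>
  proof -
    have mu [measurable]: "(\<lambda>w. (fst w)(j := h w)) \<in> measurable (PL I \<Otimes>\<^sub>M lborel) (PL (insert j I))"
      if "h \<in> borel_measurable (PL I \<Otimes>\<^sub>M lborel)" for h :: "('a \<Rightarrow> real) \<times> real \<Rightarrow> real"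
      by (rule measurable_fun_upd[where J=I]) (use that in auto)
    define \<psi> where "\<psi> y = (\<integral>\<^sup>+t. ennreal (?\<gamma> t) * \<phi> (y(j := S y t)) \<partial>lborel)" for y
    have "(\<lambda>w. \<phi> ((fst w)(j := S (fst w) (snd w)))) \<in> borel_measurable (PL I \<Otimes>\<^sub>M lborel)"
      by (rule measurable_compose[OF mu that]) measurable
    then have [measurable]: "\<psi> \<in> borel_measurable (PL I)"
      unfolding \<psi>_def[abs_def] by measurable
    have ups: "(\<lambda>t. y(j := t)) \<in> measurable borel (PL (insert j I))" if "y \<in> extensional I" for y
      by (rule measurable_fun_upd[where J=I]) (use that in \<open>auto simp: space_PL\<close>)
    have "(\<integral>\<^sup>+x. ennreal (v x) * \<phi> x \<partial>PL (insert j I)) = (\<integral>\<^sup>+y. \<integral>\<^sup>+t. ennreal (v (y(j := t))) * \<phi> (y(j := t)) \<partial>lborel \<partial>PL I)"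
      by (rule nn_integral_slices[OF ctx]) measurable
    \<comment> \<open>For fixed y the conditional law of coordinate j is replaced by its
      representation as the image of \<gamma> under \<open>S y\<close>.\<close>
    also have "\<dots> = (\<integral>\<^sup>+y. ennreal (p y) * \<psi> y \<partial>PL I)"
    proof (rule nn_integral_cong)
      fix y assume "y \<in> space (PL I)"
      then have y: "y \<in> extensional I" by (simp add: space_PL)
      note fD = pos_densityD[OF f[OF y]]
      have \<phi>y: "(\<lambda>t. \<phi> (y(j := t))) \<in> borel_measurable borel"
        by (rule measurable_compose[OF ups[OF y] that])
      have fy: "(\<lambda>t. ennreal (f y t)) \<in> borel_measurable borel" using fD(4) by measurable
      have "(\<integral>\<^sup>+t. ennreal (v (y(j := t))) * \<phi> (y(j := t)) \<partial>lborel)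
          = (\<integral>\<^sup>+t. ennreal (p y) * (ennreal (f y t) * \<phi> (y(j := t))) \<partial>lborel)"
        using p0[OF y] fD(2) by (intro nn_integral_cong) (simp add: vf[OF y] ennreal_mult less_imp_le mult.assoc)
      also have "\<dots> = ennreal (p y) * (\<integral>\<^sup>+t. ennreal (f y t) * \<phi> (y(j := t)) \<partial>lborel)"
        using borel_measurable_times_ennreal[OF fy \<phi>y] by (intro nn_integral_cmult) simp
      also have "(\<integral>\<^sup>+t. ennreal (f y t) * \<phi> (y(j := t)) \<partial>lborel) = \<psi> y"
        unfolding \<psi>_def Sy by (rule nn_integral_rearr[OF \<gamma> f[OF y] \<phi>y, symmetric])
      finally show "(\<integral>\<^sup>+t. ennreal (v (y(j := t))) * \<phi> (y(j := t)) \<partial>lborel) = ennreal (p y) * \<psi> y" .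
    qed
    also have "\<dots> = (\<integral>\<^sup>+x. ennreal (gaussI I x) * \<psi> (T x) \<partial>PL I)" by (rule push) measurable
    also have "\<dots> = (\<integral>\<^sup>+x. \<integral>\<^sup>+t. ennreal (gaussI (insert j I) (x(j := t))) * \<phi> (T' (x(j := t))) \<partial>lborel \<partial>PL I)"
    proof (rule nn_integral_cong)
      fix x assume "x \<in> space (PL I)"
      then have x: "x \<in> extensional I" by (simp add: space_PL)
      have \<phi>x: "(\<lambda>t. \<phi> ((T x)(j := S (T x) t))) \<in> borel_measurable borel"
        unfolding Sy using ups[OF Text[OF x]] rearr_measurable[OF \<gamma> f[OF Text[OF x]]]
        by (intro measurable_compose[OF _ that] measurable_compose[OF _ ups[OF Text[OF x]]])
      have "ennreal (gaussI I x) * \<psi> (T x) = (\<integral>\<^sup>+t. ennreal (gaussI I x) * (ennreal (?\<gamma> t) * \<phi> ((T x)(j := S (T x) t))) \<partial>lborel)"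
        unfolding \<psi>_def using \<phi>x by (intro nn_integral_cmult[symmetric] borel_measurable_times_ennreal) auto
      also have "\<dots> = (\<integral>\<^sup>+t. ennreal (gaussI (insert j I) (x(j := t))) * \<phi> (T' (x(j := t))) \<partial>lborel)"
        by (intro nn_integral_cong)
           (simp add: T'_upd[OF x] gaussI_upd[OF insert.hyps] ennreal_mult gaussI_pos less_imp_le mult.assoc del: fun_upd_apply)
      finally show "ennreal (gaussI I x) * \<psi> (T x) = (\<integral>\<^sup>+t. ennreal (gaussI (insert j I) (x(j := t))) * \<phi> (T' (x(j := t))) \<partial>lborel)" .
    qed
    also have "\<dots> = (\<integral>\<^sup>+x. ennreal (gaussI (insert j I) x) * \<phi> (T' x) \<partial>PL (insert j I))"
      by (rule nn_integral_slices[OF ctx, symmetric]) measurable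
    finally show ?thesis .
  qed
  define d where "d = 2 * (\<sigma> - 1 - ln \<sigma>)"
  have d0: "0 \<le> d" using ln_le_minus_one[OF s] by (simp add: d_def)
  define b where "b y = (\<integral>\<^sup>+t. ennreal (?\<gamma> t) * ennreal ((t - S y t)\<^sup>2) \<partial>lborel)" for y
  define q where "q y = (\<integral>\<^sup>+t. ennreal (f y t * ln (f y t / ?\<gamma> t) - f y t + ?\<gamma> t) \<partial>lborel)" for y
  have [measurable]: "b \<in> borel_measurable (PL I)" unfolding b_def[abs_def] by measurable
  have [measurable]: "q \<in> borel_measurable (PL I)" unfolding q_def[abs_def] by measurable
  have Sm: "S y \<in> borel_measurable borel" if "y \<in> extensional I" for y
    unfolding Sy by (rule rearr_measurable[OF \<gamma> f[OF that]])
  have cost_eq: "(\<integral>\<^sup>+x. ennreal (gaussI (insert j I) x) * ennreal (sqdist (insert j I) x (T' x)) \<partial>PL (insert j I))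
     = (\<integral>\<^sup>+x. ennreal (gaussI I x) * ennreal (sqdist I x (T x)) \<partial>PL I) + (\<integral>\<^sup>+y. ennreal (p y) * b y \<partial>PL I)"
  proof -
    have "(\<integral>\<^sup>+x. ennreal (gaussI (insert j I) x) * ennreal (sqdist (insert j I) x (T' x)) \<partial>PL (insert j I))
      = (\<integral>\<^sup>+x. \<integral>\<^sup>+t. ennreal (gaussI (insert j I) (x(j := t))) * ennreal (sqdist (insert j I) (x(j := t)) (T' (x(j := t)))) \<partial>lborel \<partial>PL I)"
      by (rule nn_integral_slices[OF ctx]) measurable
    also have "\<dots> = (\<integral>\<^sup>+x. ennreal (gaussI I x) * ennreal (sqdist I x (T x)) + ennreal (gaussI I x) * b (T x) \<partial>PL I)"
    proof (rule nn_integral_cong)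
      fix x assume "x \<in> space (PL I)"
      then have x: "x \<in> extensional I" by (simp add: space_PL)
      note [measurable] = Sm[OF Text[OF x]]
      have "(\<integral>\<^sup>+t. ennreal (gaussI (insert j I) (x(j := t))) * ennreal (sqdist (insert j I) (x(j := t)) (T' (x(j := t)))) \<partial>lborel)
        = (\<integral>\<^sup>+t. ennreal (gaussI I x) * ennreal (sqdist I x (T x)) * ennreal (?\<gamma> t)
             + ennreal (gaussI I x) * (ennreal (?\<gamma> t) * ennreal ((t - S (T x) t)\<^sup>2)) \<partial>lborel)"
      proof (rule nn_integral_cong)
        fix t
        show "ennreal (gaussI (insert j I) (x(j := t))) * ennreal (sqdist (insert j I) (x(j := t)) (T' (x(j := t))))
          = ennreal (gaussI I x) * ennreal (sqdist I x (T x)) * ennreal (?\<gamma> t)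
             + ennreal (gaussI I x) * (ennreal (?\<gamma> t) * ennreal ((t - S (T x) t)\<^sup>2))"
          unfolding T'_upd[OF x] gaussI_upd[OF insert.hyps] sqdist_upd[OF insert.hyps]
          using gaussI_pos[of I x] sqdist_nonneg[of I x "T x"]
          by (simp add: ennreal_mult ennreal_plus less_imp_le algebra_simps)
      qed
      also have "\<dots> = ennreal (gaussI I x) * ennreal (sqdist I x (T x)) + ennreal (gaussI I x) * b (T x)"
        unfolding b_def by (subst nn_integral_add) (auto simp: nn_integral_cmult pos_densityD(7)[OF \<gamma>])
      finally show "(\<integral>\<^sup>+t. ennreal (gaussI (insert j I) (x(j := t))) * ennreal (sqdist (insert j I) (x(j := t)) (T' (x(j := t)))) \<partial>lborel)
        = ennreal (gaussI I x) * ennreal (sqdist I x (T x)) + ennreal (gaussI I x) * b (T x)" .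
    qed
    also have "\<dots> = (\<integral>\<^sup>+x. ennreal (gaussI I x) * ennreal (sqdist I x (T x)) \<partial>PL I) + (\<integral>\<^sup>+x. ennreal (gaussI I x) * b (T x) \<partial>PL I)"
      by (rule nn_integral_add) measurable
    \<comment> \<open>The cost in coordinate j depends on x only through \<open>T x\<close>, so the
      push-forward property turns its Gaussian average into an average over the marginal of
      v.\<close>
    also have "(\<integral>\<^sup>+x. ennreal (gaussI I x) * b (T x) \<partial>PL I) = (\<integral>\<^sup>+y. ennreal (p y) * b y \<partial>PL I)"
      by (rule push[symmetric]) measurable
    finally show ?thesis .
  qed
  \<comment> \<open>Unlike finiteness of the mass, finiteness of the second moment is obtained for
    almost every slice only; this suffices, as the inequality is integrated over y.\<close>
  have m2: "AE y in PL I. integrable lborel (\<lambda>t. f y t * t\<^sup>2)"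
  proof -
    have "(\<integral>\<^sup>+y. \<integral>\<^sup>+t. ennreal (v (y(j := t)) * t\<^sup>2) \<partial>lborel \<partial>PL I)
      \<le> (\<integral>\<^sup>+y. \<integral>\<^sup>+t. ennreal (v (y(j := t)) * sumsq (insert j I) (y(j := t))) \<partial>lborel \<partial>PL I)"
      using slice_pos[OF ctx]
      by (intro nn_integral_mono ennreal_leI mult_left_mono)
         (auto simp: sumsq_upd insert.hyps sumsq_nonneg space_PL less_imp_le simp del: fun_upd_apply)
    also have "\<dots> = (\<integral>\<^sup>+x. ennreal (v x * sumsq (insert j I) x) \<partial>PL (insert j I))"
      by (rule nn_integral_slices[OF ctx, symmetric]) measurable
    also have "\<dots> < \<infinity>" using insert.prems by (simp add: semi_log_density_def)
    finally have "AE y in PL I. (\<integral>\<^sup>+t. ennreal (v (y(j := t)) * t\<^sup>2) \<partial>lborel) \<noteq> \<infinity>"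
      by (intro nn_integral_PInf_AE) auto
    then show ?thesis using AE_space
    proof eventually_elim
      case (elim y)
      then have y: "y \<in> extensional I" by (simp add: space_PL)
      note [measurable] = slice_measurable[OF ctx y]
      have "integrable lborel (\<lambda>t. v (y(j := t)) * t\<^sup>2)"
        by (rule integrableI_nonneg) (use elim(1) slice_pos[OF ctx y] in \<open>auto simp: less_imp_le less_top simp del: fun_upd_apply\<close>)
      then have "integrable lborel (\<lambda>t. v (y(j := t)) * t\<^sup>2 / p y)" by simp
      then show ?case by (simp add: f_def del: fun_upd_apply)
    qed
  qed
  have ent: "(\<integral>\<^sup>+x. ennreal (v x * ln (v x / gaussI (insert j I) x) - v x + gaussI (insert j I) x) \<partial>PL (insert j I))
     = (\<integral>\<^sup>+y. ennreal (p y) * q y \<partial>PL I) + (\<integral>\<^sup>+y. ennreal (p y * ln (p y / gaussI I y) - p y + gaussI I y) \<partial>PL I)"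
  proof -
    have "(\<integral>\<^sup>+x. ennreal (v x * ln (v x / gaussI (insert j I) x) - v x + gaussI (insert j I) x) \<partial>PL (insert j I))
     = (\<integral>\<^sup>+y. \<integral>\<^sup>+t. ennreal (v (y(j := t)) * ln (v (y(j := t)) / gaussI (insert j I) (y(j := t))) - v (y(j := t)) + gaussI (insert j I) (y(j := t))) \<partial>lborel \<partial>PL I)"
      by (rule nn_integral_slices[OF ctx]) measurable
    also have "\<dots> = (\<integral>\<^sup>+y. ennreal (p y) * q y + ennreal (p y * ln (p y / gaussI I y) - p y + gaussI I y) \<partial>PL I)"
    proof (rule nn_integral_cong)
      fix y assume "y \<in> space (PL I)"
      then have y: "y \<in> extensional I" by (simp add: space_PL)
      show "(\<integral>\<^sup>+t. ennreal (v (y(j := t)) * ln (v (y(j := t)) / gaussI (insert j I) (y(j := t))) - v (y(j := t)) + gaussI (insert j I) (y(j := t))) \<partial>lborel)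
        = ennreal (p y) * q y + ennreal (p y * ln (p y / gaussI I y) - p y + gaussI I y)"
        unfolding vf[OF y] gaussI_upd[OF insert.hyps] q_def
        by (rule entropy_chain_rule[OF f[OF y] p0[OF y] gaussI_pos])
    qed
    also have "\<dots> = (\<integral>\<^sup>+y. ennreal (p y) * q y \<partial>PL I) + (\<integral>\<^sup>+y. ennreal (p y * ln (p y / gaussI I y) - p y + gaussI I y) \<partial>PL I)"
      by (rule nn_integral_add) measurable
    finally show ?thesis .
  qed
  have tal: "(\<integral>\<^sup>+y. ennreal (p y) * b y \<partial>PL I) + ennreal d \<le> 2 * (\<integral>\<^sup>+y. ennreal (p y) * q y \<partial>PL I)"
  proof -
    have "(\<integral>\<^sup>+y. ennreal (p y) \<partial>PL I) = 1"
      using marginal_semi_log_density[OF ctx] by (simp add: semi_log_density_def p_def)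
    then have "(\<integral>\<^sup>+y. ennreal (p y) * b y \<partial>PL I) + ennreal d = (\<integral>\<^sup>+y. ennreal (p y) * b y + ennreal d * ennreal (p y) \<partial>PL I)"
      by (subst nn_integral_add) (auto simp: nn_integral_cmult)
    also have "\<dots> \<le> (\<integral>\<^sup>+y. 2 * (ennreal (p y) * q y) \<partial>PL I)"
    proof (rule nn_integral_mono_AE)
      show "AE y in PL I. ennreal (p y) * b y + ennreal d * ennreal (p y) \<le> 2 * (ennreal (p y) * q y)"
        using m2 AE_space
      proof eventually_elim
        case (elim y)
        then have y: "y \<in> extensional I" by (simp add: space_PL)
        have "(\<sigma> < 1 \<and> concave_on UNIV (\<lambda>t. ln (f y t) + t\<^sup>2 / (2 * \<sigma>\<^sup>2))) \<or>
            (1 < \<sigma> \<and> convex_on UNIV (\<lambda>t. ln (f y t) + t\<^sup>2 / (2 * \<sigma>\<^sup>2)))"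
        proof -
          \<comment> \<open>Normalizing a slice adds a constant to its logarithm, which preserves
            convexity and concavity.\<close>
          have eq: "(\<lambda>t. ln (f y t) + t\<^sup>2 / (2 * \<sigma>\<^sup>2)) = (\<lambda>t. (ln (v (y(j := t))) + t\<^sup>2 / (2 * \<sigma>\<^sup>2)) + - ln (p y))"
          proof
            fix t
            have "0 < v (y(j := t))" by (rule slice_pos[OF ctx y])
            then show "ln (f y t) + t\<^sup>2 / (2 * \<sigma>\<^sup>2) = (ln (v (y(j := t))) + t\<^sup>2 / (2 * \<sigma>\<^sup>2)) + - ln (p y)"
              unfolding f_def using p0[OF y] by (subst ln_div) simp_all
          qed
          show ?thesis
            unfolding eq using es convex_on_add[OF slice_convex[OF ctx _ y], of "\<lambda>_. - ln (p y)"]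
              concave_on_add[OF slice_concave[OF ctx _ y], of "\<lambda>_. - ln (p y)"]
            by (auto simp: concave_on_const convex_on_const simp del: fun_upd_apply)
        qed
        from talagrand_deficit_1d[OF f[OF y] s this elim(1)]
        have "b y + ennreal d \<le> 2 * q y" by (simp add: b_def q_def d_def Sy)
        then have "ennreal (p y) * (b y + ennreal d) \<le> ennreal (p y) * (2 * q y)" by (rule mult_left_mono) simp
        then show ?case by (simp add: algebra_simps)
      qed
    qed
    also have "\<dots> = 2 * (\<integral>\<^sup>+y. ennreal (p y) * q y \<partial>PL I)" by (rule nn_integral_cmult) measurable
    finally show ?thesis .
  qed
  have "2 * real (card (insert j I)) * (\<sigma> - 1 - ln \<sigma>) = 2 * real (card I) * (\<sigma> - 1 - ln \<sigma>) + d"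
    using insert.hyps by (simp add: d_def algebra_simps)
  moreover have "0 \<le> 2 * real (card I) * (\<sigma> - 1 - ln \<sigma>)" using d0 by (simp add: d_def)
  ultimately have dd: "ennreal (2 * real (card (insert j I)) * (\<sigma> - 1 - ln \<sigma>)) = ennreal (2 * real (card I) * (\<sigma> - 1 - ln \<sigma>)) + ennreal d"
    using d0 by (simp add: ennreal_plus)
  have "(\<integral>\<^sup>+x. ennreal (gaussI (insert j I) x) * ennreal (sqdist (insert j I) x (T' x)) \<partial>PL (insert j I))
        + ennreal (2 * real (card (insert j I)) * (\<sigma> - 1 - ln \<sigma>))
      \<le> 2 * (\<integral>\<^sup>+x. ennreal (v x * ln (v x / gaussI (insert j I) x) - v x + gaussI (insert j I) x) \<partial>PL (insert j I))"
    unfolding cost_eq ent dd using add_mono[OF cost tal] by (simp add: algebra_simps)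
  with push' show ?case by (intro bexI[of _ T']) auto
qed

section \<open>Euclidean space\<close>

text \<open>Lebesgue measure is by construction the image of \<open>PL Basis\<close> under this map,
  so results on products carry over by reading points in coordinates.\<close>

definition emb :: "('a::euclidean_space \<Rightarrow> real) \<Rightarrow> 'a" where
  "emb f = (\<Sum>b\<in>Basis. f b *\<^sub>R b)"

lemma emb_measurable [measurable]: "emb \<in> borel_measurable (PL Basis)"
  unfolding emb_def[abs_def] by measurable

lemma emb_inner: "b \<in> Basis \<Longrightarrow> emb f \<bullet> b = f b"
  by (simp add: emb_def inner_sum_left inner_Basis if_distrib cong: if_cong)

lemma nn_integral_emb:
  assumes [measurable]: "g \<in> borel_measurable borel"
  shows "(\<integral>\<^sup>+x. g x \<partial>lborel) = (\<integral>\<^sup>+f. g (emb f) \<partial>PL Basis)"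
  by (subst lborel_eq, subst nn_integral_distr) (simp_all add: emb_def)

lemma norm_emb: "(norm (emb f))\<^sup>2 = sumsq Basis f"
  unfolding power2_norm_eq_inner euclidean_inner[of "emb f" "emb f"] sumsq_def
  by (simp add: emb_inner power2_eq_square)

lemma norm_emb_diff: "(norm (emb f - emb g))\<^sup>2 = sqdist Basis f g"
  unfolding power2_norm_eq_inner euclidean_inner[of "emb f - emb g" "emb f - emb g"] sqdist_def
  by (simp add: inner_diff_left emb_inner power2_eq_square)

lemma emb_comb: "emb (comb l f g) = (1 - l) *\<^sub>R emb f + l *\<^sub>R emb g"
  by (simp add: emb_def comb_def scaleR_add_left sum.distrib scaleR_sum_right)

section \<open>Gaussian densities in dimension n: mass and second moment\<close>

lemma gauss_density_prod:
  assumes s: "0 < \<sigma>"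
  shows "gauss_density (\<sigma>\<^sup>2) (x :: real^'n) = (\<Prod>b\<in>Basis. normal_density 0 \<sigma> (x \<bullet> b))"
proof -
  have n: "card (Basis :: (real^'n) set) = CARD('n)" by simp
  have "(2 * pi * \<sigma>\<^sup>2) powr (- real CARD('n) / 2) = ((2 * pi * \<sigma>\<^sup>2) powr (- 1 / 2)) powr (real CARD('n))"
    by (simp add: powr_powr)
  also have "\<dots> = (1 / sqrt (2 * pi * \<sigma>\<^sup>2)) powr (real CARD('n))"
  proof -
    have "(2 * pi * \<sigma>\<^sup>2) powr (- (1 / 2)) = 1 / sqrt (2 * pi * \<sigma>\<^sup>2)"
      using powr_minus_divide[of "2 * pi * \<sigma>\<^sup>2" "1/2"] powr_half_sqrt[of "2 * pi * \<sigma>\<^sup>2"] by simp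
    then show ?thesis by (simp only: minus_divide_left)
  qed
  also have "\<dots> = (1 / sqrt (2 * pi * \<sigma>\<^sup>2)) ^ CARD('n)"
    using s by (intro powr_realpow) auto
  finally have c: "(2 * pi * \<sigma>\<^sup>2) powr (- real CARD('n) / 2) = (1 / sqrt (2 * pi * \<sigma>\<^sup>2)) ^ CARD('n)" .
  have "(\<Prod>b\<in>Basis. normal_density 0 \<sigma> (x \<bullet> b)) =
     (1 / sqrt (2 * pi * \<sigma>\<^sup>2)) ^ CARD('n) * exp (\<Sum>b\<in>Basis. - (x \<bullet> b)\<^sup>2 / (2 * \<sigma>\<^sup>2))"
    unfolding normal_density_def by (simp only: diff_0_right prod.distrib exp_sum finite_Basis prod_constant n)
  also have "(\<Sum>b\<in>Basis. - (x \<bullet> b)\<^sup>2 / (2 * \<sigma>\<^sup>2)) = - (norm x)\<^sup>2 / (2 * \<sigma>\<^sup>2)"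
    unfolding power2_norm_eq_inner euclidean_inner[of x x]
    by (simp add: sum_negf sum_divide_distrib[symmetric] power2_eq_square)
  finally show ?thesis unfolding gauss_density_def c by simp
qed

lemma gauss_density_pos: "0 < \<beta> \<Longrightarrow> 0 < gauss_density \<beta> x"
  by (simp add: gauss_density_def)

lemma gauss_density_measurable [measurable]: "gauss_density \<beta> \<in> borel_measurable borel"
  unfolding gauss_density_def[abs_def] by measurable

lemma ln_gauss_density:
  "0 < \<beta> \<Longrightarrow> ln (gauss_density \<beta> (x :: real^'n)) = - real CARD('n) / 2 * ln (2 * pi * \<beta>) - (norm x)\<^sup>2 / (2 * \<beta>)"
  by (simp add: gauss_density_def ln_mult ln_powr)

lemma nn_integral_gauss_density:
  assumes s: "0 < \<sigma>"
  shows "(\<integral>\<^sup>+x. ennreal (gauss_density (\<sigma>\<^sup>2) (x :: real^'n)) \<partial>lborel) = 1"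
proof -
  have "(\<integral>\<^sup>+x. ennreal (gauss_density (\<sigma>\<^sup>2) (x :: real^'n)) \<partial>lborel)
     = (\<integral>\<^sup>+x. (\<Prod>b\<in>Basis. ennreal (normal_density 0 \<sigma> ((x :: real^'n) \<bullet> b))) \<partial>lborel)"
    by (simp add: gauss_density_prod[OF s] prod_ennreal)
  also have "\<dots> = (\<Prod>b\<in>(Basis::(real^'n) set). \<integral>\<^sup>+t. ennreal (normal_density 0 \<sigma> t) \<partial>lborel)"
    by (rule nn_integral_lborel_prod) auto
  also have "\<dots> = 1" using pos_densityD(7)[OF pos_density_normal[OF s]] by simp
  finally show ?thesis .
qed

lemma nn_integral_gauss_density_norm:
  assumes s: "0 < \<sigma>"
  shows "(\<integral>\<^sup>+x. ennreal (gauss_density (\<sigma>\<^sup>2) (x :: real^'n) * (norm x)\<^sup>2) \<partial>lborel) = ennreal (real CARD('n) * \<sigma>\<^sup>2)"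
proof -
  have N: "(\<integral>\<^sup>+t. ennreal (normal_density 0 \<sigma> t) \<partial>lborel) = 1"
    by (rule pos_densityD(7)[OF pos_density_normal[OF s]])
  have M: "(\<integral>\<^sup>+t. ennreal (normal_density 0 \<sigma> t * t\<^sup>2) \<partial>lborel) = ennreal (\<sigma>\<^sup>2)"
  proof -
    have "has_bochner_integral lborel (\<lambda>t. normal_density 0 \<sigma> t * t\<^sup>2) (\<sigma>\<^sup>2)"
      using normal_moment_even[OF s, of 0 1] by simp
    then show ?thesis
      by (subst nn_integral_eq_integral) (auto simp: has_bochner_integral_iff)
  qed
  have one: "(\<integral>\<^sup>+x. ennreal (gauss_density (\<sigma>\<^sup>2) (x :: real^'n) * (x \<bullet> c)\<^sup>2) \<partial>lborel) = ennreal (\<sigma>\<^sup>2)"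
    if c: "c \<in> Basis" for c
  proof -
    \<comment> \<open>The square is placed in the single factor c, so that the integral is again a
      product of one-dimensional ones.\<close>
    let ?f = "\<lambda>b t. normal_density 0 \<sigma> t * (if b = c then t\<^sup>2 else 1)"
    have "gauss_density (\<sigma>\<^sup>2) x * (x \<bullet> c)\<^sup>2 = (\<Prod>b\<in>Basis. ?f b (x \<bullet> b))" for x :: "real^'n"
      using c by (simp add: gauss_density_prod[OF s] prod.distrib prod.delta)
    then have "(\<integral>\<^sup>+x. ennreal (gauss_density (\<sigma>\<^sup>2) (x :: real^'n) * (x \<bullet> c)\<^sup>2) \<partial>lborel)
       = (\<integral>\<^sup>+x. (\<Prod>b\<in>Basis. ennreal (?f b ((x :: real^'n) \<bullet> b))) \<partial>lborel)"
      by (simp add: prod_ennreal)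
    also have "\<dots> = (\<Prod>b\<in>(Basis::(real^'n) set). \<integral>\<^sup>+t. ennreal (?f b t) \<partial>lborel)"
      by (rule nn_integral_lborel_prod) auto
    also have "\<dots> = (\<Prod>b\<in>(Basis::(real^'n) set). if b = c then ennreal (\<sigma>\<^sup>2) else 1)"
      by (intro prod.cong) (auto simp: N M)
    also have "\<dots> = ennreal (\<sigma>\<^sup>2)" using c by simp
    finally show ?thesis .
  qed
  have nn: "0 \<le> gauss_density (\<sigma>\<^sup>2) x * (x \<bullet> b)\<^sup>2" for x b :: "real^'n"
    using gauss_density_pos[of "\<sigma>\<^sup>2" x] s by simp
  have "(norm x)\<^sup>2 = (\<Sum>b\<in>Basis. (x \<bullet> b)\<^sup>2)" for x :: "real^'n"
    unfolding power2_norm_eq_inner euclidean_inner[of x x] by (simp add: power2_eq_square)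
  then have "(\<integral>\<^sup>+x. ennreal (gauss_density (\<sigma>\<^sup>2) (x :: real^'n) * (norm x)\<^sup>2) \<partial>lborel)
    = (\<integral>\<^sup>+x. (\<Sum>b\<in>Basis. ennreal (gauss_density (\<sigma>\<^sup>2) (x :: real^'n) * (x \<bullet> b)\<^sup>2)) \<partial>lborel)"
    using nn by (intro nn_integral_cong) (simp add: sum_distrib_left sum_ennreal)
  also have "\<dots> = (\<Sum>b\<in>(Basis::(real^'n) set). ennreal (\<sigma>\<^sup>2))"
    by (subst nn_integral_sum) (auto simp: one)
  also have "\<dots> = ennreal (real CARD('n) * \<sigma>\<^sup>2)"
    by (simp add: ennreal_mult ennreal_of_nat_eq_real_of_nat)
  finally show ?thesis .
qed

definition semi_log_cvx_on_space :: "real \<Rightarrow> real \<Rightarrow> ('a::euclidean_space \<Rightarrow> real) \<Rightarrow> bool" where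
  "semi_log_cvx_on_space \<epsilon> \<sigma> v \<longleftrightarrow> convex_on UNIV (\<lambda>x. \<epsilon> * (ln (v x) + (norm x)\<^sup>2 / (2 * \<sigma>\<^sup>2)))"

lemma semi_log_density_emb:
  assumes v: "v \<in> borel_measurable borel" "\<And>x. 0 < v x" "(\<integral>\<^sup>+x. ennreal (v x) \<partial>lborel) = 1"
    "(\<integral>\<^sup>+x. ennreal (v x * (norm x)\<^sup>2) \<partial>lborel) < \<infinity>" "semi_log_cvx_on_space \<epsilon> \<sigma> v"
  shows "semi_log_density \<epsilon> \<sigma> Basis (\<lambda>f. v (emb f))"
  unfolding semi_log_density_def
proof (intro conjI ballI)
  note [measurable] = v(1)
  show "(\<lambda>f. v (emb f)) \<in> borel_measurable (PL Basis)" by measurable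
  show "0 < v (emb f)" for f using v(2) .
  show "(\<integral>\<^sup>+f. ennreal (v (emb f)) \<partial>PL Basis) = 1"
    using v(3) by (subst (asm) nn_integral_emb) auto
  show "(\<integral>\<^sup>+f. ennreal (v (emb f) * sumsq Basis f) \<partial>PL Basis) < \<infinity>"
    using v(4) by (subst (asm) nn_integral_emb) (auto simp: norm_emb)
  show "semi_log_cvx \<epsilon> \<sigma> Basis (\<lambda>f. v (emb f))"
    unfolding semi_log_cvx_def
  proof (intro ballI allI impI)
    fix f g :: "'a \<Rightarrow> real" and l :: real assume "0 \<le> l" "l \<le> 1"
    then show "\<epsilon> * (ln (v (emb (comb l f g))) + sumsq Basis (comb l f g) / (2 * \<sigma>\<^sup>2))
       \<le> (1 - l) * (\<epsilon> * (ln (v (emb f)) + sumsq Basis f / (2 * \<sigma>\<^sup>2)))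
         + l * (\<epsilon> * (ln (v (emb g)) + sumsq Basis g / (2 * \<sigma>\<^sup>2)))"
      using convex_onD[OF v(5)[unfolded semi_log_cvx_on_space_def], of l "emb f" "emb g"]
      by (simp add: norm_emb[symmetric] emb_comb)
  qed
qed

text \<open>The joint law of x and its image under the transport map, with x distributed as
  \<gamma>, is a coupling, and the infimum is at most its cost. No optimality of the map
  enters.\<close>

lemma transport_coupling:
  fixes v :: "real^'n \<Rightarrow> real"
  assumes s: "0 < \<sigma>" and es: "(\<epsilon> = 1 \<and> 1 < \<sigma>) \<or> (\<epsilon> = - 1 \<and> \<sigma> < 1)"
    and v: "v \<in> borel_measurable borel" "\<And>x. 0 < v x" "(\<integral>\<^sup>+x. ennreal (v x) \<partial>lborel) = 1"
    "(\<integral>\<^sup>+x. ennreal (v x * (norm x)\<^sup>2) \<partial>lborel) < \<infinity>" "semi_log_cvx_on_space \<epsilon> \<sigma> v"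
  shows "(INF \<pi>\<in>couplings (density_measure (gauss_density 1)) (density_measure v).
        \<integral>\<^sup>+ p. ennreal ((norm (fst p - snd p))\<^sup>2) \<partial>\<pi>) + ennreal (2 * real CARD('n) * (\<sigma> - 1 - ln \<sigma>))
    \<le> 2 * (\<integral>\<^sup>+x. ennreal (v x * ln (v x / gauss_density 1 x) - v x + gauss_density 1 x) \<partial>lborel)"
proof -
  let ?g = "gauss_density 1 :: real^'n \<Rightarrow> real"
  let ?B = "Basis :: (real^'n) set"
  note [measurable] = v(1)
  have g: "?g (emb f) = gaussI ?B f" for f
    using gauss_density_prod[of 1 "emb f"] by (simp add: gaussI_def emb_inner)
  from transport_exists[OF _ s es semi_log_density_emb[OF v]]
  obtain T where T [measurable]: "T \<in> measurable (PL ?B) (PL ?B)"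
    and push: "\<And>\<phi>. \<phi> \<in> borel_measurable (PL ?B) \<Longrightarrow>
      (\<integral>\<^sup>+f. ennreal (v (emb f)) * \<phi> f \<partial>PL ?B) = (\<integral>\<^sup>+f. ennreal (gaussI ?B f) * \<phi> (T f) \<partial>PL ?B)"
    and cost: "(\<integral>\<^sup>+f. ennreal (gaussI ?B f) * ennreal (sqdist ?B f (T f)) \<partial>PL ?B) + ennreal (2 * real (card ?B) * (\<sigma> - 1 - ln \<sigma>))
      \<le> 2 * (\<integral>\<^sup>+f. ennreal (v (emb f) * ln (v (emb f) / gaussI ?B f) - v (emb f) + gaussI ?B f) \<partial>PL ?B)"
    by auto
  define N where "N = density (PL ?B) (\<lambda>f. ennreal (gaussI ?B f))"
  have [simp]: "sets N = sets (PL ?B)" "measurable N M = measurable (PL ?B) M" for M :: "'z measure"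
    by (auto simp: N_def cong: measurable_cong_sets)
  define \<pi> where "\<pi> = distr N (borel \<Otimes>\<^sub>M borel) (\<lambda>f. (emb f, emb (T f)))"
  have "\<pi> \<in> couplings (density_measure ?g) (density_measure v)"
    unfolding couplings_def
  proof (intro CollectI conjI)
    show "sets \<pi> = sets (density_measure ?g \<Otimes>\<^sub>M density_measure v)"
      by (auto simp: \<pi>_def density_measure_def intro!: sets_pair_measure_cong)
    show "distr \<pi> (density_measure ?g) fst = density_measure ?g"
    proof (rule measure_eqI)
      fix A assume "A \<in> sets (distr \<pi> (density_measure ?g) fst)"
      then have A [measurable]: "A \<in> sets borel" by (simp add: density_measure_def)
      have "distr \<pi> (density_measure ?g) fst = distr \<pi> borel fst"
        by (rule distr_cong) (auto simp: density_measure_def)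
      also have "\<dots> = distr N borel emb"
        unfolding \<pi>_def by (subst distr_distr) (auto simp: comp_def)
      also have "emeasure \<dots> A = (\<integral>\<^sup>+f. indicator A (emb f) \<partial>N)"
        by (subst nn_integral_indicator[symmetric], simp, subst nn_integral_distr) auto
      also have "\<dots> = (\<integral>\<^sup>+f. ennreal (?g (emb f)) * indicator A (emb f) \<partial>PL ?B)"
        unfolding N_def g by (subst nn_integral_density) auto
      also have "\<dots> = (\<integral>\<^sup>+x. ennreal (?g x) * indicator A x \<partial>lborel)"
        by (rule nn_integral_emb[symmetric]) measurable
      also have "\<dots> = emeasure (density_measure ?g) A"
        unfolding density_measure_def by (subst emeasure_density) auto
      finally show "emeasure (distr \<pi> (density_measure ?g) fst) A = emeasure (density_measure ?g) A" .
    qed simp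
    show "distr \<pi> (density_measure v) snd = density_measure v"
    proof (rule measure_eqI)
      fix A assume "A \<in> sets (distr \<pi> (density_measure v) snd)"
      then have A [measurable]: "A \<in> sets borel" by (simp add: density_measure_def)
      have "distr \<pi> (density_measure v) snd = distr \<pi> borel snd"
        by (rule distr_cong) (auto simp: density_measure_def)
      also have "\<dots> = distr N borel (\<lambda>f. emb (T f))"
        unfolding \<pi>_def by (subst distr_distr) (auto simp: comp_def)
      also have "emeasure \<dots> A = (\<integral>\<^sup>+f. indicator A (emb (T f)) \<partial>N)"
        by (subst nn_integral_indicator[symmetric], simp, subst nn_integral_distr) auto
      also have "\<dots> = (\<integral>\<^sup>+f. ennreal (gaussI ?B f) * indicator A (emb (T f)) \<partial>PL ?B)"
        unfolding N_def by (subst nn_integral_density) auto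
      also have "\<dots> = (\<integral>\<^sup>+f. ennreal (v (emb f)) * indicator A (emb f) \<partial>PL ?B)"
        by (rule push[symmetric]) measurable
      also have "\<dots> = (\<integral>\<^sup>+x. ennreal (v x) * indicator A x \<partial>lborel)"
        by (rule nn_integral_emb[symmetric]) measurable
      also have "\<dots> = emeasure (density_measure v) A"
        unfolding density_measure_def by (subst emeasure_density) auto
      finally show "emeasure (distr \<pi> (density_measure v) snd) A = emeasure (density_measure v) A" .
    qed simp
  qed
  then have "(INF \<pi>\<in>couplings (density_measure ?g) (density_measure v). \<integral>\<^sup>+ p. ennreal ((norm (fst p - snd p))\<^sup>2) \<partial>\<pi>)
     \<le> (\<integral>\<^sup>+ p. ennreal ((norm (fst p - snd p))\<^sup>2) \<partial>\<pi>)" by (rule INF_lower)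
  also have "\<dots> = (\<integral>\<^sup>+f. ennreal (sqdist ?B f (T f)) \<partial>N)"
    unfolding \<pi>_def by (subst nn_integral_distr) (auto simp: norm_emb_diff)
  also have "\<dots> = (\<integral>\<^sup>+f. ennreal (gaussI ?B f) * ennreal (sqdist ?B f (T f)) \<partial>PL ?B)"
    unfolding N_def by (subst nn_integral_density) auto
  finally have "(INF \<pi>\<in>couplings (density_measure ?g) (density_measure v). \<integral>\<^sup>+ p. ennreal ((norm (fst p - snd p))\<^sup>2) \<partial>\<pi>)
      + ennreal (2 * real CARD('n) * (\<sigma> - 1 - ln \<sigma>))
    \<le> 2 * (\<integral>\<^sup>+f. ennreal (v (emb f) * ln (v (emb f) / gaussI ?B f) - v (emb f) + gaussI ?B f) \<partial>PL ?B)"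
    using cost by (auto elim!: order_trans[rotated] intro!: add_right_mono)
  also have "(\<integral>\<^sup>+f. ennreal (v (emb f) * ln (v (emb f) / gaussI ?B f) - v (emb f) + gaussI ?B f) \<partial>PL ?B)
    = (\<integral>\<^sup>+x. ennreal (v x * ln (v x / ?g x) - v x + ?g x) \<partial>lborel)"
    by (subst nn_integral_emb) (auto simp: g)
  finally show ?thesis .
qed

section \<open>Pointwise bounds on the density and finiteness of its entropy\<close>

lemma nn_integral_reflect:
  fixes g :: "'a::euclidean_space \<Rightarrow> ennreal"
  assumes [measurable]: "g \<in> borel_measurable borel" and s: "s = 1 \<or> s = - 1"
  shows "(\<integral>\<^sup>+h. g (x + s *\<^sub>R h) \<partial>lborel) = (\<integral>\<^sup>+h. g h \<partial>lborel)"
proof -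
  have "s \<noteq> 0" "\<bar>s\<bar> = 1" using s by auto
  from lborel_affine[OF this(1), of x] this(2)
  have "(lborel :: 'a measure) = distr lborel borel (\<lambda>h. x + s *\<^sub>R h)"
    by (simp add: density_1 one_ennreal_def[symmetric])
  then have "(\<integral>\<^sup>+h. g h \<partial>lborel) = (\<integral>\<^sup>+h. g h \<partial>distr lborel borel (\<lambda>h. x + s *\<^sub>R h))" by simp
  also have "\<dots> = (\<integral>\<^sup>+h. g (x + s *\<^sub>R h) \<partial>lborel)" by (subst nn_integral_distr) auto
  finally show ?thesis ..
qed

text \<open>The point x is the midpoint of x + h and x - h. Convexity and the parallelogram law give
  v(x) exp(-|h|^2 / (2 \<sigma>^2)) \<le> sqrt(v(x + h) v(x - h)), which is at most the average of
  the two values. Integrating in h yields the maximum of the Gaussian density of variance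
  \<open>\<sigma>\<^sup>2\<close>.\<close>

lemma semi_log_convex_bound:
  fixes v :: "real^'n \<Rightarrow> real"
  assumes s: "0 < \<sigma>" and v [measurable]: "v \<in> borel_measurable borel" and v0: "\<And>x. 0 < v x"
    and v1: "(\<integral>\<^sup>+x. ennreal (v x) \<partial>lborel) = 1" and cv: "semi_log_cvx_on_space 1 \<sigma> v"
  shows "v x \<le> (2 * pi * \<sigma>\<^sup>2) powr (- real CARD('n) / 2)"
proof -
  define c where "c = (2 * pi * \<sigma>\<^sup>2) powr (- real CARD('n) / 2)"
  have c0: "0 < c" using s by (simp add: c_def)
  have pt: "v x * gauss_density (\<sigma>\<^sup>2) h \<le> c * (1/2 * v (x + 1 *\<^sub>R h) + 1/2 * v (x + (-1) *\<^sub>R h))" for h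
  proof -
    let ?a = "v (x + h)" and ?b = "v (x - h)"
    have mid: "(1 - 1/2) *\<^sub>R (x + h) + (1/2) *\<^sub>R (x - h) = x"
      by (simp add: algebra_simps flip: scaleR_add_left)
    have par: "(norm (x + h))\<^sup>2 + (norm (x - h))\<^sup>2 = 2 * (norm x)\<^sup>2 + 2 * (norm h)\<^sup>2"
      unfolding power2_norm_eq_inner by (simp add: inner_add_left inner_add_right inner_diff_left inner_diff_right)
    have "ln (v x) + (norm x)\<^sup>2 / (2 * \<sigma>\<^sup>2)
       \<le> (1 - 1/2) * (ln ?a + (norm (x + h))\<^sup>2 / (2 * \<sigma>\<^sup>2)) + 1/2 * (ln ?b + (norm (x - h))\<^sup>2 / (2 * \<sigma>\<^sup>2))"
      using convex_onD[OF cv[unfolded semi_log_cvx_on_space_def], of "1/2" "x + h" "x - h"] unfolding mid by simp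
    also have "\<dots> = 1/2 * ln ?a + 1/2 * ln ?b + ((norm (x + h))\<^sup>2 + (norm (x - h))\<^sup>2) / (4 * \<sigma>\<^sup>2)"
      using s by (simp add: field_simps)
    also have "((norm (x + h))\<^sup>2 + (norm (x - h))\<^sup>2) / (4 * \<sigma>\<^sup>2) = (norm x)\<^sup>2 / (2 * \<sigma>\<^sup>2) + (norm h)\<^sup>2 / (2 * \<sigma>\<^sup>2)"
      unfolding par using s by (simp add: field_simps)
    finally have "ln (v x) - (norm h)\<^sup>2 / (2 * \<sigma>\<^sup>2) \<le> 1/2 * ln ?a + 1/2 * ln ?b" by linarith
    then have "exp (ln (v x) - (norm h)\<^sup>2 / (2 * \<sigma>\<^sup>2)) \<le> exp (1/2 * ln ?a + 1/2 * ln ?b)" by simp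
    also have "\<dots> = ?a powr (1/2) * ?b powr (1/2)" using v0[of "x + h"] v0[of "x - h"] by (simp add: powr_def exp_add)
    also have "\<dots> \<le> 1/2 * ?a + 1/2 * ?b" by (rule Youngs_inequality_0) (use v0 in auto)
    finally have "c * exp (ln (v x) - (norm h)\<^sup>2 / (2 * \<sigma>\<^sup>2)) \<le> c * (1/2 * ?a + 1/2 * ?b)"
      using c0 by (intro mult_left_mono) auto
    moreover have "c * exp (ln (v x) - (norm h)\<^sup>2 / (2 * \<sigma>\<^sup>2)) = v x * gauss_density (\<sigma>\<^sup>2) h"
      using v0[of x] by (simp add: gauss_density_def c_def exp_diff exp_minus field_simps)
    ultimately show ?thesis by simp
  qed
  \<comment> \<open>Each map from h to x + h or x - h preserves Lebesgue measure, so both terms on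
    the right integrate to c / 2.\<close>
  have "ennreal (v x) = (\<integral>\<^sup>+h. ennreal (v x) * ennreal (gauss_density (\<sigma>\<^sup>2) (h :: real^'n)) \<partial>lborel)"
    using nn_integral_gauss_density[OF s, where 'n='n] by (subst nn_integral_cmult) auto
  also have "\<dots> \<le> (\<integral>\<^sup>+h. ennreal (c/2) * ennreal (v (x + 1 *\<^sub>R h)) + ennreal (c/2) * ennreal (v (x + (-1) *\<^sub>R h)) \<partial>lborel)"
  proof (rule nn_integral_mono)
    fix h :: "real^'n"
    have "ennreal (v x) * ennreal (gauss_density (\<sigma>\<^sup>2) h) = ennreal (v x * gauss_density (\<sigma>\<^sup>2) h)"
      using v0[of x] by (intro ennreal_mult'[symmetric]) (simp add: less_imp_le)
    also have "\<dots> \<le> ennreal (c/2 * v (x + 1 *\<^sub>R h) + c/2 * v (x + (-1) *\<^sub>R h))"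
      using pt[of h] by (intro ennreal_leI) (simp add: algebra_simps)
    also have "\<dots> = ennreal (c/2) * ennreal (v (x + 1 *\<^sub>R h)) + ennreal (c/2) * ennreal (v (x + (-1) *\<^sub>R h))"
      using c0 v0[THEN less_imp_le]
      by (subst ennreal_plus) (simp_all add: ennreal_mult del: scaleR_one scaleR_minus1_left times_divide_eq_left)
    finally show "ennreal (v x) * ennreal (gauss_density (\<sigma>\<^sup>2) h)
       \<le> ennreal (c/2) * ennreal (v (x + 1 *\<^sub>R h)) + ennreal (c/2) * ennreal (v (x + (-1) *\<^sub>R h))" .
  qed
  also have "\<dots> = ennreal (c/2) + ennreal (c/2)"
  proof -
    have r: "(\<integral>\<^sup>+h. ennreal (v (x + s *\<^sub>R h)) \<partial>lborel) = 1" if "s = 1 \<or> s = - 1" for s :: real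
      using nn_integral_reflect[of "\<lambda>h. ennreal (v h)" s x] that v1 by simp
    show ?thesis
      using r[of 1] r[of "- 1"] by (subst nn_integral_add) (simp_all add: nn_integral_cmult)
  qed
  also have "\<dots> = ennreal c" using c0 by (simp add: ennreal_plus[symmetric] del: ennreal_plus)
  finally show ?thesis using c0 by (simp add: c_def)
qed

text \<open>The convex function \<psi> decreases at most linearly, so the quadratic term dominates
  it in ln v.\<close>

lemma semi_log_concave_bound:
  fixes v :: "'a::euclidean_space \<Rightarrow> real"
  assumes s: "0 < \<sigma>" and v0: "\<And>x. 0 < v x" and cv: "semi_log_cvx_on_space (- 1) \<sigma> v"
  shows "\<exists>C. \<forall>x. v x \<le> C"
proof -
  define \<psi> where "\<psi> x = - (ln (v x) + (norm x)\<^sup>2 / (2 * \<sigma>\<^sup>2))" for x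
  have cv': "convex_on UNIV \<psi>" using cv by (simp add: semi_log_cvx_on_space_def \<psi>_def[abs_def])
  have "continuous_on (cball 0 1) \<psi>"
    by (rule continuous_on_subset[OF convex_on_continuous[OF open_UNIV cv']]) simp
  then have "\<exists>x\<in>cball 0 1. \<forall>y\<in>cball 0 1. \<psi> x \<le> \<psi> y"
    by (intro continuous_attains_inf) auto
  then obtain x0 where x0: "\<And>u. u \<in> cball 0 1 \<Longrightarrow> \<psi> x0 \<le> \<psi> u" by blast
  define m where "m = \<psi> x0"
  \<comment> \<open>Chosen to dominate - m, - \<psi> 0 and \<psi> 0 - m, the three quantities
    occurring in the two cases below.\<close>
  define b where "b = \<bar>\<psi> 0\<bar> + \<bar>m\<bar>"
  have low: "- b - b * norm x \<le> \<psi> x" for x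
  proof (cases "norm x \<le> 1")
    case True
    then have "m \<le> \<psi> x" using x0[of x] by (simp add: m_def)
    moreover have "0 \<le> b * norm x" "- b \<le> m" by (auto simp: b_def)
    ultimately show ?thesis by linarith
  next
    case False
    define r where "r = norm x"
    have r: "1 < r" using False by (simp add: r_def)
    have "m \<le> \<psi> ((1 / r) *\<^sub>R x)" using x0[of "(1 / r) *\<^sub>R x"] r by (simp add: m_def r_def)
    \<comment> \<open>Convexity along the segment from 0 to x, evaluated where it crosses the unit
      sphere, transports the lower bound m from the unit ball out to x.\<close>
    also have "\<psi> ((1 / r) *\<^sub>R x) \<le> (1 - 1/r) * \<psi> 0 + 1/r * \<psi> x"
      using convex_onD[OF cv', of "1/r" 0 x] r by simp
    finally have "r * m \<le> r * ((1 - 1/r) * \<psi> 0 + 1/r * \<psi> x)" using r by (intro mult_left_mono) auto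
    also have "\<dots> = (r - 1) * \<psi> 0 + \<psi> x" using r by (simp add: field_simps)
    finally have "r * m - r * \<psi> 0 + \<psi> 0 \<le> \<psi> x" by (simp add: algebra_simps)
    moreover have "- (r * b) \<le> r * m - r * \<psi> 0"
    proof -
      have "r * (\<psi> 0 - m) \<le> r * b" using r by (intro mult_left_mono) (auto simp: b_def)
      then show ?thesis by (simp add: algebra_simps)
    qed
    moreover have "- b \<le> \<psi> 0" by (simp add: b_def)
    ultimately show ?thesis by (simp add: r_def algebra_simps)
  qed
  have "v x \<le> exp (b + b\<^sup>2 * \<sigma>\<^sup>2 / 2)" for x
  proof -
    have "ln (v x) \<le> b + b * norm x - (norm x)\<^sup>2 / (2 * \<sigma>\<^sup>2)" using low[of x] by (simp add: \<psi>_def)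
    \<comment> \<open>Completing the square in \<open>norm x\<close>.\<close>
    also have "\<dots> = b + b\<^sup>2 * \<sigma>\<^sup>2 / 2 - (norm x - b * \<sigma>\<^sup>2)\<^sup>2 / (2 * \<sigma>\<^sup>2)"
      using s by (simp add: field_simps power2_eq_square)
    also have "\<dots> \<le> b + b\<^sup>2 * \<sigma>\<^sup>2 / 2" by simp
    finally show ?thesis using v0[of x] by (metis exp_le_cancel_iff exp_ln)
  qed
  then show ?thesis by blast
qed

text \<open>\<open>Ent\<close> is built from Bochner integrals, so real integrability has to be
  shown: above by ln v \<le> ln C and the second moment, below by Gibbs' inequality.\<close>

lemma entropy_integrable:
  fixes v :: "real^'n \<Rightarrow> real"
  assumes v [measurable]: "v \<in> borel_measurable borel" and v0: "\<And>x. 0 < v x" and C: "\<And>x. v x \<le> C"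
    and i: "integrable lborel v" and m: "integrable lborel (\<lambda>x. v x * (norm x)\<^sup>2)"
  shows "integrable lborel (\<lambda>x. v x * ln (v x / gauss_density 1 x))"
proof -
  let ?g = "gauss_density 1 :: real^'n \<Rightarrow> real"
  have g0: "0 < ?g x" for x by (rule gauss_density_pos) simp
  have ig: "integrable lborel ?g"
    using nn_integral_gauss_density[of 1, where 'n='n] g0 by (intro integrableI_nonneg) (auto simp: less_imp_le)
  define k where "k = \<bar>ln C\<bar> + \<bar>real CARD('n) / 2 * ln (2 * pi)\<bar>"
  define h where "h x = v x * ln (v x / ?g x)" for x
  have up: "h x \<le> k * v x + v x * (norm x)\<^sup>2" for x
  proof -
    have "ln (v x / ?g x) = ln (v x) - ln (?g x)" using v0[of x] g0[of x] by (simp add: ln_div)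
    also have "\<dots> = ln (v x) + real CARD('n) / 2 * ln (2 * pi) + (norm x)\<^sup>2 / 2" by (simp add: ln_gauss_density)
    also have "ln (v x) \<le> ln C" using v0[of x] C[of x] by simp
    also have "ln C + real CARD('n) / 2 * ln (2 * pi) + (norm x)\<^sup>2 / 2 \<le> k + (norm x)\<^sup>2"
      unfolding k_def by (intro add_mono) auto
    finally have "h x \<le> v x * (k + (norm x)\<^sup>2)"
      unfolding h_def using v0[of x] by (intro mult_left_mono) auto
    then show ?thesis by (simp add: algebra_simps)
  qed
  have lo: "- v x - ?g x \<le> h x" for x
    using gibbs_nonneg[OF v0[of x] g0[of x]] v0[of x] by (simp add: h_def)
  have "integrable lborel h"
  proof (rule Bochner_Integration.integrable_bound[where f="\<lambda>x. (k * v x + v x * (norm x)\<^sup>2) + (v x + ?g x)"])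
    show "integrable lborel (\<lambda>x. (k * v x + v x * (norm x)\<^sup>2) + (v x + ?g x))"
      using i m ig by auto
    show "h \<in> borel_measurable lborel" unfolding h_def by measurable
    have "\<bar>h x\<bar> \<le> (k * v x + v x * (norm x)\<^sup>2) + (v x + ?g x)" for x
    proof -
      have "0 \<le> k * v x + v x * (norm x)\<^sup>2" "0 \<le> v x + ?g x"
        using v0[of x] g0[of x] by (auto simp: k_def less_imp_le)
      then show ?thesis using up[of x] lo[of x] by linarith
    qed
    then show "AE x in lborel. norm (h x) \<le> norm ((k * v x + v x * (norm x)\<^sup>2) + (v x + ?g x))"
      by (intro AE_I2) (metis abs_ge_self order_trans real_norm_def)
  qed
  then show ?thesis by (simp add: h_def[abs_def])
qed

text \<open>The second term of \<open>Ent\<close> is 1 ln 1 = 0, and the density of \<gamma> cancels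
  the denominator outside the logarithm.\<close>

lemma Ent_gauss:
  fixes v :: "real^'n \<Rightarrow> real"
  assumes v [measurable]: "v \<in> borel_measurable borel" and i: "(\<integral>x. v x \<partial>lborel) = 1"
  shows "Ent (density_measure (gauss_density 1)) (\<lambda>x. v x / gauss_density 1 x)
    = (\<integral>x. v x * ln (v x / gauss_density 1 x) \<partial>lborel)"
proof -
  have g0: "0 < gauss_density 1 x" for x :: "real^'n" by (rule gauss_density_pos) simp
  have "(\<integral>x. f x \<partial>density_measure (gauss_density 1)) = (\<integral>x. gauss_density 1 x * f x \<partial>lborel)"
    if [measurable]: "f \<in> borel_measurable borel" for f :: "real^'n \<Rightarrow> real"
    unfolding density_measure_def using g0 by (subst integral_density) (auto simp: less_imp_le)
  then show ?thesis unfolding Ent_def using g0[THEN less_imp_neq] i by (simp add: less_imp_neq[symmetric])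
qed

text \<open>Finiteness of the infimum is recorded separately: \<open>enn2real\<close> sends infinity
  to 0, so a lower bound on \<open>W2\<close>, as is required for \<gamma>_\<beta>, depends on
  it.\<close>

lemma W2_le_Ent:
  fixes v :: "real^'n \<Rightarrow> real"
  assumes s: "0 < \<sigma>" and es: "(\<epsilon> = 1 \<and> 1 < \<sigma>) \<or> (\<epsilon> = - 1 \<and> \<sigma> < 1)"
    and v [measurable]: "v \<in> borel_measurable borel" and v0: "\<And>x. 0 < v x"
    and i: "integrable lborel v" "(\<integral>x. v x \<partial>lborel) = 1"
    and m: "integrable lborel (\<lambda>x. v x * (norm x)\<^sup>2)" and cv: "semi_log_cvx_on_space \<epsilon> \<sigma> v"
  defines "I \<equiv> INF \<pi>\<in>couplings (density_measure (gauss_density 1)) (density_measure v).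
        \<integral>\<^sup>+ p. ennreal ((norm (fst p - snd p))\<^sup>2) \<partial>\<pi>"
  shows "I < \<infinity>"
    "(W2 (density_measure (gauss_density 1)) (density_measure v))\<^sup>2 + 2 * real CARD('n) * (\<sigma> - 1 - ln \<sigma>)
       \<le> 2 * Ent (density_measure (gauss_density 1)) (\<lambda>x. v x / gauss_density 1 x)"
proof -
  let ?g = "gauss_density 1 :: real^'n \<Rightarrow> real"
  have g0: "0 < ?g x" for x by (rule gauss_density_pos) simp
  have ig: "integrable lborel ?g"
    using nn_integral_gauss_density[of 1, where 'n='n] g0 by (intro integrableI_nonneg) (auto simp: less_imp_le)
  have ig1: "(\<integral>x. ?g x \<partial>lborel) = 1"
    using nn_integral_gauss_density[of 1, where 'n='n] g0 by (subst integral_eq_nn_integral) (auto simp: less_imp_le)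
  have v1: "(\<integral>\<^sup>+x. ennreal (v x) \<partial>lborel) = 1"
    using i v0 by (subst nn_integral_eq_integral) (auto simp: less_imp_le)
  have m': "(\<integral>\<^sup>+x. ennreal (v x * (norm x)\<^sup>2) \<partial>lborel) < \<infinity>"
    using v0 by (subst nn_integral_eq_integral[OF m]) (auto simp: less_imp_le)
  have "\<exists>C. \<forall>x. v x \<le> C"
  proof (cases "\<epsilon> = 1")
    case True
    then show ?thesis using semi_log_convex_bound[OF s v v0 v1] cv by blast
  next
    case False
    then have "semi_log_cvx_on_space (- 1) \<sigma> v" using es cv by auto
    then show ?thesis by (rule semi_log_concave_bound[OF s v0])
  qed
  then obtain C where C: "\<And>x. v x \<le> C" by blast
  let ?h = "\<lambda>x. v x * ln (v x / ?g x)"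
  have ih: "integrable lborel ?h" by (rule entropy_integrable[OF v v0 C i(1) m])
  have "(\<integral>\<^sup>+x. ennreal (?h x - v x + ?g x) \<partial>lborel) = ennreal (\<integral>x. ?h x - v x + ?g x \<partial>lborel)"
    using gibbs_nonneg[OF v0 g0] ih i ig by (intro nn_integral_eq_integral) auto
  also have "(\<integral>x. ?h x - v x + ?g x \<partial>lborel) = (\<integral>x. ?h x \<partial>lborel)"
    using ih i ig ig1 by simp
  also have "\<dots> = Ent (density_measure ?g) (\<lambda>x. v x / ?g x)" by (rule Ent_gauss[OF v i(2), symmetric])
  finally have E: "(\<integral>\<^sup>+x. ennreal (?h x - v x + ?g x) \<partial>lborel) = ennreal (Ent (density_measure ?g) (\<lambda>x. v x / ?g x))" .
  have E0: "0 \<le> Ent (density_measure ?g) (\<lambda>x. v x / ?g x)"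
  proof -
    have "0 \<le> (\<integral>x. ?h x - v x + ?g x \<partial>lborel)"
      using gibbs_nonneg[OF v0 g0] by (intro Bochner_Integration.integral_nonneg) auto
    also have "\<dots> = (\<integral>x. ?h x \<partial>lborel)" using ih i ig ig1 by simp
    also have "\<dots> = Ent (density_measure ?g) (\<lambda>x. v x / ?g x)" by (rule Ent_gauss[OF v i(2), symmetric])
    finally show ?thesis .
  qed
  have d0: "0 \<le> 2 * real CARD('n) * (\<sigma> - 1 - ln \<sigma>)" using ln_le_minus_one[OF s] by simp
  have le: "I + ennreal (2 * real CARD('n) * (\<sigma> - 1 - ln \<sigma>)) \<le> ennreal (2 * Ent (density_measure ?g) (\<lambda>x. v x / ?g x))"
    using transport_coupling[OF s es v v0 v1 m' cv] unfolding E I_def[symmetric] by (simp add: ennreal_mult')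
  then have "I \<le> ennreal (2 * Ent (density_measure ?g) (\<lambda>x. v x / ?g x))"
    by (metis add_increasing2 le_iff_add order_trans zero_le)
  then show "I < \<infinity>" by (rule order_le_less_trans) simp
  then obtain r where r: "I = ennreal r" "0 \<le> r" by (cases I) auto
  have "(W2 (density_measure ?g) (density_measure v))\<^sup>2 = r"
    using r by (simp add: W2_def I_def)
  moreover have "r + 2 * real CARD('n) * (\<sigma> - 1 - ln \<sigma>) \<le> 2 * Ent (density_measure ?g) (\<lambda>x. v x / ?g x)"
  proof -
    have "ennreal (r + 2 * real CARD('n) * (\<sigma> - 1 - ln \<sigma>)) \<le> ennreal (2 * Ent (density_measure ?g) (\<lambda>x. v x / ?g x))"
      using le unfolding r(1) ennreal_plus[OF r(2) d0] .
    then show ?thesis using E0 by (subst (asm) ennreal_le_iff) simp_all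
  qed
  ultimately show "(W2 (density_measure ?g) (density_measure v))\<^sup>2 + 2 * real CARD('n) * (\<sigma> - 1 - ln \<sigma>)
     \<le> 2 * Ent (density_measure ?g) (\<lambda>x. v x / ?g x)" by simp
qed

section \<open>Hessians and the theorem\<close>

text \<open>A duality bound valid for every coupling: 2 x.y \<le> \<sigma> |x|^2 + |y|^2 / \<sigma>,
  with equality exactly on y = \<sigma> x. After integration only the second moments of the two
  marginals remain on the right.\<close>

lemma W2_gauss_ge:
  assumes s: "0 < \<sigma>"
    and fin: "(INF \<pi>\<in>couplings (density_measure (gauss_density 1 :: real^'n \<Rightarrow> real)) (density_measure (gauss_density (\<sigma>\<^sup>2))).
        \<integral>\<^sup>+ p. ennreal ((norm (fst p - snd p))\<^sup>2) \<partial>\<pi>) < \<infinity>"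
  shows "real CARD('n) * (1 - \<sigma>)\<^sup>2
    \<le> (W2 (density_measure (gauss_density 1 :: real^'n \<Rightarrow> real)) (density_measure (gauss_density (\<sigma>\<^sup>2))))\<^sup>2"
proof -
  let ?\<mu> = "density_measure (gauss_density 1 :: real^'n \<Rightarrow> real)"
  let ?\<nu> = "density_measure (gauss_density (\<sigma>\<^sup>2) :: real^'n \<Rightarrow> real)"
  let ?n = "real CARD('n)"
  have mom: "(\<integral>\<^sup>+x. ennreal ((norm x)\<^sup>2) \<partial>density_measure (gauss_density (r\<^sup>2) :: real^'n \<Rightarrow> real)) = ennreal (?n * r\<^sup>2)"
    if r: "0 < r" for r
  proof -
    have "(\<integral>\<^sup>+x. ennreal ((norm x)\<^sup>2) \<partial>density_measure (gauss_density (r\<^sup>2) :: real^'n \<Rightarrow> real))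
        = (\<integral>\<^sup>+x. ennreal (gauss_density (r\<^sup>2) (x :: real^'n) * (norm x)\<^sup>2) \<partial>lborel)"
      unfolding density_measure_def using r
      by (subst nn_integral_density) (auto intro!: nn_integral_cong simp: ennreal_mult gauss_density_pos less_imp_le)
    then show ?thesis using nn_integral_gauss_density_norm[OF r, where 'n='n] by simp
  qed
  have low: "ennreal (?n * (1 - \<sigma>)\<^sup>2) \<le> (\<integral>\<^sup>+ p. ennreal ((norm (fst p - snd p))\<^sup>2) \<partial>\<pi>)"
    if \<pi>: "\<pi> \<in> couplings ?\<mu> ?\<nu>" for \<pi>
  proof -
    have sets: "sets \<pi> = sets (borel \<Otimes>\<^sub>M borel)"
      using \<pi> by (auto simp: couplings_def density_measure_def intro!: sets_pair_measure_cong)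
    have [measurable]: "fst \<in> measurable \<pi> borel" "snd \<in> measurable \<pi> borel"
      by (simp_all add: measurable_cong_sets[OF sets refl])
    have m1: "(\<integral>\<^sup>+p. ennreal ((norm (fst p))\<^sup>2) \<partial>\<pi>) = ennreal ?n"
    proof -
      have "(\<integral>\<^sup>+p. ennreal ((norm (fst p))\<^sup>2) \<partial>\<pi>) = (\<integral>\<^sup>+x. ennreal ((norm x)\<^sup>2) \<partial>distr \<pi> ?\<mu> fst)"
        by (subst nn_integral_distr) (auto simp: density_measure_def)
      also have "distr \<pi> ?\<mu> fst = ?\<mu>" using \<pi> by (simp add: couplings_def)
      finally show ?thesis using mom[of 1] by simp
    qed
    have m2: "(\<integral>\<^sup>+p. ennreal ((norm (snd p))\<^sup>2) \<partial>\<pi>) = ennreal (?n * \<sigma>\<^sup>2)"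
    proof -
      have "(\<integral>\<^sup>+p. ennreal ((norm (snd p))\<^sup>2) \<partial>\<pi>) = (\<integral>\<^sup>+x. ennreal ((norm x)\<^sup>2) \<partial>distr \<pi> ?\<nu> snd)"
        by (subst nn_integral_distr) (auto simp: density_measure_def)
      also have "distr \<pi> ?\<nu> snd = ?\<nu>" using \<pi> by (simp add: couplings_def)
      finally show ?thesis using mom[OF s] by simp
    qed
    \<comment> \<open>The inequality is arranged with sums on both sides, so that it can be
      integrated in the extended nonnegative reals.\<close>
    have pt: "ennreal ((norm (fst p))\<^sup>2) + ennreal ((norm (snd p))\<^sup>2)
      \<le> ennreal ((norm (fst p - snd p))\<^sup>2) + (ennreal \<sigma> * ennreal ((norm (fst p))\<^sup>2) + ennreal (1 / \<sigma>) * ennreal ((norm (snd p))\<^sup>2))"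
      for p :: "(real^'n) \<times> (real^'n)"
    proof -
      obtain x y where p: "p = (x, y)" by (cases p)
      have "0 \<le> (norm (\<sigma> *\<^sub>R x - y))\<^sup>2 / \<sigma>" using s by simp
      also have "\<dots> = \<sigma> * (norm x)\<^sup>2 + (1 / \<sigma>) * (norm y)\<^sup>2 - 2 * (x \<bullet> y)"
        unfolding power2_norm_eq_inner using s
        by (simp add: inner_diff_left inner_diff_right inner_commute field_simps power2_eq_square)
      finally have "2 * (x \<bullet> y) \<le> \<sigma> * (norm x)\<^sup>2 + (1 / \<sigma>) * (norm y)\<^sup>2" by simp
      moreover have "(norm (x - y))\<^sup>2 = (norm x)\<^sup>2 + (norm y)\<^sup>2 - 2 * (x \<bullet> y)"
        unfolding power2_norm_eq_inner by (simp add: inner_diff_left inner_diff_right inner_commute)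
      ultimately have "(norm x)\<^sup>2 + (norm y)\<^sup>2 \<le> (norm (x - y))\<^sup>2 + (\<sigma> * (norm x)\<^sup>2 + (1 / \<sigma>) * (norm y)\<^sup>2)" by simp
      then have "ennreal ((norm x)\<^sup>2 + (norm y)\<^sup>2) \<le> ennreal ((norm (x - y))\<^sup>2 + (\<sigma> * (norm x)\<^sup>2 + (1 / \<sigma>) * (norm y)\<^sup>2))"
        by (rule ennreal_leI)
      then show ?thesis using s unfolding p fst_conv snd_conv
        by (simp add: ennreal_plus ennreal_mult del: times_divide_eq_left)
    qed
    have "ennreal (?n + ?n * \<sigma>\<^sup>2) = (\<integral>\<^sup>+p. ennreal ((norm (fst p))\<^sup>2) + ennreal ((norm (snd p))\<^sup>2) \<partial>\<pi>)"
      by (subst nn_integral_add) (auto simp: m1 m2 ennreal_plus)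
    also have "\<dots> \<le> (\<integral>\<^sup>+p. ennreal ((norm (fst p - snd p))\<^sup>2) + (ennreal \<sigma> * ennreal ((norm (fst p))\<^sup>2) + ennreal (1 / \<sigma>) * ennreal ((norm (snd p))\<^sup>2)) \<partial>\<pi>)"
      by (intro nn_integral_mono pt)
    also have "\<dots> = (\<integral>\<^sup>+p. ennreal ((norm (fst p - snd p))\<^sup>2) \<partial>\<pi>) + (ennreal \<sigma> * ennreal ?n + ennreal (1 / \<sigma>) * ennreal (?n * \<sigma>\<^sup>2))"
      by (simp add: nn_integral_add nn_integral_cmult m1 m2)
    also have "ennreal \<sigma> * ennreal ?n + ennreal (1 / \<sigma>) * ennreal (?n * \<sigma>\<^sup>2) = ennreal (2 * ?n * \<sigma>)"
    proof -
      have "ennreal \<sigma> * ennreal ?n + ennreal (1 / \<sigma>) * ennreal (?n * \<sigma>\<^sup>2) = ennreal (\<sigma> * ?n + (1 / \<sigma>) * (?n * \<sigma>\<^sup>2))"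
        using s by (subst ennreal_plus) (auto simp: ennreal_mult[symmetric])
      also have "\<sigma> * ?n + (1 / \<sigma>) * (?n * \<sigma>\<^sup>2) = 2 * ?n * \<sigma>" using s by (simp add: power2_eq_square)
      finally show ?thesis .
    qed
    finally have le: "ennreal (?n + ?n * \<sigma>\<^sup>2) \<le> (\<integral>\<^sup>+p. ennreal ((norm (fst p - snd p))\<^sup>2) \<partial>\<pi>) + ennreal (2 * ?n * \<sigma>)" .
    show ?thesis
    proof (cases "(\<integral>\<^sup>+p. ennreal ((norm (fst p - snd p))\<^sup>2) \<partial>\<pi>)")
      case (real r)
      then have "ennreal (?n + ?n * \<sigma>\<^sup>2) \<le> ennreal (r + 2 * ?n * \<sigma>)"
        using le s by (simp add: ennreal_plus)
      then have "?n + ?n * \<sigma>\<^sup>2 \<le> r + 2 * ?n * \<sigma>" using real s by (subst (asm) ennreal_le_iff) auto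
      then show ?thesis using real by (auto simp: power2_eq_square algebra_simps intro!: ennreal_leI)
    qed simp
  qed
  define I where "I = (INF \<pi>\<in>couplings ?\<mu> ?\<nu>. \<integral>\<^sup>+ p. ennreal ((norm (fst p - snd p))\<^sup>2) \<partial>\<pi>)"
  have "ennreal (?n * (1 - \<sigma>)\<^sup>2) \<le> I" unfolding I_def by (rule INF_greatest) (rule low)
  moreover obtain r where r: "I = ennreal r" "0 \<le> r" using fin unfolding I_def[symmetric] by (cases I) auto
  ultimately have "?n * (1 - \<sigma>)\<^sup>2 \<le> r" by simp
  moreover have "(W2 ?\<mu> ?\<nu>)\<^sup>2 = r" using r by (simp add: W2_def I_def)
  ultimately show ?thesis by simp
qed

lemma Ent_gauss_gauss:
  assumes s: "0 < \<sigma>"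
  shows "Ent (density_measure (gauss_density 1)) (\<lambda>x :: real^'n. gauss_density (\<sigma>\<^sup>2) x / gauss_density 1 x)
    = real CARD('n) / 2 * (\<sigma>\<^sup>2 - 1 - 2 * ln \<sigma>)"
proof -
  let ?n = "real CARD('n)" and ?f = "gauss_density (\<sigma>\<^sup>2) :: real^'n \<Rightarrow> real"
  have f0: "0 < ?f x" for x using s by (simp add: gauss_density_pos)
  have f: "has_bochner_integral lborel ?f 1"
    by (rule has_bochner_integral_nn_integral) (use nn_integral_gauss_density[OF s, where 'n='n] f0 in \<open>auto simp: less_imp_le\<close>)
  have m: "has_bochner_integral lborel (\<lambda>x. ?f x * (norm x)\<^sup>2) (?n * \<sigma>\<^sup>2)"
    by (rule has_bochner_integral_nn_integral) (use nn_integral_gauss_density_norm[OF s, where 'n='n] f0 in \<open>auto simp: less_imp_le\<close>)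
  \<comment> \<open>The logarithm of the quotient is affine in |x|^2, so mass and second moment of
    the Gaussian determine the entropy.\<close>
  have ln_eq: "?f x * ln (?f x / gauss_density 1 x) = (- ?n * ln \<sigma>) * ?f x + (1/2 - 1 / (2 * \<sigma>\<^sup>2)) * (?f x * (norm x)\<^sup>2)" for x
  proof -
    have "ln (?f x / gauss_density 1 x) = ln (?f x) - ln (gauss_density 1 x)"
      using f0[of x] gauss_density_pos[of 1 x] by (simp add: ln_div)
    also have "\<dots> = - ?n * ln \<sigma> + (1/2 - 1 / (2 * \<sigma>\<^sup>2)) * (norm x)\<^sup>2"
      using s by (simp add: ln_gauss_density ln_mult ln_realpow algebra_simps)
    finally have *: "ln (?f x / gauss_density 1 x) = - ?n * ln \<sigma> + (1/2 - 1 / (2 * \<sigma>\<^sup>2)) * (norm x)\<^sup>2" .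
    have "a * (b + k * z) = b * a + k * (a * z)" for a b k z :: real by (simp add: algebra_simps)
    then show ?thesis unfolding * .
  qed
  have "Ent (density_measure (gauss_density 1)) (\<lambda>x. ?f x / gauss_density 1 x) = (\<integral>x. ?f x * ln (?f x / gauss_density 1 x) \<partial>lborel)"
    by (rule Ent_gauss) (use f in \<open>auto simp: has_bochner_integral_iff\<close>)
  also have "\<dots> = (- ?n * ln \<sigma>) * 1 + (1/2 - 1 / (2 * \<sigma>\<^sup>2)) * (?n * \<sigma>\<^sup>2)"
    unfolding ln_eq
    by (intro has_bochner_integral_integral_eq has_bochner_integral_add has_bochner_integral_mult_right f m)
  also have "\<dots> = ?n / 2 * (\<sigma>\<^sup>2 - 1 - 2 * ln \<sigma>)" using s by (simp add: field_simps)
  finally show ?thesis .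
qed

text \<open>The function in question is constant: this Gaussian is the borderline case for both
  signs, so the transport bound applies to it as well.\<close>

lemma semi_log_cvx_on_space_gauss: "0 < \<sigma> \<Longrightarrow> semi_log_cvx_on_space \<epsilon> \<sigma> (gauss_density (\<sigma>\<^sup>2) :: real^'n \<Rightarrow> real)"
  by (simp add: semi_log_cvx_on_space_def ln_gauss_density convex_on_const)

section \<open>From Hessian bounds to convexity\<close>

lemma has_derivative_gradient:
  fixes v :: "real^'n \<Rightarrow> real"
  assumes "v differentiable (at x)"
  shows "(v has_derivative (\<lambda>h. gradient v x \<bullet> h)) (at x)"
proof -
  let ?D = "frechet_derivative v (at x)"
  have D: "(v has_derivative ?D) (at x)" using assms by (simp add: frechet_derivative_works)
  then have lin: "linear ?D" by (rule has_derivative_linear)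
  have "?D h = gradient v x \<bullet> h" for h
  proof -
    have "?D h = ?D (\<Sum>i\<in>UNIV. (h $ i) *\<^sub>R axis i 1)"
      using basis_expansion[of h] by (simp add: scalar_mult_eq_scaleR)
    also have "\<dots> = (\<Sum>i\<in>UNIV. (h $ i) * ?D (axis i 1))"
      using lin by (simp add: linear_sum linear_scale)
    also have "\<dots> = gradient v x \<bullet> h" by (simp add: gradient_def inner_vec_def mult.commute)
    finally show ?thesis .
  qed
  with D show ?thesis by (metis (no_types, lifting) ext)
qed

text \<open>The gradient of ln v is the quotient of the gradient of v by v, again differentiable as
  v is positive. It makes the Hessian of ln v a genuine derivative.\<close>

lemma twice_differentiable_ln:
  fixes v :: "real^'n \<Rightarrow> real"
  assumes td: "twice_differentiable v" and v0: "\<And>x. 0 < v x"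
  shows "twice_differentiable (\<lambda>y. ln (v y))"
proof -
  have dv: "(v has_derivative (\<lambda>h. gradient v x \<bullet> h)) (at x)" for x
    using td by (intro has_derivative_gradient) (simp add: twice_differentiable_def)
  have dl: "((\<lambda>y. ln (v y)) has_derivative (\<lambda>h. (gradient v x \<bullet> h) / v x)) (at x)" for x
    using has_derivative_ln[OF _ dv[of x]] v0[of x] by (simp add: divide_inverse mult.commute)
  have g: "gradient (\<lambda>y. ln (v y)) x = (1 / v x) *\<^sub>R gradient v x" for x
    unfolding gradient_def[of "\<lambda>y. ln (v y)"] frechet_derivative_at[OF dl, symmetric]
    by (simp add: vec_eq_iff inner_axis)
  have "(\<lambda>x. (1 / v x) *\<^sub>R gradient v x) differentiable (at x)" for x
  proof (intro differentiable_scaleR differentiable_divide)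
    show "v differentiable at x" "gradient v differentiable at x"
      using td by (auto simp: twice_differentiable_def)
    show "v x \<noteq> 0" using v0[of x] by simp
  qed simp
  then have "gradient (\<lambda>y. ln (v y)) differentiable (at x)" for x
    unfolding g[abs_def] .
  then show ?thesis using dl unfolding twice_differentiable_def differentiable_def by blast
qed

text \<open>Along a line with direction w, the second derivative of the function in question is the
  quadratic form assumed nonnegative. The one-dimensional criterion asks for this derivative at each
  point, without continuity.\<close>

lemma semi_log_cvx_on_space_of_hessian:
  fixes v :: "real^'n \<Rightarrow> real"
  assumes td: "twice_differentiable v" and v0: "\<And>x. 0 < v x" and s: "0 < \<sigma>"
    and H: "\<And>x w. 0 \<le> \<epsilon> * (w \<bullet> (hessian (\<lambda>y. ln (v y)) x *v w) + (w \<bullet> w) / \<sigma>\<^sup>2)"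
  shows "semi_log_cvx_on_space \<epsilon> \<sigma> v"
  unfolding semi_log_cvx_on_space_def
proof (rule convex_onI)
  let ?L = "\<lambda>y. ln (v y)"
  let ?\<psi> = "\<lambda>x. \<epsilon> * (?L x + (norm x)\<^sup>2 / (2 * \<sigma>\<^sup>2))"
  note tl = twice_differentiable_ln[OF td v0]
  have d1: "(?L has_derivative (\<lambda>h. gradient ?L x \<bullet> h)) (at x)" for x
    using tl by (intro has_derivative_gradient) (simp add: twice_differentiable_def)
  have d2: "(gradient ?L has_derivative (\<lambda>h. hessian ?L x *v h)) (at x)" for x
    using tl unfolding hessian_def twice_differentiable_def by (simp add: jacobian_works)
  fix l :: real and x y :: "real^'n" assume l: "0 < l" "l < 1"
  define w where "w = y - x"
  define c where "c t = x + t *\<^sub>R w" for t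
  have dc: "(c has_derivative (\<lambda>t. t *\<^sub>R w)) (at t)" for t
    unfolding c_def by (auto intro!: derivative_eq_intros)
  have "convex_on UNIV (\<lambda>t. ?\<psi> (c t))"
  proof (rule f''_ge0_imp_convex)
    fix t
    have e1: "((\<lambda>t. ?L (c t)) has_derivative (\<lambda>h. gradient ?L (c t) \<bullet> (h *\<^sub>R w))) (at t)"
      using has_derivative_compose[OF dc d1] .
    have e2: "((\<lambda>t. gradient ?L (c t)) has_derivative (\<lambda>h. hessian ?L (c t) *v (h *\<^sub>R w))) (at t)"
      using has_derivative_compose[OF dc d2] .
    have n: "(norm z)\<^sup>2 = z \<bullet> z" for z :: "real^'n" by (rule power2_norm_eq_inner)
    have e3: "((\<lambda>t. c t \<bullet> c t) has_derivative (\<lambda>h. c t \<bullet> (h *\<^sub>R w) + (h *\<^sub>R w) \<bullet> c t)) (at t)"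
      by (rule has_derivative_inner[OF dc dc])
    have "?\<psi> z = \<epsilon> * (?L z + 1 / (2 * \<sigma>\<^sup>2) * (z \<bullet> z))" for z unfolding n by simp
    then have "((\<lambda>t. ?\<psi> (c t)) has_derivative
        (\<lambda>h. \<epsilon> * (gradient ?L (c t) \<bullet> (h *\<^sub>R w) + 1 / (2 * \<sigma>\<^sup>2) * (c t \<bullet> (h *\<^sub>R w) + (h *\<^sub>R w) \<bullet> c t)))) (at t)"
      using has_derivative_mult_right[OF has_derivative_add[OF e1 has_derivative_mult_right[OF e3, of "1 / (2 * \<sigma>\<^sup>2)"]], of \<epsilon>]
      by (simp only:)
    moreover have "(\<lambda>h. \<epsilon> * (gradient ?L (c t) \<bullet> (h *\<^sub>R w) + 1 / (2 * \<sigma>\<^sup>2) * (c t \<bullet> (h *\<^sub>R w) + (h *\<^sub>R w) \<bullet> c t)))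
       = (*) (\<epsilon> * (gradient ?L (c t) \<bullet> w + (c t \<bullet> w) / \<sigma>\<^sup>2))"
      using s by (auto simp: fun_eq_iff inner_commute[of w] field_simps)
    ultimately show "DERIV (\<lambda>t. ?\<psi> (c t)) t :> \<epsilon> * (gradient ?L (c t) \<bullet> w + (c t \<bullet> w) / \<sigma>\<^sup>2)"
      by (simp add: has_field_derivative_def)
    have "((\<lambda>t. \<epsilon> * (gradient ?L (c t) \<bullet> w + (c t \<bullet> w) / \<sigma>\<^sup>2)) has_derivative
      (\<lambda>h. \<epsilon> * ((hessian ?L (c t) *v (h *\<^sub>R w)) \<bullet> w + ((h *\<^sub>R w) \<bullet> w) / \<sigma>\<^sup>2))) (at t)"
      using has_derivative_mult_right[OF has_derivative_add[OF has_derivative_inner_left[OF e2, of w]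
          has_derivative_mult_right[OF has_derivative_inner_left[OF dc, of w], of "1 / \<sigma>\<^sup>2"]], of \<epsilon>]
      by simp
    moreover have "(\<lambda>h. \<epsilon> * ((hessian ?L (c t) *v (h *\<^sub>R w)) \<bullet> w + ((h *\<^sub>R w) \<bullet> w) / \<sigma>\<^sup>2))
       = (*) (\<epsilon> * (w \<bullet> (hessian ?L (c t) *v w) + (w \<bullet> w) / \<sigma>\<^sup>2))"
      by (auto simp: fun_eq_iff inner_commute matrix_vector_mult_scaleR field_simps)
    ultimately show "DERIV (\<lambda>t. \<epsilon> * (gradient ?L (c t) \<bullet> w + (c t \<bullet> w) / \<sigma>\<^sup>2)) t :> \<epsilon> * (w \<bullet> (hessian ?L (c t) *v w) + (w \<bullet> w) / \<sigma>\<^sup>2)"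
      by (simp add: has_field_derivative_def)
    show "0 \<le> \<epsilon> * (w \<bullet> (hessian ?L (c t) *v w) + (w \<bullet> w) / \<sigma>\<^sup>2)" by (rule H)
  qed simp
  from convex_onD[OF this, of l 0 1] l
  have "?\<psi> (c l) \<le> (1 - l) * ?\<psi> (c 0) + l * ?\<psi> (c 1)" by simp
  moreover have "c l = (1 - l) *\<^sub>R x + l *\<^sub>R y" "c 0 = x" "c 1 = y"
    by (auto simp: c_def w_def algebra_simps)
  ultimately show "?\<psi> ((1 - l) *\<^sub>R x + l *\<^sub>R y) \<le> (1 - l) * ?\<psi> x + l * ?\<psi> y" by simp
qed simp

theorem theorem1p5:
  fixes v :: "real^'n \<Rightarrow> real" and \<beta> :: real
  assumes beta_pos: "\<beta> > 0"
    and v_pos: "\<And>x. v x > 0"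
    and v_diff: "twice_differentiable v"
    and v_prob: "integrable lborel v" "(\<integral>x. v x \<partial>lborel) = 1"
    and v_moment: "integrable lborel (\<lambda>x. (norm x)\<^sup>2 * v x)"
    and cases:
      "(\<beta> > 1 \<and>
          (\<forall>x. loewner_le (hessian (\<lambda>y. ln (v y)) x) 0 \<and>
               loewner_le ((- (1 / \<beta>)) *\<^sub>R mat 1) (hessian (\<lambda>y. ln (v y)) x))) \<or>
       (\<beta> < 1 \<and> semi_log_concave \<beta> v)"
  shows "(1 / 2) * (W2 (density_measure (gauss_density 1 :: real^'n \<Rightarrow> real)) (density_measure v))\<^sup>2
           - Ent (density_measure (gauss_density 1 :: real^'n \<Rightarrow> real))
               (\<lambda>x. v x / gauss_density 1 x)
         \<le> (1 / 2) * (W2 (density_measure (gauss_density 1 :: real^'n \<Rightarrow> real))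
                         (density_measure (gauss_density \<beta>)))\<^sup>2
           - Ent (density_measure (gauss_density 1 :: real^'n \<Rightarrow> real))
               (\<lambda>x. gauss_density \<beta> x / gauss_density 1 x)"
proof -
  define \<sigma> where "\<sigma> = sqrt \<beta>"
  have s: "0 < \<sigma>" and \<beta>: "\<beta> = \<sigma>\<^sup>2" using beta_pos by (auto simp: \<sigma>_def)
  \<comment> \<open>The sign selects between semi-log-convexity and semi-log-concavity; both
    alternatives exclude \<beta> = 1.\<close>
  define \<epsilon> :: real where "\<epsilon> = (if 1 < \<beta> then 1 else - 1)"
  have es: "(\<epsilon> = 1 \<and> 1 < \<sigma>) \<or> (\<epsilon> = - 1 \<and> \<sigma> < 1)"
    using cases beta_pos by (auto simp: \<epsilon>_def \<sigma>_def)
  have mat: "w \<bullet> (((- (1 / \<beta>)) *\<^sub>R mat 1) *v w) = - (w \<bullet> w) / \<sigma>\<^sup>2" for w :: "real^'n"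
    unfolding scaleR_matrix_vector_assoc[symmetric] matrix_vector_mul_lid by (simp add: \<beta>)
  have cv: "semi_log_cvx_on_space \<epsilon> \<sigma> v"
  proof (rule semi_log_cvx_on_space_of_hessian[OF v_diff v_pos s])
    fix x w
    show "0 \<le> \<epsilon> * (w \<bullet> (hessian (\<lambda>y. ln (v y)) x *v w) + (w \<bullet> w) / \<sigma>\<^sup>2)"
      using cases
    proof
      assume a: "\<beta> > 1 \<and> (\<forall>x. loewner_le (hessian (\<lambda>y. ln (v y)) x) 0 \<and>
               loewner_le ((- (1 / \<beta>)) *\<^sub>R mat 1) (hessian (\<lambda>y. ln (v y)) x))"
      then have "w \<bullet> (((- (1 / \<beta>)) *\<^sub>R mat 1) *v w) \<le> w \<bullet> (hessian (\<lambda>y. ln (v y)) x *v w)"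
        unfolding loewner_le_def by blast
      then show ?thesis using a unfolding mat by (simp add: \<epsilon>_def)
    next
      assume a: "\<beta> < 1 \<and> semi_log_concave \<beta> v"
      then have "w \<bullet> (hessian (\<lambda>y. ln (v y)) x *v w) \<le> w \<bullet> (((- (1 / \<beta>)) *\<^sub>R mat 1) *v w)"
        unfolding semi_log_concave_def loewner_le_def by blast
      then show ?thesis using a unfolding mat by (simp add: \<epsilon>_def)
    qed
  qed
  have "v \<in> borel_measurable borel"
    using v_diff differentiable_imp_continuous_within
    by (intro borel_measurable_continuous_onI) (auto simp: twice_differentiable_def continuous_on_eq_continuous_within)
  moreover have "integrable lborel (\<lambda>x. v x * (norm x)\<^sup>2)" using v_moment by (simp add: mult.commute)
  ultimately have upper: "(W2 (density_measure (gauss_density 1)) (density_measure v))\<^sup>2 + 2 * real CARD('n) * (\<sigma> - 1 - ln \<sigma>)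
       \<le> 2 * Ent (density_measure (gauss_density 1)) (\<lambda>x. v x / gauss_density 1 x)"
    using W2_le_Ent(2)[OF s es _ v_pos v_prob _ cv] by blast
  let ?g = "gauss_density (\<sigma>\<^sup>2) :: real^'n \<Rightarrow> real"
  have g0: "0 < ?g x" for x using s by (simp add: gauss_density_pos)
  have "has_bochner_integral lborel ?g 1"
    by (rule has_bochner_integral_nn_integral) (use nn_integral_gauss_density[OF s, where 'n='n] g0 in \<open>auto simp: less_imp_le\<close>)
  moreover have "has_bochner_integral lborel (\<lambda>x. ?g x * (norm x)\<^sup>2) (real CARD('n) * \<sigma>\<^sup>2)"
    by (rule has_bochner_integral_nn_integral) (use nn_integral_gauss_density_norm[OF s, where 'n='n] g0 in \<open>auto simp: less_imp_le\<close>)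
  \<comment> \<open>The transport bound applied to \<gamma>_\<beta> itself supplies the finiteness
    that the lower bound on its distance requires.\<close>
  ultimately have "(INF \<pi>\<in>couplings (density_measure (gauss_density 1)) (density_measure ?g).
        \<integral>\<^sup>+ p. ennreal ((norm (fst p - snd p))\<^sup>2) \<partial>\<pi>) < \<infinity>"
    by (intro W2_le_Ent(1)[OF s es _ g0 _ _ _ semi_log_cvx_on_space_gauss[OF s]]) (auto simp: has_bochner_integral_iff)
  then have lower: "real CARD('n) * (1 - \<sigma>)\<^sup>2 \<le> (W2 (density_measure (gauss_density 1)) (density_measure ?g))\<^sup>2"
    by (rule W2_gauss_ge[OF s])
  have "(1 / 2) * (W2 (density_measure (gauss_density 1)) (density_measure v))\<^sup>2
      - Ent (density_measure (gauss_density 1)) (\<lambda>x. v x / gauss_density 1 x)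
    \<le> - (real CARD('n) * (\<sigma> - 1 - ln \<sigma>))"
    using upper by simp
  \<comment> \<open>The intermediate value is exactly half the squared cost of the linear map x to
    \<sigma> x minus the entropy of \<gamma>_\<beta>.\<close>
  also have "\<dots> = (1 / 2) * (real CARD('n) * (1 - \<sigma>)\<^sup>2) - real CARD('n) / 2 * (\<sigma>\<^sup>2 - 1 - 2 * ln \<sigma>)"
    by (simp add: power2_eq_square algebra_simps)
  also have "\<dots> \<le> (1 / 2) * (W2 (density_measure (gauss_density 1)) (density_measure ?g))\<^sup>2
      - Ent (density_measure (gauss_density 1)) (\<lambda>x. ?g x / gauss_density 1 x)"
    unfolding Ent_gauss_gauss[OF s] using lower by simp
  finally show ?thesis unfolding \<beta> .
qed

end
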